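(* Let $\Lambda$ be a domestic string algebra and let $b_0\xrightarrow{u_1}b_1\xrightarrow{u_2}b_2\xrightarrow{u_3}b_3$ be a sequence of non-trivial weak arch bridges. Then $u_3\circ_H(u_2\circ_H u_1)=(u_3\circ_H u_2)\circ_H u_1$.
   Context: STRINGS. $\mathcal K$ is an algebraically closed field. A string algebra is $\Lambda=\mathcal K\mathcal Q/\langle\rho\rangle$ with $\mathcal Q=(Q_0,Q_1,s,t)$ a finite quiver and $\rho$ a set of paths of length $\ge2$, none a subpath of another, such that: every vertex is the source of at most two and the target of at most two arrows; for every arrow $b$ there is at most one arrow $a$ with $s(a)=t(b)$, $ab\notin\rho$, and at most one arrow $c$ with $t(c)=s(b)$, $bc\notin\rho$; all sufficiently long paths have a subpath in $\rho$. Words are composed from right to left. Fix $\sigma,\varepsilon:Q_1\to\{1,-1\}$ with $\sigma(a)=-\sigma(b)$ for distinct arrows with the same source, $\varepsilon(a)=-\varepsilon(b)$ for distinct arrows with the same target, and $\sigma(a)=-\varepsilon(b)$ whenever $s(a)=t(b)$ and $ab\notin\rho$. Syllables are arrows (direct) and their formal inverses (inverse), with $s(a^{-1})=t(a)$, $t(a^{-1})=s(a)$, $\sigma(a^{-1})=\varepsilon(a)$, $\varepsilon(a^{-1})=\sigma(a)$. A string of length $n>0$ is a word $\alpha_n\cdots\alpha_1$ of syllables with $s(\alpha_{i+1})=t(\alpha_i)$, $\alpha_{i+1}\ne\alpha_i^{-1}$, and no subword in $\rho\cup\rho^{-1}$; its first syllable is $\alpha_1$ (determining $s,\sigma$) and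 its last is $\alpha_n$ (determining $t,\varepsilon$). For each vertex $v$ and $i\in\{1,-1\}$ there is a length-$0$ string $1_{(v,i)}$ with $s=t=v$, $\sigma=-i$, $\varepsilon=i$; $x1_{(v,i)}=x$ is defined iff $s(x)=v,\sigma(x)=-i$, and $1_{(v,i)}x=x$ is defined iff $t(x)=v,\varepsilon(x)=i$. A band is a string $b$ with $s(b)=t(b)$ whose first syllable is inverse and last syllable is direct, such that $b^n$ is a string for all $n\ge1$ and $b$ is not a proper power of a string. $\Lambda$ is domestic if it has only finitely many bands. A string is band-free if no substring of it is a cyclic permutation of a band. REDUCTIONS. For a band $b$ and a string $y$, $N(b,y)$ is the largest $n$ with $y=y_2(b')^ny_1$ for some strings $y_1,y_2$ and some cyclic permutation $b'$ of $b$; $\mathfrak B(y)$ is the set of bands $b$ (up to cyclic permutation) with $N(b,y)>0$. A 1-step $b$-reduction of $y$ is a string of the form $y_2y_1$ where $y=y_2b'y_1$ with $b'$ a cyclic permutation of $b$; when it exists it is denoted $\mathrm R_b(y)$. The skeleton $\{y\}$ of $y$ is obtained by applying, for every $b\in\mathfrak B(y)$, the operation $\mathrm R_b$ exactly $N(b,y)-1$ times. H-REDUCTIONS. Strings $y_1,y_2$ are H-equivalent, $y_1\equiv_H y_2$, if $t(y_1)=t(y_2)$ and for each string $x$ with $s(x)=t(y_1)$, $xy_1$ is a string iff $xy_2$ is a string. A 1-step H-reduction of $y$ is a string $y_2y_1$, where $y=y_2b'y_1$ with $b'$ a cyclic permutation of a band and $b'y_1\equiv_H y_1$. For a band $b$,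 set $\mathfrak h_b(y)=\mathrm R_b(y)$ if $b\in\mathfrak B(y)$, $\mathrm R_b(y)$ exists and is a 1-step H-reduction of $y$; otherwise $\mathfrak h_b(y)=y$. WEAK BRIDGES. Fix a set $Q_0^{\mathrm{Ba}}$ of representatives of bands up to cyclic permutation. For $b_1,b_2\in Q_0^{\mathrm{Ba}}$, a weak bridge $u:b_1\to b_2$ is a band-free string $u$ such that $b_2ub_1$ is a string, excluding the trivial ones $1_{(t(b),\varepsilon(b))}:b\to b$; write $\mathfrak s(u)=b_1$, $\mathfrak t(u)=b_2$. The weak bridge quiver $\overline{\mathcal Q}^{\mathrm{Ba}}$ has vertex set $Q_0^{\mathrm{Ba}}$ and the weak bridges as arrows. WEAK ARCH BRIDGES AND H-COMPOSITION. For a path $P=(u_1,\dots,u_n)$, $n\ge1$, in $\overline{\mathcal Q}^{\mathrm{Ba}}$ (so $\mathfrak t(u_j)=\mathfrak s(u_{j+1})$), with $\mathfrak s(P)=\mathfrak s(u_1)$ and $\mathfrak t(P)=\mathfrak t(u_n)$, the string $\mathfrak h(P)$ is defined by $$\mathfrak t(P)\,\mathfrak h(P)\,\mathfrak s(P)=\mathfrak h_{\mathfrak t(u_1)}\cdots\mathfrak h_{\mathfrak t(u_{n-1})}\big(\{\mathfrak t(u_n)u_n\cdots\mathfrak t(u_1)u_1\mathfrak s(u_1)\}\big).$$ A (non-trivial) weak arch bridge $b\to b'$ is a string $\mathfrak h(P)$ for some such path $P$ with $\mathfrak s(P)=b$, $\mathfrak t(P)=b'$, regarded as an arrow from $b$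 to $b'$. For paths $P_1,P_2$ in $\overline{\mathcal Q}^{\mathrm{Ba}}$ with $\mathfrak t(P_1)=\mathfrak s(P_2)$ let $P_1+P_2$ be the concatenated path ($P_1$ first), and define $$\mathfrak h(P_2)\circ_H\mathfrak h(P_1):=\mathfrak h(P_1+P_2).$$ This is understood as an operation on weak arch bridges, i.e. the value depends only on the weak arch bridges $\mathfrak h(P_1),\mathfrak h(P_2)$ with their sources and targets. *)

theory Defs
  imports "Graph_Theory.Graph_Theory" "HOL-Library.Sublist"
begin

section \<open>String algebras\<close>

text \<open>
  A string algebra \<open>K Q / (\<rho>)\<close> is represented by its presentation \<open>(Q, \<rho>)\<close> together with the
  chosen sign functions \<open>\<sigma>, \<epsilon>\<close>.  Strings, bands, domesticity and everything below are defined from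
  these data alone; the algebraically closed field \<open>K\<close> does not enter.

  Words are written, as usual, from right to left, and a word \<open>\<alpha>\<^sub>n \<dots> \<alpha>\<^sub>1\<close> is the list
  \<open>[\<alpha>\<^sub>n, \<dots>, \<alpha>\<^sub>1]\<close>: juxtaposition is \<open>@\<close>, the first syllable is \<open>last\<close>, the last one is \<open>hd\<close>.
\<close>

record ('v, 'a) string_pres =
  quiver :: "('v, 'a) pre_digraph"
  rels :: "'a list set"
  sigma :: "'a \<Rightarrow> int"
  epsilon :: "'a \<Rightarrow> int"

definition is_path :: "('v, 'a) string_pres \<Rightarrow> 'a list \<Rightarrow> bool" where
  "is_path \<Lambda> p \<longleftrightarrow> p \<noteq> [] \<and> (\<exists>u v. pre_digraph.awalk (quiver \<Lambda>) u (rev p) v)"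

locale string_algebra = fin_digraph "quiver \<Lambda>"
  for \<Lambda> :: "('v, 'a) string_pres" +
  assumes rels_path: "r \<in> rels \<Lambda> \<Longrightarrow> is_path \<Lambda> r \<and> length r \<ge> 2"
    and rels_minimal: "\<lbrakk>r \<in> rels \<Lambda>; r' \<in> rels \<Lambda>; sublist r r'\<rbrakk> \<Longrightarrow> r = r'"
    and out_le_2: "v \<in> verts (quiver \<Lambda>) \<Longrightarrow> out_degree (quiver \<Lambda>) v \<le> 2"
    and in_le_2: "v \<in> verts (quiver \<Lambda>) \<Longrightarrow> in_degree (quiver \<Lambda>) v \<le> 2"
    and left_unique: "b \<in> arcs (quiver \<Lambda>) \<Longrightarrow>
      card {a \<in> arcs (quiver \<Lambda>). tail (quiver \<Lambda>) a = head (quiver \<Lambda>) b \<and> [a, b] \<notin> rels \<Lambda>} \<le> 1"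
    and right_unique: "b \<in> arcs (quiver \<Lambda>) \<Longrightarrow>
      card {c \<in> arcs (quiver \<Lambda>). head (quiver \<Lambda>) c = tail (quiver \<Lambda>) b \<and> [b, c] \<notin> rels \<Lambda>} \<le> 1"
    and long_paths: "\<exists>n. \<forall>p. is_path \<Lambda> p \<and> length p \<ge> n \<longrightarrow> (\<exists>r \<in> rels \<Lambda>. sublist r p)"
    and signs: "a \<in> arcs (quiver \<Lambda>) \<Longrightarrow> sigma \<Lambda> a \<in> {1, -1} \<and> epsilon \<Lambda> a \<in> {1, -1}"
    and sigma_opposite: "\<lbrakk>a \<in> arcs (quiver \<Lambda>); b \<in> arcs (quiver \<Lambda>); a \<noteq> b;
      tail (quiver \<Lambda>) a = tail (quiver \<Lambda>) b\<rbrakk> \<Longrightarrow> sigma \<Lambda> a = - sigma \<Lambda> b"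
    and epsilon_opposite: "\<lbrakk>a \<in> arcs (quiver \<Lambda>); b \<in> arcs (quiver \<Lambda>); a \<noteq> b;
      head (quiver \<Lambda>) a = head (quiver \<Lambda>) b\<rbrakk> \<Longrightarrow> epsilon \<Lambda> a = - epsilon \<Lambda> b"
    and sigma_epsilon: "\<lbrakk>a \<in> arcs (quiver \<Lambda>); b \<in> arcs (quiver \<Lambda>);
      tail (quiver \<Lambda>) a = head (quiver \<Lambda>) b; [a, b] \<notin> rels \<Lambda>\<rbrakk> \<Longrightarrow> sigma \<Lambda> a = - epsilon \<Lambda> b"

section \<open>Strings\<close>

datatype 'a syl = Dir 'a | Inv 'a

fun inv_syl :: "'a syl \<Rightarrow> 'a syl" where
  "inv_syl (Dir a) = Inv a"
| "inv_syl (Inv a) = Dir a"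

fun syl_arc :: "'a syl \<Rightarrow> 'a" where
  "syl_arc (Dir a) = a"
| "syl_arc (Inv a) = a"

fun syl_src :: "('v, 'a) string_pres \<Rightarrow> 'a syl \<Rightarrow> 'v" where
  "syl_src \<Lambda> (Dir a) = tail (quiver \<Lambda>) a"
| "syl_src \<Lambda> (Inv a) = head (quiver \<Lambda>) a"

fun syl_tgt :: "('v, 'a) string_pres \<Rightarrow> 'a syl \<Rightarrow> 'v" where
  "syl_tgt \<Lambda> (Dir a) = head (quiver \<Lambda>) a"
| "syl_tgt \<Lambda> (Inv a) = tail (quiver \<Lambda>) a"

fun syl_sigma :: "('v, 'a) string_pres \<Rightarrow> 'a syl \<Rightarrow> int" where
  "syl_sigma \<Lambda> (Dir a) = sigma \<Lambda> a"
| "syl_sigma \<Lambda> (Inv a) = epsilon \<Lambda> a"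

fun syl_epsilon :: "('v, 'a) string_pres \<Rightarrow> 'a syl \<Rightarrow> int" where
  "syl_epsilon \<Lambda> (Dir a) = epsilon \<Lambda> a"
| "syl_epsilon \<Lambda> (Inv a) = sigma \<Lambda> a"

text \<open>\<open>Triv v i\<close> is the string \<open>1\<^bsub>(v,i)\<^esub>\<close> of length 0; strings of positive length are nonempty words.\<close>

datatype ('v, 'a) str = Triv 'v int | Word "'a syl list"

fun src :: "('v, 'a) string_pres \<Rightarrow> ('v, 'a) str \<Rightarrow> 'v" where
  "src \<Lambda> (Triv v i) = v"
| "src \<Lambda> (Word w) = syl_src \<Lambda> (last w)"

fun tgt :: "('v, 'a) string_pres \<Rightarrow> ('v, 'a) str \<Rightarrow> 'v" where
  "tgt \<Lambda> (Triv v i) = v"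
| "tgt \<Lambda> (Word w) = syl_tgt \<Lambda> (hd w)"

fun str_sigma :: "('v, 'a) string_pres \<Rightarrow> ('v, 'a) str \<Rightarrow> int" where
  "str_sigma \<Lambda> (Triv v i) = - i"
| "str_sigma \<Lambda> (Word w) = syl_sigma \<Lambda> (last w)"

fun str_epsilon :: "('v, 'a) string_pres \<Rightarrow> ('v, 'a) str \<Rightarrow> int" where
  "str_epsilon \<Lambda> (Triv v i) = i"
| "str_epsilon \<Lambda> (Word w) = syl_epsilon \<Lambda> (hd w)"

fun is_string :: "('v, 'a) string_pres \<Rightarrow> ('v, 'a) str \<Rightarrow> bool" where
  "is_string \<Lambda> (Triv v i) \<longleftrightarrow> v \<in> verts (quiver \<Lambda>) \<and> i \<in> {1, -1}"
| "is_string \<Lambda> (Word w) \<longleftrightarrow> w \<noteq> [] \<and> syl_arc ` set w \<subseteq> arcs (quiver \<Lambda>) \<and>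
     successively (\<lambda>\<beta> \<alpha>. syl_src \<Lambda> \<beta> = syl_tgt \<Lambda> \<alpha> \<and> \<beta> \<noteq> inv_syl \<alpha>) w \<and>
     (\<forall>r \<in> rels \<Lambda>. \<not> sublist (map Dir r) w \<and> \<not> sublist (map Inv (rev r)) w)"

text \<open>
  \<open>cat x y\<close> is the product \<open>xy\<close>; it is meaningful only if \<open>composes \<Lambda> x y\<close>, i.e. if \<open>x\<close> and \<open>y\<close> are
  strings whose product is defined and is a string.  The second case of \<open>composes\<close> covers products
  with strings of length 0: \<open>x 1\<^bsub>(v,i)\<^esub>\<close> is defined iff \<open>s(x) = v\<close> and \<open>\<sigma>(x) = -i\<close>, and \<open>1\<^bsub>(v,i)\<^esub> y\<close>
  iff \<open>t(y) = v\<close> and \<open>\<epsilon>(y) = i\<close>.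
\<close>

fun cat :: "('v, 'a) str \<Rightarrow> ('v, 'a) str \<Rightarrow> ('v, 'a) str" where
  "cat (Word x) (Word y) = Word (x @ y)"
| "cat x (Triv v i) = x"
| "cat (Triv v i) y = y"

definition composes :: "('v, 'a) string_pres \<Rightarrow> ('v, 'a) str \<Rightarrow> ('v, 'a) str \<Rightarrow> bool" where
  "composes \<Lambda> x y \<longleftrightarrow> is_string \<Lambda> x \<and> is_string \<Lambda> y \<and>
     (case (x, y) of
        (Word p, Word q) \<Rightarrow> is_string \<Lambda> (Word (p @ q))
      | _ \<Rightarrow> src \<Lambda> x = tgt \<Lambda> y \<and> str_sigma \<Lambda> x = - str_epsilon \<Lambda> y)"

text \<open>\<open>factors \<Lambda> y x z w\<close>: the product \<open>x z w\<close> of strings is a string and equals \<open>y\<close>.\<close>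

definition factors ::
    "('v, 'a) string_pres \<Rightarrow> ('v, 'a) str \<Rightarrow> ('v, 'a) str \<Rightarrow> ('v, 'a) str \<Rightarrow> ('v, 'a) str \<Rightarrow> bool" where
  "factors \<Lambda> y x z w \<longleftrightarrow> composes \<Lambda> z w \<and> composes \<Lambda> x (cat z w) \<and> y = cat x (cat z w)"

text \<open>Used for \<open>n \<ge> 1\<close> only.\<close>

fun str_pow :: "('v, 'a) str \<Rightarrow> nat \<Rightarrow> ('v, 'a) str" where
  "str_pow (Triv v i) n = Triv v i"
| "str_pow (Word w) n = Word (concat (replicate n w))"

section \<open>Bands\<close>

definition is_band :: "('v, 'a) string_pres \<Rightarrow> ('v, 'a) str \<Rightarrow> bool" where
  "is_band \<Lambda> b \<longleftrightarrow> is_string \<Lambda> b \<and> src \<Lambda> b = tgt \<Lambda> b \<and>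
     (\<exists>w. b = Word w \<and> (\<exists>a. last w = Inv a) \<and> (\<exists>a. hd w = Dir a)) \<and>
     (\<forall>n \<ge> 1. is_string \<Lambda> (str_pow b n)) \<and>
     \<not> (\<exists>x n. is_string \<Lambda> x \<and> n \<ge> 2 \<and> b = str_pow x n)"

definition cyclic_perm :: "('v, 'a) str \<Rightarrow> ('v, 'a) str \<Rightarrow> bool" where
  "cyclic_perm b' b \<longleftrightarrow> (\<exists>w k. b = Word w \<and> b' = Word (rotate k w))"

definition domestic :: "('v, 'a) string_pres \<Rightarrow> bool" where
  "domestic \<Lambda> \<longleftrightarrow> finite {b. is_band \<Lambda> b}"

definition band_free :: "('v, 'a) string_pres \<Rightarrow> ('v, 'a) str \<Rightarrow> bool" where
  "band_free \<Lambda> y \<longleftrightarrow>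
     \<not> (\<exists>b b' y1 y2. is_band \<Lambda> b \<and> cyclic_perm b' b \<and> factors \<Lambda> y y2 b' y1)"

text \<open>\<open>Ba\<close> is a set of representatives of the bands up to cyclic permutation.\<close>

definition band_representatives :: "('v, 'a) string_pres \<Rightarrow> ('v, 'a) str set \<Rightarrow> bool" where
  "band_representatives \<Lambda> Ba \<longleftrightarrow> (\<forall>b \<in> Ba. is_band \<Lambda> b) \<and>
     (\<forall>b. is_band \<Lambda> b \<longrightarrow> (\<exists>!c. c \<in> Ba \<and> cyclic_perm c b))"

section \<open>Reductions\<close>

definition band_count :: "('v, 'a) string_pres \<Rightarrow> ('v, 'a) str \<Rightarrow> ('v, 'a) str \<Rightarrow> nat" where
  "band_count \<Lambda> b y =
     Max (insert 0 {n. n \<ge> 1 \<and> (\<exists>b' y1 y2. cyclic_perm b' b \<and> factors \<Lambda> y y2 (str_pow b' n) y1)})"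

definition bands_in :: "('v, 'a) string_pres \<Rightarrow> ('v, 'a) str set \<Rightarrow> ('v, 'a) str \<Rightarrow> ('v, 'a) str set" where
  "bands_in \<Lambda> Ba y = {b \<in> Ba. band_count \<Lambda> b y > 0}"

definition is_reduction ::
    "('v, 'a) string_pres \<Rightarrow> ('v, 'a) str \<Rightarrow> ('v, 'a) str \<Rightarrow> ('v, 'a) str \<Rightarrow> bool" where
  "is_reduction \<Lambda> b y z \<longleftrightarrow> (\<exists>b' y1 y2. cyclic_perm b' b \<and> factors \<Lambda> y y2 b' y1 \<and>
     composes \<Lambda> y2 y1 \<and> z = cat y2 y1)"

definition reduct :: "('v, 'a) string_pres \<Rightarrow> ('v, 'a) str \<Rightarrow> ('v, 'a) str \<Rightarrow> ('v, 'a) str" where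
  "reduct \<Lambda> b y = (THE z. is_reduction \<Lambda> b y z)"

text \<open>
  \<open>Finite_Set.fold\<close> denotes the result obtained by processing the bands in any order, all orders
  giving the same result.
\<close>

definition skeleton :: "('v, 'a) string_pres \<Rightarrow> ('v, 'a) str set \<Rightarrow> ('v, 'a) str \<Rightarrow> ('v, 'a) str" where
  "skeleton \<Lambda> Ba y =
     Finite_Set.fold (\<lambda>b. reduct \<Lambda> b ^^ (band_count \<Lambda> b y - 1)) y (bands_in \<Lambda> Ba y)"

definition H_equiv :: "('v, 'a) string_pres \<Rightarrow> ('v, 'a) str \<Rightarrow> ('v, 'a) str \<Rightarrow> bool" where
  "H_equiv \<Lambda> y1 y2 \<longleftrightarrow> is_string \<Lambda> y1 \<and> is_string \<Lambda> y2 \<and> tgt \<Lambda> y1 = tgt \<Lambda> y2 \<and>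
     (\<forall>x. is_string \<Lambda> x \<and> src \<Lambda> x = tgt \<Lambda> y1 \<longrightarrow> composes \<Lambda> x y1 = composes \<Lambda> x y2)"

definition is_H_reduction :: "('v, 'a) string_pres \<Rightarrow> ('v, 'a) str \<Rightarrow> ('v, 'a) str \<Rightarrow> bool" where
  "is_H_reduction \<Lambda> y z \<longleftrightarrow> (\<exists>b b' y1 y2. is_band \<Lambda> b \<and> cyclic_perm b' b \<and> factors \<Lambda> y y2 b' y1 \<and>
     composes \<Lambda> y2 y1 \<and> z = cat y2 y1 \<and> H_equiv \<Lambda> (cat b' y1) y1)"

definition H_reduct ::
    "('v, 'a) string_pres \<Rightarrow> ('v, 'a) str set \<Rightarrow> ('v, 'a) str \<Rightarrow> ('v, 'a) str \<Rightarrow> ('v, 'a) str" where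
  "H_reduct \<Lambda> Ba b y =
     (if b \<in> bands_in \<Lambda> Ba y \<and> (\<exists>z. is_reduction \<Lambda> b y z) \<and> is_H_reduction \<Lambda> y (reduct \<Lambda> b y)
      then reduct \<Lambda> b y else y)"

section \<open>Weak bridges and weak arch bridges\<close>

text \<open>An arrow \<open>u : b \<rightarrow> b'\<close> between bands is the triple \<open>(b, u, b')\<close>.\<close>

type_synonym ('v, 'a) arrow = "('v, 'a) str \<times> ('v, 'a) str \<times> ('v, 'a) str"

abbreviation arrow_src :: "('v, 'a) arrow \<Rightarrow> ('v, 'a) str" where
  "arrow_src f \<equiv> fst f"

abbreviation arrow_str :: "('v, 'a) arrow \<Rightarrow> ('v, 'a) str" where
  "arrow_str f \<equiv> fst (snd f)"

abbreviation arrow_tgt :: "('v, 'a) arrow \<Rightarrow> ('v, 'a) str" where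
  "arrow_tgt f \<equiv> snd (snd f)"

definition weak_bridges :: "('v, 'a) string_pres \<Rightarrow> ('v, 'a) str set \<Rightarrow> ('v, 'a) arrow set" where
  "weak_bridges \<Lambda> Ba = {(b1, u, b2). b1 \<in> Ba \<and> b2 \<in> Ba \<and> is_string \<Lambda> u \<and> band_free \<Lambda> u \<and>
     (\<exists>y. factors \<Lambda> y b2 u b1) \<and> \<not> (b1 = b2 \<and> u = Triv (tgt \<Lambda> b1) (str_epsilon \<Lambda> b1))}"

definition weak_bridge_quiver ::
    "('v, 'a) string_pres \<Rightarrow> ('v, 'a) str set \<Rightarrow> (('v, 'a) str, ('v, 'a) arrow) pre_digraph" where
  "weak_bridge_quiver \<Lambda> Ba = \<lparr>verts = Ba, arcs = weak_bridges \<Lambda> Ba,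
     tail = (\<lambda>f. arrow_src f), head = (\<lambda>f. arrow_tgt f)\<rparr>"

text \<open>A path \<open>P = (u\<^sub>1, \<dots>, u\<^sub>n)\<close> is the list of its arrows in order of traversal, so \<open>P\<^sub>1 + P\<^sub>2\<close> is \<open>P\<^sub>1 @ P\<^sub>2\<close>.\<close>

definition bridge_paths :: "('v, 'a) string_pres \<Rightarrow> ('v, 'a) str set \<Rightarrow> ('v, 'a) arrow list set" where
  "bridge_paths \<Lambda> Ba =
     {P. P \<noteq> [] \<and> (\<exists>b b'. pre_digraph.awalk (weak_bridge_quiver \<Lambda> Ba) b P b')}"

definition path_src :: "('v, 'a) arrow list \<Rightarrow> ('v, 'a) str" where
  "path_src P = arrow_src (hd P)"

definition path_tgt :: "('v, 'a) arrow list \<Rightarrow> ('v, 'a) str" where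
  "path_tgt P = arrow_tgt (last P)"

text \<open>The string \<open>t(u\<^sub>n) u\<^sub>n \<dots> t(u\<^sub>1) u\<^sub>1 s(u\<^sub>1)\<close>.\<close>

definition path_str :: "('v, 'a) arrow list \<Rightarrow> ('v, 'a) str" where
  "path_str P = fold (\<lambda>f y. cat (arrow_tgt f) (cat (arrow_str f) y)) P (path_src P)"

definition H_string :: "('v, 'a) string_pres \<Rightarrow> ('v, 'a) str set \<Rightarrow> ('v, 'a) arrow list \<Rightarrow> ('v, 'a) str" where
  "H_string \<Lambda> Ba P =
     (THE u. factors \<Lambda>
        (foldr (H_reduct \<Lambda> Ba) (map arrow_tgt (butlast P)) (skeleton \<Lambda> Ba (path_str P)))
        (path_tgt P) u (path_src P))"

definition H_arrow ::
    "('v, 'a) string_pres \<Rightarrow> ('v, 'a) str set \<Rightarrow> ('v, 'a) arrow list \<Rightarrow> ('v, 'a) arrow" where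
  "H_arrow \<Lambda> Ba P = (path_src P, H_string \<Lambda> Ba P, path_tgt P)"

definition weak_arch_bridges :: "('v, 'a) string_pres \<Rightarrow> ('v, 'a) str set \<Rightarrow> ('v, 'a) arrow set" where
  "weak_arch_bridges \<Lambda> Ba = H_arrow \<Lambda> Ba ` bridge_paths \<Lambda> Ba"

text \<open>
  H-composition is defined through paths representing the two weak arch bridges.  \<open>is_H_comp\<close> relates
  \<open>g\<close> and \<open>f\<close> to the value obtained from any choice of such paths; \<open>g \<circ>\<^sub>H f\<close> exists as a value of an
  operation on weak arch bridges precisely if there is exactly one such value (\<open>H_comp_defined\<close>).
\<close>

definition is_H_comp :: "('v, 'a) string_pres \<Rightarrow> ('v, 'a) str set \<Rightarrow>
    ('v, 'a) arrow \<Rightarrow> ('v, 'a) arrow \<Rightarrow> ('v, 'a) arrow \<Rightarrow> bool" where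
  "is_H_comp \<Lambda> Ba g f h \<longleftrightarrow> (\<exists>P1 \<in> bridge_paths \<Lambda> Ba. \<exists>P2 \<in> bridge_paths \<Lambda> Ba.
     path_tgt P1 = path_src P2 \<and> f = H_arrow \<Lambda> Ba P1 \<and> g = H_arrow \<Lambda> Ba P2 \<and>
     h = H_arrow \<Lambda> Ba (P1 @ P2))"

definition H_comp_defined :: "('v, 'a) string_pres \<Rightarrow> ('v, 'a) str set \<Rightarrow>
    ('v, 'a) arrow \<Rightarrow> ('v, 'a) arrow \<Rightarrow> bool" where
  "H_comp_defined \<Lambda> Ba g f \<longleftrightarrow> (\<exists>!h. is_H_comp \<Lambda> Ba g f h)"

definition H_comp :: "('v, 'a) string_pres \<Rightarrow> ('v, 'a) str set \<Rightarrow>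
    ('v, 'a) arrow \<Rightarrow> ('v, 'a) arrow \<Rightarrow> ('v, 'a) arrow" where
  "H_comp \<Lambda> Ba g f = (THE h. is_H_comp \<Lambda> Ba g f h)"

end

theory Submission
  imports Defs "HOL-Library.Multiset"
begin

text \<open>
  Call the substrings that are cyclic permutations of bands windows.  In the domestic case a string
  \<open>g z g\<close> with \<open>g\<close> a cyclic permutation of a band forces \<open>z\<close> to be a power of \<open>g\<close>.  Hence all windows
  of one band in a string lie in one periodic run, so the result of removing one of them does not
  depend on its position, and windows of different bands which admit H-reductions never overlap.
  Therefore the H-reductions with respect to different bands commute and do not create new
  reducible windows; the skeleton operations are H-reductions as well.  So \<open>t(P) h(P) s(P)\<close> is the
  unique string that is reached from \<open>t(u\<^sub>n) u\<^sub>n \<dots> t(u\<^sub>1) u\<^sub>1 s(u\<^sub>1)\<close> by H-reductions at intermediate bands and that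
  admits no further such reduction.  Reducing the two halves of \<open>P\<^sub>1 + P\<^sub>2\<close> first shows that \<open>h(P\<^sub>1 + P\<^sub>2)\<close>
  depends only on \<open>h(P\<^sub>1)\<close> and \<open>h(P\<^sub>2)\<close>, and associativity is that of concatenation.
\<close>

section \<open>Words\<close>

text \<open>The operations prescribe a number of removals instead of asking for a normal form, so
  terminality has to be counted. An H-reduction at a band lowers the largest exponent of that band
  by at least one. The skeleton performs one removal fewer than the exponent and each interior band
  is applied at least once more, so no reduction at it is left. The end bands need protection. A
  closed path would have a power of one band as its word, so the weak bridge quiver is acyclic and
  no interior band is conjugate to an end band. The end blocks carry the rotation whose ends form a
  turn from an inverse to a direct syllable. At such a turn strings can be prolonged without a
  relation interfering, and so a window of another band never meets such a block. Hence reductions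
  at interior bands stay inside the word, away from strings of length 0. Different paths may give
  the same weak arch bridge and still pass through different interior bands. They are comparable
  because the word of a path has no windows of bands outside the path, so that its reduced word is
  stable at every band except the two end bands.\<close>

abbreviation word_pow :: "'b list \<Rightarrow> nat \<Rightarrow> 'b list" where
  "word_pow w n \<equiv> concat (replicate n w)"

definition conjugate :: "'b list \<Rightarrow> 'b list \<Rightarrow> bool" where
  "conjugate x y \<longleftrightarrow> (\<exists>s t. x = s @ t \<and> y = t @ s)"

definition primitive :: "'b list \<Rightarrow> bool" where
  "primitive w \<longleftrightarrow> w \<noteq> [] \<and> (\<forall>x n. w = word_pow x n \<longrightarrow> n = 1)"

lemma append_eq_appendE:
  assumes "x @ y = u @ v" "length x \<le> length u"
  obtains t where "u = x @ t" "y = t @ v"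
proof
  show "u = x @ drop (length x) u"
    using arg_cong[OF assms(1), of "take (length x)"] assms(2)
    by simp (metis append_take_drop_id)
  then show "y = drop (length x) u @ v"
    using assms(1) by (metis append_assoc same_append_eq)
qed

lemma append_eq_append_casesE:
  assumes "x @ y = u @ v"
  obtains (left) t where "u = x @ t" "y = t @ v" | (right) t where "x = u @ t" "v = t @ y" "t \<noteq> []"
proof (cases "length x \<le> length u")
  case True
  then show ?thesis
    using append_eq_appendE[OF assms] that(1) by blast
next
  case False
  then obtain t where "x = u @ t" "v = t @ y"
    using append_eq_appendE[OF assms[symmetric]] by auto
  then show ?thesis
    using that(2) False by auto
qed

lemma word_pow_add: "word_pow w (m + n) = word_pow w m @ word_pow w n"
  by (simp add: replicate_add)

lemma word_pow_Suc_right: "word_pow w (Suc n) = word_pow w n @ w"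
  using word_pow_add[of n 1 w] by simp

lemma word_pow_mult: "word_pow (word_pow w m) n = word_pow w (m * n)"
  by (induction n) (auto simp: replicate_add)

lemma length_word_pow: "length (word_pow w n) = n * length w"
  by (induction n) auto

lemma word_pow_rotate: "s @ word_pow (t @ s) n = word_pow (s @ t) n @ s"
  by (induction n) auto

lemma conjugate_iff_rotate: "conjugate x y \<longleftrightarrow> (\<exists>k. y = rotate k x)"
proof
  assume "conjugate x y"
  then obtain s t where "x = s @ t" "y = t @ s"
    by (auto simp: conjugate_def)
  then have "y = rotate (length s) x"
    by (simp add: rotate_append)
  then show "\<exists>k. y = rotate k x" ..
next
  assume "\<exists>k. y = rotate k x"
  then obtain k where "y = rotate k x" ..
  then have "x = take (k mod length x) x @ drop (k mod length x) x"
    "y = drop (k mod length x) x @ take (k mod length x) x"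
    by (simp_all add: rotate_drop_take)
  then show "conjugate x y"
    unfolding conjugate_def by blast
qed

lemma conjugate_refl [simp]: "conjugate x x"
  unfolding conjugate_def by (rule exI[of _ "[]"]) simp

lemma conjugate_sym: "conjugate x y \<Longrightarrow> conjugate y x"
  unfolding conjugate_def by blast

lemma conjugate_trans: "conjugate x y \<Longrightarrow> conjugate y z \<Longrightarrow> conjugate x z"
  unfolding conjugate_iff_rotate by (auto simp: rotate_rotate)

lemma conjugate_length: "conjugate x y \<Longrightarrow> length x = length y"
  by (auto simp: conjugate_def)

lemma conjugate_set: "conjugate x y \<Longrightarrow> set x = set y"
  by (auto simp: conjugate_def)

lemma conjugate_append: "conjugate (s @ t) (t @ s)"
  unfolding conjugate_def by blast

text \<open>Peeling \<open>x\<close> off \<open>s\<close> as long as it fits keeps the equation.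
  Once \<open>s\<close> is no longer than \<open>x\<close>, it is a prefix, \<open>x = s t\<close>,
  and cancelling leaves \<open>y = t s\<close>.\<close>

lemma conjugate_if_shift:
  assumes "x @ s = s @ y"
  shows "conjugate x y"
  using assms
proof (induction "length s" arbitrary: s rule: less_induct)
  case less
  show ?case
  proof (cases "length s \<le> length x")
    case True
    then obtain t where "x = s @ t" "y = t @ s"
      using append_eq_appendE[of s y x s] less.prems by metis
    then show ?thesis
      unfolding conjugate_def by blast
  next
    case False
    then obtain s' where s': "s = x @ s'" "s = s' @ y"
      using append_eq_appendE[of x s s y] less.prems by (metis nat_le_linear)
    show ?thesis
    proof (cases "x = []")
      case True
      then show ?thesis using less.prems by (metis append_Nil append_self_conv conjugate_refl)
    next
      case False
      then have "length s' < length s" "x @ s' = s' @ y"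
        using s' by simp_all
      then show ?thesis
        using less.hyps by blast
    qed
  qed
qed

text \<open>A cut at the border of two copies is taken as \<open>h1 = []\<close> in the next copy,
  and the cut after the last copy as \<open>h2 = []\<close>. So one copy is always set aside, and
  the exponents add up to \<open>n\<close> minus one.\<close>

lemma word_pow_split:
  assumes "xs @ ys = word_pow w n" "n \<ge> 1"
  shows "\<exists>a b h1 h2. w = h1 @ h2 \<and> xs = word_pow w a @ h1 \<and> ys = h2 @ word_pow w b \<and> Suc (a + b) = n"
  using assms
proof (induction n arbitrary: xs)
  case 0
  then show ?case by simp
next
  case (Suc n)
  show ?case
  proof (cases "length xs < length w \<or> n = 0")
    case True
    then have "length xs \<le> length w"
      using arg_cong[OF Suc.prems(1), of length] by auto
    then obtain h2 where "w = xs @ h2" "ys = h2 @ word_pow w n"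
      using append_eq_appendE[of xs ys w "word_pow w n"] Suc.prems(1) by auto
    then show ?thesis
      by (intro exI[of _ 0] exI[of _ n] exI[of _ xs] exI[of _ h2]) auto
  next
    case False
    then obtain xs' where xs': "xs = w @ xs'" "word_pow w n = xs' @ ys"
      using append_eq_appendE[of w "word_pow w n" xs ys] Suc.prems(1) by auto
    from Suc.IH[OF xs'(2)[symmetric]] False obtain a b h1 h2 where
      "w = h1 @ h2" "xs' = word_pow w a @ h1" "ys = h2 @ word_pow w b" "Suc (a + b) = n" by auto
    then show ?thesis using xs'(1)
      by (intro exI[of _ "Suc a"] exI[of _ b] exI[of _ h1] exI[of _ h2]) auto
  qed
qed

text \<open>The cut falls into one copy \<open>h1 h2\<close> of \<open>w\<close>; exchanging the two
  sides gives a power of \<open>h2 h1\<close> with the same exponent.\<close>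

lemma conjugate_word_pow:
  assumes "conjugate x (word_pow w n)"
  shows "\<exists>v. conjugate v w \<and> x = word_pow v n"
proof (cases "n = 0")
  case True
  then show ?thesis using assms by (auto simp: conjugate_def)
next
  case False
  from assms obtain s t where st: "x = s @ t" "t @ s = word_pow w n"
    by (auto simp: conjugate_def)
  with False word_pow_split[of t s n w] obtain a b h1 h2 where
    h: "w = h1 @ h2" "t = word_pow w a @ h1" "s = h2 @ word_pow w b" "Suc (a + b) = n" by auto
  have "x = h2 @ word_pow w (b + a) @ h1"
    unfolding st(1) h(2,3) word_pow_add by simp
  also have "\<dots> = word_pow (h2 @ h1) (Suc (a + b))"
    unfolding h(1) word_pow_Suc_right using word_pow_rotate[of h2 "b + a" h1] by (simp add: add.commute)
  finally show ?thesis
    using h(1,4) conjugate_append by blast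
qed

lemma primitive_conjugate:
  assumes "primitive w" "conjugate w v"
  shows "primitive v"
  unfolding primitive_def
proof (intro conjI allI impI)
  show "v \<noteq> []"
    using assms conjugate_length by (fastforce simp: primitive_def)
  fix x n
  assume "v = word_pow x n"
  then show "n = 1"
    using conjugate_word_pow assms unfolding primitive_def by metis
qed

lemma primitive_conjugate_word_pow:
  assumes "primitive w" "conjugate w (word_pow v n)"
  shows "n = 1 \<and> conjugate w v"
proof -
  have "n = 1"
    using conjugate_word_pow[OF assms(2)] assms(1) unfolding primitive_def by blast
  then show ?thesis
    using assms(2) by simp
qed

lemma primitive_root:
  assumes "w \<noteq> []"
  shows "\<exists>r k. primitive r \<and> k \<ge> 1 \<and> w = word_pow r k"
  using assms
proof (induction "length w" arbitrary: w rule: less_induct)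
  case less
  show ?case
  proof (cases "primitive w")
    case True
    then show ?thesis by (intro exI[of _ w] exI[of _ 1]) simp
  next
    case False
    with less.prems obtain x n where x: "w = word_pow x n" "n \<noteq> 1"
      by (auto simp: primitive_def)
    moreover have "n \<noteq> 0" "x \<noteq> []"
      using less.prems x(1) by (auto simp: replicate_0)
    ultimately have n: "n \<ge> 2" "x \<noteq> []" by auto
    then have "length x < length w"
      using x by (simp add: length_word_pow)
    from less.hyps[OF this n(2)] obtain r k where "primitive r" "k \<ge> 1" "x = word_pow r k" by blast
    then show ?thesis
      using x n by (intro exI[of _ r] exI[of _ "k * n"]) (auto simp: word_pow_mult)
  qed
qed

text \<open>If \<open>s\<close> is shorter than \<open>w\<close>, cancelling shows that
  \<open>s\<close> commutes with the rest \<open>t\<close> of \<open>w = s t\<close>. Commuting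
  words are powers of a common word, so primitivity of \<open>w\<close> leaves \<open>s\<close>
  empty. A longer \<open>s\<close> begins with \<open>w\<close>, which can be stripped without
  losing the equation.\<close>

lemma primitive_commuting:
  assumes "primitive w" "N \<ge> 1" "s @ word_pow w N = word_pow w N @ s"
  shows "\<exists>k. s = word_pow w k"
  using assms(3)
proof (induction "length s" arbitrary: s rule: less_induct)
  case less
  obtain M where M: "N = Suc M"
    using assms(2) by (cases N) auto
  show ?case
  proof (cases "length s < length w")
    case True
    then obtain t where t: "w = s @ t"
      using append_eq_appendE[of s "word_pow w N" w "word_pow w M @ s"] less.prems unfolding M by auto
    have "t @ word_pow w M @ s = (s @ t) @ word_pow w M"
      using less.prems unfolding M t by simp
    moreover have "word_pow w M @ s = s @ word_pow (t @ s) M"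
      unfolding t by (simp add: word_pow_rotate)
    ultimately have "(t @ s) @ word_pow (t @ s) M = (s @ t) @ word_pow w M"
      by simp
    then have "t @ s = s @ t"
      by (subst (asm) append_eq_append_conv) auto
    from comm_append_are_replicate[OF this] obtain m n zs where
      zs: "word_pow zs m = t" "word_pow zs n = s" by blast
    then have "w = word_pow zs (n + m)"
      using t by (simp add: replicate_add)
    then have "n + m = 1"
      using assms(1) by (simp add: primitive_def)
    then have "s = [] \<or> t = []"
      using zs by (cases n) auto
    then have "s = []" using True t by auto
    then show ?thesis by (intro exI[of _ 0]) simp
  next
    case False
    then obtain s' where s': "s = w @ s'"
      using append_eq_appendE[of w "word_pow w M @ s" s "word_pow w N"] less.prems unfolding M by auto
    have "w @ s' @ word_pow w N = (word_pow w N @ w) @ s'"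
      using less.prems unfolding s' by simp
    also have "word_pow w N @ w = w @ word_pow w N"
      using word_pow_rotate[of w N "[]"] by simp
    finally have "s' @ word_pow w N = word_pow w N @ s'"
      by simp
    moreover have "length s' < length s"
      using assms(1) s' by (auto simp: primitive_def)
    ultimately obtain k where "s' = word_pow w k"
      using less.hyps by blast
    then show ?thesis using s' by (intro exI[of _ "Suc k"]) simp
  qed
qed

section \<open>Strings as words\<close>

lemma sublist_append3:
  assumes "sublist r (x @ g @ y)"
  shows "sublist r (x @ g) \<or> sublist r (g @ y) \<or> sublist g r"
proof -
  obtain p q where "p @ r @ q = x @ g @ y"
    using assms by (auto simp: sublist_def)
  then show ?thesis
  proof (cases rule: append_eq_append_casesE)
    case (right us)
    then show ?thesis by (metis sublist_appendI)
  next
    case (left us)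
    then have "r @ q = (us @ g) @ y" by simp
    then show ?thesis
    proof (cases rule: append_eq_append_casesE)
      case (right vs)
      then show ?thesis by auto
    next
      case (left vs)
      then have "x @ g = p @ r @ vs"
        using \<open>x = p @ us\<close> by auto
      then show ?thesis by (metis sublist_appendI)
    qed
  qed
qed

lemma sublist_append_junction:
  assumes "sublist r (x @ y)" "x \<noteq> []" "y \<noteq> []"
  shows "sublist r x \<or> sublist r y \<or> (last x \<in> set r \<and> hd y \<in> set r)"
proof -
  obtain p q where "x @ y = p @ r @ q"
    using assms(1) by (auto simp: sublist_def)
  then show ?thesis
  proof (cases rule: append_eq_append_casesE)
    case (left us)
    then show ?thesis by (metis sublist_appendI)
  next
    case (right us)
    from right(2) show ?thesis
    proof (cases rule: append_eq_append_casesE)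
      case (left vs)
      then show ?thesis using right by (metis sublist_appendI)
    next
      case 2: (right vs)
      then have "last x = last us" "hd y = hd vs"
        using right by auto
      then show ?thesis
        using 2 right by auto
    qed
  qed
qed

text \<open>Relations and their inverses consist of syllables of one kind, so none of them contains
  a mixed word. This makes mixed words the overlaps along which strings can be glued.\<close>

definition mixed :: "'a syl list \<Rightarrow> bool" where
  "mixed w \<longleftrightarrow> (\<exists>a. Dir a \<in> set w) \<and> (\<exists>a. Inv a \<in> set w)"

lemma mixed_append [simp]: "mixed x \<Longrightarrow> mixed (x @ y)" "mixed y \<Longrightarrow> mixed (x @ y)"
  by (auto simp: mixed_def)

lemma mixed_not_Nil: "mixed x \<Longrightarrow> x \<noteq> []"
  by (auto simp: mixed_def)

text \<open>Read cyclically, a mixed word has an inverse syllable directly before a direct one;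
  cutting there gives the ends demanded of a band. If the ends do not have this form already, the
  first direct or the last inverse syllable shows such a place.\<close>

lemma mixed_rotation:
  assumes "mixed w"
  shows "\<exists>v a b. conjugate w v \<and> hd v = Dir a \<and> last v = Inv b"
proof -
  have turn: ?thesis if "w = s @ Inv b # Dir a # t" for s t a b
  proof -
    have "conjugate w (Dir a # t @ s @ [Inv b])"
      using conjugate_append[of "s @ [Inv b]" "Dir a # t"] that by simp
    then show ?thesis
      by (intro exI[of _ "Dir a # t @ s @ [Inv b]"] exI[of _ a] exI[of _ b]) simp
  qed
  have dir: "\<exists>a. x = Dir a" if "x \<notin> range Inv" for x :: "'a syl"
    using that by (cases x) auto
  have inv: "\<exists>a. x = Inv a" if "x \<notin> range Dir" for x :: "'a syl"
    using that by (cases x) auto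
  have "w \<noteq> []" using assms by (rule mixed_not_Nil)
  consider "hd w \<in> range Dir" "last w \<in> range Inv" | "hd w \<in> range Inv" | "last w \<in> range Dir"
    using dir inv by blast
  then show ?thesis
  proof cases
    case 1
    then show ?thesis
      by (intro exI[of _ w]) auto
  next
    case 2
    have "\<exists>x \<in> set w. x \<in> range Dir"
      using assms by (auto simp: mixed_def)
    then obtain s x t where s: "w = s @ x # t" "x \<in> range Dir" "\<forall>y \<in> set s. y \<notin> range Dir"
      using split_list_first_prop[of w "\<lambda>x. x \<in> range Dir"] by blast
    then have "s \<noteq> []" using 2 by (cases s) auto
    then have "s = butlast s @ [last s]" "last s \<in> set s" by auto
    then show ?thesis
      using s turn inv by (metis append_Cons append_assoc append_Nil rangeE)
  next
    case 3
    have "\<exists>x \<in> set w. x \<in> range Inv"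
      using assms by (auto simp: mixed_def)
    then obtain s x t where s: "w = s @ x # t" "x \<in> range Inv" "\<forall>y \<in> set t. y \<notin> range Inv"
      using split_list_last_prop[of w "\<lambda>x. x \<in> range Inv"] by blast
    then have "t \<noteq> []" using 3 by (cases t) auto
    then have "t = hd t # tl t" "hd t \<in> set t" by auto
    then show ?thesis
      using s turn dir by (metis rangeE)
  qed
qed

section \<open>Gluing strings, and recognising bands up to rotation\<close>

context string_algebra
begin

abbreviation sword :: "'a syl list \<Rightarrow> bool" where
  "sword w \<equiv> is_string \<Lambda> (Word w)"

lemma sword_sublist:
  assumes "sword w" "sublist v w" "v \<noteq> []"
  shows "sword v"
proof -
  obtain p q where "w = p @ v @ q"
    using assms(2) by (auto simp: sublist_def)
  then have "successively (\<lambda>\<beta> \<alpha>. syl_src \<Lambda> \<beta> = syl_tgt \<Lambda> \<alpha> \<and> \<beta> \<noteq> inv_syl \<alpha>) v"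
    using assms(1) by (auto simp: successively_append_iff)
  moreover have "syl_arc ` set v \<subseteq> arcs (quiver \<Lambda>)"
    using assms(1) set_mono_sublist[OF assms(2)] by auto
  moreover have "\<not> sublist (map Dir r) v \<and> \<not> sublist (map Inv (rev r)) v" if "r \<in> rels \<Lambda>" for r
    using assms(1,2) that by (auto dest: sublist_order.order.trans)
  ultimately show ?thesis
    using assms(3) by simp
qed

lemma sword_appendD:
  "sword (x @ y) \<Longrightarrow> x \<noteq> [] \<Longrightarrow> sword x"
  "sword (x @ y) \<Longrightarrow> y \<noteq> [] \<Longrightarrow> sword y"
  using sword_sublist[OF _ sublist_append_rightI] sword_sublist[OF _ sublist_append_leftI] by blast+

text \<open>A relation that lies in neither of the two strings would have to cover \<open>g\<close>,
  which is impossible for mixed \<open>g\<close>. The conditions on neighbouring syllables are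
  local.\<close>

lemma sword_glue:
  assumes "sword (x @ g)" "sword (g @ y)" "mixed g"
  shows "sword (x @ g @ y)"
proof -
  have rels: "\<not> sublist (map Dir r) w" "\<not> sublist (map Inv (rev r)) w"
    if "sword w" "r \<in> rels \<Lambda>" for w r
    using that by simp_all
  have "\<not> sublist g (map Dir r)" "\<not> sublist g (map Inv r)" for r :: "'a list"
    using assms(3) set_mono_sublist by (fastforce simp: mixed_def)+
  then have "\<not> sublist (map Dir r) (x @ g @ y)" "\<not> sublist (map Inv (rev r)) (x @ g @ y)"
    if "r \<in> rels \<Lambda>" for r
    using rels[OF assms(1) that] rels[OF assms(2) that] sublist_append3 by blast+
  moreover have "g \<noteq> []"
    using assms(3) by (rule mixed_not_Nil)
  ultimately show ?thesis
    using assms(1,2) by (auto simp: successively_append_iff)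
qed

text \<open>A relation across the junction would contain an inverse and a direct syllable, so only
  the two syllables at the junction need checking. In contrast to \<open>sword_glue\<close>, the two
  strings need not overlap.\<close>

lemma sword_turn:
  assumes "sword x" "sword y" "sword [last x, hd y]" "last x = Inv a" "hd y = Dir b"
  shows "sword (x @ y)"
proof -
  have ne: "x \<noteq> []" "y \<noteq> []"
    using assms by auto
  have rels: "\<not> sublist (map Dir r) w" "\<not> sublist (map Inv (rev r)) w"
    if "sword w" "r \<in> rels \<Lambda>" for w r
    using that by simp_all
  have "\<not> (last x \<in> set (map Dir r) \<and> hd y \<in> set (map Dir r))"
    "\<not> (last x \<in> set (map Inv r) \<and> hd y \<in> set (map Inv r))" for r :: "'a list"
    using assms(4,5) by auto
  then have "\<not> sublist (map Dir r) (x @ y)" "\<not> sublist (map Inv (rev r)) (x @ y)"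
    if "r \<in> rels \<Lambda>" for r
    using rels[OF assms(1) that] rels[OF assms(2) that] sublist_append_junction[OF _ ne] by blast+
  then show ?thesis
    using assms(1-3) ne by (auto simp: successively_append_iff)
qed

definition band_word :: "'a syl list \<Rightarrow> bool" where
  "band_word g \<longleftrightarrow> (\<exists>w. is_band \<Lambda> (Word w) \<and> conjugate w g)"

lemma band_word_conjugate: "band_word g \<Longrightarrow> conjugate g h \<Longrightarrow> band_word h"
  unfolding band_word_def using conjugate_trans by blast

lemma is_band_imp_band_word: "is_band \<Lambda> (Word w) \<Longrightarrow> band_word w"
  unfolding band_word_def using conjugate_refl by blast

lemma sublist_word_pow_conjugate:
  assumes "conjugate w g"
  shows "sublist (word_pow g n) (word_pow w (Suc n))"
proof -
  obtain s t where st: "w = s @ t" "g = t @ s"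
    using assms by (auto simp: conjugate_def)
  have "word_pow w (Suc n) = s @ word_pow g n @ t"
    unfolding st word_pow_Suc_right using word_pow_rotate[of s n t] by simp
  then show ?thesis by simp
qed

lemma word_pow_eq_Nil: "word_pow w n = [] \<longleftrightarrow> w = [] \<or> n = 0"
  by (cases n) auto

lemma is_band_primitive:
  assumes "is_band \<Lambda> (Word w)"
  shows "primitive w"
  unfolding primitive_def
proof (intro conjI allI impI)
  show ne: "w \<noteq> []"
    using assms by (auto simp: is_band_def)
  fix x n
  assume w: "w = word_pow x n"
  show "n = 1"
  proof (rule ccontr)
    assume "n \<noteq> 1"
    moreover have "n \<noteq> 0" "x \<noteq> []"
      using w ne by (auto simp: word_pow_eq_Nil)
    ultimately have n: "n \<ge> 2" by auto
    have "sword w" using assms by (simp add: is_band_def)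
    moreover have "sublist x w"
      using n w by (cases n) auto
    ultimately have "sword x"
      using sword_sublist \<open>x \<noteq> []\<close> by blast
    then show False
      using assms n w unfolding is_band_def by (metis str_pow.simps(2))
  qed
qed

lemma band_word_primitive: "band_word g \<Longrightarrow> primitive g"
  unfolding band_word_def using is_band_primitive primitive_conjugate by blast

lemma band_word_not_Nil: "band_word g \<Longrightarrow> g \<noteq> []"
  using band_word_primitive by (auto simp: primitive_def)

lemma is_band_ends:
  assumes "is_band \<Lambda> (Word w)"
  obtains a b where "hd w = Dir a" "last w = Inv b"
  using assms by (auto simp: is_band_def)

lemma band_word_mixed:
  assumes "band_word g"
  shows "mixed g"
proof -
  obtain w where w: "is_band \<Lambda> (Word w)" "conjugate w g"
    using assms by (auto simp: band_word_def)
  then have "w \<noteq> []" by (auto simp: is_band_def)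
  then have "hd w \<in> set w" "last w \<in> set w" by auto
  then have "mixed w"
    using w(1) by (metis is_band_ends mixed_def)
  then show ?thesis
    using conjugate_set[OF w(2)] by (simp add: mixed_def)
qed

lemma band_word_pow:
  assumes "band_word g" "n \<ge> 1"
  shows "sword (word_pow g n)"
proof -
  obtain w where w: "is_band \<Lambda> (Word w)" "conjugate w g"
    using assms by (auto simp: band_word_def)
  have "sword (word_pow w (Suc n))"
    using w(1) by (metis is_band_def str_pow.simps(2) le_add1 plus_1_eq_Suc)
  moreover have "word_pow g n \<noteq> []"
    using assms band_word_not_Nil by (auto simp: word_pow_eq_Nil)
  ultimately show ?thesis
    using sublist_word_pow_conjugate[OF w(2)] sword_sublist by blast
qed

lemma band_word_sword: "band_word g \<Longrightarrow> sword g"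
  using band_word_pow[of g 1] by simp

lemma band_word_square: "band_word g \<Longrightarrow> sword (g @ g)"
  using band_word_pow[of g 2] by (simp add: numeral_2_eq_2)

text \<open>This is how roots are recognised as bands. \<open>mixed_rotation\<close> supplies the
  required ends, and the powers of the rotated word stay strings because they are subwords of the
  next higher power of \<open>r\<close>.\<close>

lemma primitive_mixed_band_word:
  assumes "primitive r" "mixed r" "\<And>n. n \<ge> 1 \<Longrightarrow> sword (word_pow r n)"
  shows "band_word r"
proof -
  obtain v a b where v: "conjugate r v" "hd v = Dir a" "last v = Inv b"
    using mixed_rotation[OF assms(2)] by blast
  have prim: "primitive v" and ne: "v \<noteq> []"
    using primitive_conjugate[OF assms(1) v(1)] by (auto simp: primitive_def)
  have pow: "sword (word_pow v n)" if "n \<ge> 1" for n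
  proof (rule sword_sublist)
    show "sword (word_pow r (Suc n))"
      by (rule assms(3)) simp
    show "word_pow v n \<noteq> []"
      using that ne by (auto simp: word_pow_eq_Nil)
  qed (rule sublist_word_pow_conjugate[OF v(1)])
  have sv: "sword v" and sw2: "sword (v @ v)"
    using pow[of 1] pow[of 2] by (auto simp: numeral_2_eq_2)
  have "src \<Lambda> (Word v) = tgt \<Lambda> (Word v)"
    using sw2 ne by (auto simp: successively_append_iff)
  moreover have "\<not> (\<exists>x n. is_string \<Lambda> x \<and> n \<ge> 2 \<and> Word v = str_pow x n)"
  proof
    assume "\<exists>x n. is_string \<Lambda> x \<and> n \<ge> 2 \<and> Word v = str_pow x n"
    then obtain x n where "is_string \<Lambda> x" "n \<ge> 2" "Word v = str_pow x n" by blast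
    then obtain y where "v = word_pow y n"
      using ne by (cases x) auto
    then have "n = 1"
      using prim unfolding primitive_def by blast
    then show False
      using \<open>n \<ge> 2\<close> by simp
  qed
  ultimately have "is_band \<Lambda> (Word v)"
    using v sv pow by (auto simp: is_band_def)
  then show ?thesis
    unfolding band_word_def using conjugate_sym[OF v(1)] by blast
qed

end

section \<open>Return words in the domestic case\<close>

locale domestic_string_algebra = string_algebra \<Lambda> for \<Lambda> :: "('v, 'a) string_pres" +
  assumes domestic: "domestic \<Lambda>"
begin

lemma finite_band_words: "finite {g. band_word g}"
proof -
  let ?B = "{w. is_band \<Lambda> (Word w)}"
  have "finite (Word -` {b. is_band \<Lambda> b})"
    using domestic by (intro finite_vimageI) (auto simp: domestic_def inj_on_def)
  then have fin: "finite ?B"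
    by (simp add: vimage_def)
  have "{g. band_word g} \<subseteq> (\<Union>w \<in> ?B. {g. set g \<subseteq> set w \<and> length g = length w})"
  proof
    fix g
    assume "g \<in> {g. band_word g}"
    then obtain w where w: "is_band \<Lambda> (Word w)" "conjugate w g"
      by (auto simp: band_word_def)
    then show "g \<in> (\<Union>w \<in> ?B. {g. set g \<subseteq> set w \<and> length g = length w})"
      using conjugate_set[OF w(2)] conjugate_length[OF w(2)] by auto
  qed
  moreover have "finite {g. set g \<subseteq> set w \<and> length g = length w}" for w :: "'a syl list"
    by (rule finite_lists_length_eq) simp
  ultimately show ?thesis
    using fin by (meson finite_UN finite_subset)
qed

text \<open>
  The words \<open>g\<^sup>n g z\<close> are powers of cyclic permutations of bands.  There are finitely many of the
  latter, so two of these words have the same root, which forces \<open>g\<close> and \<open>z\<close> to commute.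
\<close>

lemma return_word:
  assumes g: "band_word g" and gzg: "sword (g @ z @ g)"
  shows "\<exists>k. z = word_pow g k"
proof -
  \<comment> \<open>The exponent \<open>Suc n\<close> keeps a \<open>g\<close> in front, which makes
    every \<open>W n\<close> mixed and provides the overlap used for gluing below.\<close>
  define W where "W n = word_pow g (Suc n) @ z" for n
  have mg: "mixed g" using g by (rule band_word_mixed)
  have mW: "mixed (W n)" for n using mg by (simp add: W_def)
  have pg: "sword (word_pow g n @ g)" for n
    using band_word_pow[OF g, of "Suc n"] unfolding word_pow_Suc_right by simp
  have Wg: "sword (W n @ g)" for n
  proof -
    have "sword (word_pow g n @ g @ z @ g)"
      using pg gzg mg by (rule sword_glue)
    then show ?thesis
      unfolding W_def word_pow_Suc_right by simp
  qed
  \<comment> \<open>\<open>W n\<close> followed by \<open>g\<close> is glued to the previous word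
    along the leading \<open>g\<close> of the latter; the trailing \<open>g\<close> in the claim
    keeps this possible in the next round.\<close>
  have Wm: "sword (word_pow (W n) m @ g)" for n m
  proof (induction m)
    case 0
    then show ?case using band_word_sword[OF g] by simp
  next
    case (Suc m)
    have W': "W n = g @ word_pow g n @ z" by (simp add: W_def)
    show ?case
    proof (cases m)
      case 0
      then show ?thesis using Wg[of n] by simp
    next
      case m: (Suc m')
      have "sword (W n @ g @ drop (length g) (word_pow (W n) m @ g))"
        by (rule sword_glue[OF Wg _ mg]) (use Suc.IH in \<open>simp add: m W'\<close>)
      then show ?thesis by (simp add: m W')
    qed
  qed
  have "\<exists>r k. band_word r \<and> W n = word_pow r k" for n
  proof -
    obtain r k where r: "primitive r" "k \<ge> 1" "W n = word_pow r k"
      using primitive_root mixed_not_Nil[OF mW] by blast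
    have "set (W n) = set r"
      using r(2,3) by (cases k) auto
    then have "mixed r"
      using mW[of n] by (simp add: mixed_def)
    moreover have "sword (word_pow r m)" if "m \<ge> 1" for m
    proof -
      have "word_pow (W n) m = word_pow r m @ word_pow r ((k - 1) * m)"
        unfolding r(3) word_pow_mult word_pow_add[symmetric] using r(2)
        by (cases k) auto
      then have "sublist (word_pow r m) (word_pow (W n) m @ g)"
        by simp
      moreover have "word_pow r m \<noteq> []"
        using r(1) that by (auto simp: primitive_def word_pow_eq_Nil)
      ultimately show ?thesis
        using Wm sword_sublist by blast
    qed
    ultimately show ?thesis
      using primitive_mixed_band_word r by blast
  qed
  then obtain R K where RK: "\<And>n. band_word (R n)" "\<And>n. W n = word_pow (R n) (K n)"
    by metis
  have "\<not> inj R"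
    using finite_subset[OF _ finite_band_words, of "range R"] RK(1) finite_imageD[of R UNIV]
    by auto
  then obtain m n where mn: "R m = R n" "m < n"
    unfolding inj_def by (metis linorder_neqE_nat)
  define r where "r = R m"
  define d where "d = n - m"
  have Wn: "W n = word_pow g d @ W m"
    unfolding W_def using mn(2) word_pow_add[of d "Suc m" g] by (simp add: d_def)
  have r: "W m = word_pow r (K m)" "W n = word_pow r (K n)"
    using RK(2) mn(1) by (simp_all add: r_def)
  have "K m \<le> K n"
  proof (rule ccontr)
    assume "\<not> K m \<le> K n"
    then have "length (W n) \<le> length (W m)"
      unfolding r length_word_pow by simp
    moreover have "length (W n) > length (W m)"
      unfolding Wn using mn(2) band_word_not_Nil[OF g] by (simp add: length_word_pow d_def)
    ultimately show False by simp
  qed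
  then have "W n = word_pow r (K n - K m) @ W m"
    unfolding r using word_pow_add[of "K n - K m" "K m" r] by simp
  then have gd: "word_pow g d = word_pow r (K n - K m)"
    unfolding Wn by simp
  \<comment> \<open>\<open>W m\<close> is a power of \<open>r\<close>, and so is
    \<open>word_pow g d\<close>, the factor by which \<open>W n\<close> exceeds \<open>W m\<close>.
    Hence the two commute, and primitivity of \<open>g\<close> makes \<open>W m\<close> a power of
    \<open>g\<close>.\<close>
  have "W m @ word_pow g d = word_pow g d @ W m"
    unfolding gd r word_pow_add[symmetric] by (simp add: add.commute)
  then obtain k where k: "W m = word_pow g k"
    using primitive_commuting[OF band_word_primitive[OF g], of d "W m"] mn(2)
    unfolding d_def by (metis Suc_leI One_nat_def zero_less_diff)
  have "k \<ge> Suc m"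
  proof (rule ccontr)
    assume "\<not> k \<ge> Suc m"
    then have "k * length g < Suc m * length g"
      using band_word_not_Nil[OF g] by (intro mult_strict_right_mono) (auto simp: not_le)
    moreover have "length (W m) = k * length g"
      unfolding k by (rule length_word_pow)
    moreover have "length (W m) = Suc m * length g + length z"
      unfolding W_def by (simp only: length_append length_word_pow)
    ultimately show False by linarith
  qed
  then have "word_pow g k = word_pow g (Suc m) @ word_pow g (k - Suc m)"
    using word_pow_add[of "Suc m" "k - Suc m" g] by simp
  then have "z = word_pow g (k - Suc m)"
    using k unfolding W_def by simp
  then show ?thesis ..
qed

end

declare is_string.simps(2) [simp del]

section \<open>Positions of band windows in a string\<close>

context domestic_string_algebra
begin

text \<open>Two successive copies of \<open>s g t\<close> contain \<open>g (t s) g\<close>, so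
  \<open>t s\<close> is a power of \<open>g\<close> and the whole word is conjugate to a power of
  \<open>g\<close>. Primitivity leaves exponent one.\<close>

lemma band_word_window_conjugate:
  assumes "band_word (s @ g @ t)" "band_word g"
  shows "conjugate (s @ g @ t) g"
proof -
  have "sublist (g @ (t @ s) @ g) ((s @ g @ t) @ (s @ g @ t))"
    by (simp add: sublist_def) (metis append_assoc)
  then have "sword (g @ (t @ s) @ g)"
    using band_word_square[OF assms(1)] sword_sublist band_word_not_Nil[OF assms(2)]
    by (metis append_is_Nil_conv)
  then obtain k where "t @ s = word_pow g k"
    using return_word[OF assms(2)] by blast
  then have "word_pow g (Suc k) = (g @ t) @ s"
    by simp
  then have "conjugate (s @ g @ t) (word_pow g (Suc k))"
    using conjugate_append[of s "g @ t"] by simp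
  then show ?thesis
    using primitive_conjugate_word_pow band_word_primitive[OF assms(1)] by blast
qed

text \<open>Write \<open>b = g2 g1\<close> and \<open>c = g1 g2\<close>. Adding one more copy of
  each window on the outside makes \<open>c (g1 M) c\<close> a subword, so \<open>g1 M\<close> is a
  power of \<open>c\<close>. The whole stretch from the first window to the second is therefore
  periodic, and the equation expresses this.\<close>

lemma disjoint_windows_shift:
  assumes "band_word b" "conjugate b c" "sword (b @ M @ c)"
  shows "b @ b @ M = b @ M @ c"
proof -
  obtain g2 g1 where g: "b = g2 @ g1" "c = g1 @ g2"
    using assms(2) by (auto simp: conjugate_def)
  have c: "band_word c"
    using assms(1,2) by (rule band_word_conjugate)
  have "sword (b @ b @ M @ c)"
    using sword_glue[OF band_word_square[OF assms(1)] assms(3) band_word_mixed[OF assms(1)]] .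
  then have "sword ((b @ b @ M) @ c @ c)"
    using sword_glue[of "b @ b @ M" c c] band_word_square[OF c] band_word_mixed[OF c] by simp
  then have "sword (c @ (g1 @ M) @ c)"
    using band_word_not_Nil[OF c] unfolding g
    by (elim sword_sublist) (auto simp: sublist_def)
  then obtain k where "g1 @ M = word_pow c k"
    using return_word[OF c] by blast
  then have "b @ b @ M = g2 @ c @ word_pow c k" "b @ M @ c = g2 @ word_pow c k @ c"
    by (simp_all add: g)
  then show ?thesis
    using word_pow_rotate[of c k "[]"] by simp
qed

lemma windows_shift:
  assumes "band_word b" "conjugate b c" "b @ B = s @ c @ B'" "sword (b @ B)"
  shows "b @ s = s @ c"
  using assms(3)
proof (cases rule: append_eq_append_casesE)
  case (left M)
  then have "b @ M @ c @ B' = b @ B" by simp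
  then have "sword (b @ M @ c)"
    using assms(1,4) band_word_not_Nil sword_appendD(1)[of "b @ M @ c" B'] by auto
  then have "b @ b @ M = b @ M @ c"
    by (rule disjoint_windows_shift[OF assms(1,2)])
  then show ?thesis
    unfolding left(1) append_assoc .
next
  case (right v)
  have c: "band_word c"
    using assms(1,2) by (rule band_word_conjugate)
  have "length v \<le> length c"
    using right(1) conjugate_length[OF assms(2)] by simp
  then obtain t where t: "c = v @ t" "B = t @ B'"
    using append_eq_appendE[of v B c B'] right(2) by metis
  have svt: "sword (s @ v @ t)"
    using assms(4) right t band_word_not_Nil[OF assms(1)] sword_appendD(1)[of "s @ v @ t" B'] by auto
  \<comment> \<open>The overlapping windows \<open>b = s v\<close> and \<open>c = v t\<close> are
    pushed apart: \<open>s v t\<close> is extended by \<open>b\<close> on the left and by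
    \<open>c\<close> on the right, and the disjoint case applies with
    \<open>M = s v t\<close>.\<close>
  have "sword (b @ b @ t)"
    using sword_glue[OF band_word_square[OF assms(1)] _ band_word_mixed[OF assms(1)], of t] svt right
    by simp
  then have "sword ((b @ s) @ c @ c)"
    using sword_glue[OF _ band_word_square[OF c] band_word_mixed[OF c], of "b @ s"] right t
    by simp
  then have "b @ b @ s @ v @ t = b @ (s @ v @ t) @ c"
    using disjoint_windows_shift[OF assms(1,2), of "s @ v @ t"] t by simp
  then have "(s @ v) @ t = (t @ v) @ t"
    by (simp add: right t)
  then show ?thesis
    using right t by simp
qed

text \<open>The window slides from the left position to the right one: \<open>windows_shift\<close>
  gives \<open>b s = s c\<close>, so \<open>b B = s c B'\<close> becomes \<open>b s B'\<close> and
  \<open>B = s B'\<close>. This is what gives the description in \<open>reduct\<close> a unique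
  referent.\<close>

lemma windows_same_reduct:
  assumes "sword (A @ b @ B)" "A @ b @ B = A' @ c @ B'" "band_word b" "conjugate b c"
  shows "A @ B = A' @ B'"
proof -
  have *: "A @ B = A' @ B'"
    if str: "sword (A @ b @ B)" and eq: "A @ b @ B = A' @ c @ B'" and bw: "band_word b"
      and cj: "conjugate b c" and le: "length A \<le> length A'" for A B A' B' b c
  proof -
    obtain s where s: "A' = A @ s" "b @ B = s @ c @ B'"
      using append_eq_appendE[OF eq le] by metis
    have "b @ s = s @ c"
      using windows_shift[OF bw cj s(2)] str bw band_word_not_Nil sword_appendD(2)[of A "b @ B"] by simp
    then have "b @ B = b @ s @ B'"
      using s(2) by (metis append_assoc)
    then show ?thesis using s(1) by simp
  qed
  show ?thesis
  proof (cases "length A \<le> length A'")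
    case True
    then show ?thesis using * assms by blast
  next
    case False
    then show ?thesis
      using *[of A' c B' A b B] assms band_word_conjugate conjugate_sym by (metis nat_le_linear)
  qed
qed

lemma band_word_turn:
  assumes "band_word b"
  shows "sword [last b, hd b]"
proof -
  have "b @ b = (butlast b @ [last b]) @ hd b # tl b"
    using band_word_not_Nil[OF assms] by simp
  also have "\<dots> = butlast b @ [last b, hd b] @ tl b"
    by simp
  finally have "sublist [last b, hd b] (b @ b)"
    unfolding sublist_def by blast
  then show ?thesis
    using band_word_square[OF assms] sword_sublist by blast
qed

text \<open>The band is needed in its own rotation, not only up to conjugation: its last and first
  syllables form a turn, so \<open>c2 v b1\<close> may be continued by \<open>v c2 v\<close>. With
  \<open>c = c2 v\<close> this is \<open>c (b1 v) c\<close>, and the return word \<open>b1 v\<close>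
  is conjugate to the band.\<close>

lemma overlap_left:
  assumes b: "is_band \<Lambda> (Word (v @ b1))" and c: "band_word (c2 @ v)"
    and "v \<noteq> []" "sword (c2 @ v @ b1)"
  shows "conjugate (v @ b1) (c2 @ v)"
proof -
  let ?b = "v @ b1" and ?c = "c2 @ v"
  obtain x y where xy: "hd ?b = Dir x" "last ?b = Inv y"
    using is_band_ends[OF b] by blast
  have bw: "band_word ?b"
    using b by (rule is_band_imp_band_word)
  have turn: "sword [last ?b, hd ?b]"
    using bw by (rule band_word_turn)
  have vc: "sword (v @ ?c)"
    using band_word_square[OF c] assms(3) sword_appendD(2)[of c2 "v @ ?c"] by simp
  have "sword ((c2 @ v @ b1) @ (v @ ?c))"
    using sword_turn[OF assms(4) vc, of y x] xy turn assms(3) by (cases b1) auto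
  then have "sword (?c @ (b1 @ v) @ ?c)"
    by simp
  then obtain k where "b1 @ v = word_pow ?c k"
    using return_word[OF c] by blast
  then show ?thesis
    using conjugate_append[of v b1] primitive_conjugate_word_pow band_word_primitive[OF bw] by metis
qed

lemma overlap_right:
  assumes b: "is_band \<Lambda> (Word (b2 @ v))" and c: "band_word (v @ c1)"
    and "v \<noteq> []" "sword (b2 @ v @ c1)"
  shows "conjugate (b2 @ v) (v @ c1)"
proof -
  let ?b = "b2 @ v" and ?c = "v @ c1"
  obtain x y where xy: "hd ?b = Dir x" "last ?b = Inv y"
    using is_band_ends[OF b] by blast
  have bw: "band_word ?b"
    using b by (rule is_band_imp_band_word)
  have turn: "sword [last ?b, hd ?b]"
    using bw by (rule band_word_turn)
  have vc: "sword (?c @ v)"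
    using band_word_square[OF c] assms(3) sword_appendD(1)[of "?c @ v" c1] by simp
  have "hd (b2 @ v @ c1) = hd ?b"
    using assms(3) by (cases b2) auto
  then have "sword ((?c @ v) @ (b2 @ v @ c1))"
    using sword_turn[OF vc assms(4), of y x] xy turn assms(3) by simp
  then have "sword (?c @ (v @ b2) @ ?c)"
    by simp
  then obtain k where "v @ b2 = word_pow ?c k"
    using return_word[OF c] by blast
  then show ?thesis
    using conjugate_append[of b2 v] primitive_conjugate_word_pow band_word_primitive[OF bw] by metis
qed

text \<open>The length conditions say that window and block share a syllable. Containment either way
  falls under \<open>band_word_window_conjugate\<close>, overlap at one side under the two preceding
  lemmas. Later this confines the windows in a path word to the bands of the path.\<close>

lemma overlap_conjugate:
  assumes b: "is_band \<Lambda> (Word b)" and g: "band_word g"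
    and "sword (A @ g @ B)" "A @ g @ B = A' @ b @ B'"
    and "length A < length A' + length b" "length A' < length A + length g"
  shows "conjugate b g"
  using assms(4)
proof (cases rule: append_eq_append_casesE)
  case (left s)
  have bw: "band_word b"
    using b by (rule is_band_imp_band_word)
  have gB: "sword (g @ B)"
    using assms(3) band_word_not_Nil[OF g] sword_appendD(2)[of A "g @ B"] by simp
  from left(2) show ?thesis
  proof (cases rule: append_eq_append_casesE)
    case l: (left u)
    then have "u = []" using left assms(6) by auto
    then show ?thesis using left l assms(6) by auto
  next
    case r: (right v)
    from r(2) show ?thesis
    proof (cases rule: append_eq_append_casesE)
      case (left t)
      then show ?thesis
        using band_word_window_conjugate[of s b t] g bw r conjugate_sym by auto
    next
      case 2: (right b1)
      then show ?thesis
        using overlap_left[of v b1 s] b g r gB sword_appendD(1)[of "s @ v @ b1" B'] by auto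
    qed
  qed
next
  case (right s)
  have bw: "band_word b"
    using b by (rule is_band_imp_band_word)
  have sgB: "sword (s @ g @ B)"
    using assms(3) right band_word_not_Nil[OF g] sword_appendD(2)[of A' "s @ g @ B"] by auto
  from right(2) show ?thesis
  proof (cases rule: append_eq_append_casesE)
    case (left u)
    then show ?thesis using assms(5) right by auto
  next
    case r: (right v)
    from r(2) show ?thesis
    proof (cases rule: append_eq_append_casesE)
      case (left t)
      then show ?thesis
        using band_word_window_conjugate[of s g t] g bw r by auto
    next
      case 2: (right t)
      then show ?thesis
        using overlap_right[of s v t] b g r sgB sword_appendD(1)[of "s @ v @ t" B] by auto
    qed
  qed
qed

end

section \<open>H-equivalence and H-reductions of words\<close>

context string_algebra
begin

abbreviation H_equiv_word :: "'a syl list \<Rightarrow> 'a syl list \<Rightarrow> bool" where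
  "H_equiv_word p q \<equiv> H_equiv \<Lambda> (Word p) (Word q)"

lemma composes_Word_Word: "composes \<Lambda> (Word p) (Word q) \<longleftrightarrow> sword p \<and> sword q \<and> sword (p @ q)"
  by (simp add: composes_def)

lemma composes_Triv_Word:
  "composes \<Lambda> (Triv v i) (Word q) \<longleftrightarrow>
    is_string \<Lambda> (Triv v i) \<and> sword q \<and> v = syl_tgt \<Lambda> (hd q) \<and> i = syl_epsilon \<Lambda> (hd q)"
  by (auto simp: composes_def)

lemma composes_Word_Triv:
  "composes \<Lambda> (Word p) (Triv v i) \<longleftrightarrow>
    is_string \<Lambda> (Triv v i) \<and> sword p \<and> v = syl_src \<Lambda> (last p) \<and> i = - syl_sigma \<Lambda> (last p)"
  by (auto simp: composes_def)

lemma sword_not_Nil: "sword p \<Longrightarrow> p \<noteq> []"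
  by (auto simp: is_string.simps(2))

lemma sword_junction: "sword (p @ q) \<Longrightarrow> p \<noteq> [] \<Longrightarrow> q \<noteq> [] \<Longrightarrow> syl_src \<Lambda> (last p) = syl_tgt \<Lambda> (hd q)"
  by (auto simp: is_string.simps(2) successively_append_iff)

lemma syl_tgt_in_verts: "syl_arc s \<in> arcs (quiver \<Lambda>) \<Longrightarrow> syl_tgt \<Lambda> s \<in> verts (quiver \<Lambda>)"
  by (cases s) auto

lemma syl_src_in_verts: "syl_arc s \<in> arcs (quiver \<Lambda>) \<Longrightarrow> syl_src \<Lambda> s \<in> verts (quiver \<Lambda>)"
  by (cases s) auto

lemma syl_signs:
  "syl_arc s \<in> arcs (quiver \<Lambda>) \<Longrightarrow> syl_epsilon \<Lambda> s \<in> {1, -1} \<and> syl_sigma \<Lambda> s \<in> {1, -1}"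
  using signs by (cases s) auto

lemma sword_arcs: "sword p \<Longrightarrow> s \<in> set p \<Longrightarrow> syl_arc s \<in> arcs (quiver \<Lambda>)"
  by (auto simp: is_string.simps(2))

lemma is_string_Triv_hd:
  assumes "sword p"
  shows "is_string \<Lambda> (Triv (syl_tgt \<Lambda> (hd p)) (syl_epsilon \<Lambda> (hd p)))"
  using sword_arcs[OF assms, of "hd p"] sword_not_Nil[OF assms] syl_tgt_in_verts syl_signs by simp

lemma is_string_Triv_last:
  assumes "sword p"
  shows "is_string \<Lambda> (Triv (syl_src \<Lambda> (last p)) (- syl_sigma \<Lambda> (last p)))"
  using sword_arcs[OF assms, of "last p"] sword_not_Nil[OF assms] syl_src_in_verts syl_signs[of "last p"]
  by auto

text \<open>Testing with the string of length 0 at the end of \<open>p\<close> yields equal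
  \<epsilon>-signs. The other tests are nonempty words, and a word with the wrong source fails on
  both sides. In this form strings of length 0 no longer occur.\<close>

lemma H_equiv_word_iff:
  "H_equiv_word p q \<longleftrightarrow> sword p \<and> sword q \<and> syl_tgt \<Lambda> (hd p) = syl_tgt \<Lambda> (hd q) \<and>
    syl_epsilon \<Lambda> (hd p) = syl_epsilon \<Lambda> (hd q) \<and> (\<forall>x. sword (x @ p) \<longleftrightarrow> sword (x @ q))"
  (is "?L \<longleftrightarrow> ?R")
proof
  assume L: ?L
  have p: "sword p" and q: "sword q" and tgt: "syl_tgt \<Lambda> (hd p) = syl_tgt \<Lambda> (hd q)"
    using L by (auto simp: H_equiv_def)
  have ex: "composes \<Lambda> x (Word p) = composes \<Lambda> x (Word q)"
    if "is_string \<Lambda> x" "src \<Lambda> x = syl_tgt \<Lambda> (hd p)" for x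
    using L that by (auto simp: H_equiv_def)
  have "composes \<Lambda> (Triv (syl_tgt \<Lambda> (hd p)) (syl_epsilon \<Lambda> (hd p))) (Word q)"
    using ex[of "Triv (syl_tgt \<Lambda> (hd p)) (syl_epsilon \<Lambda> (hd p))"] is_string_Triv_hd[OF p] p
    by (simp add: composes_Triv_Word)
  then have eps: "syl_epsilon \<Lambda> (hd p) = syl_epsilon \<Lambda> (hd q)"
    by (simp add: composes_Triv_Word)
  have "sword (x @ p) \<longleftrightarrow> sword (x @ q)" for x
  proof (cases "x = [] \<or> \<not> sword x \<or> syl_src \<Lambda> (last x) \<noteq> syl_tgt \<Lambda> (hd p)")
    case True
    then show ?thesis
      using p q tgt sword_appendD(1)[of x] sword_junction[of x] sword_not_Nil by (metis append_Nil)
  next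
    case False
    then show ?thesis
      using ex[of "Word x"] p q by (simp add: composes_Word_Word)
  qed
  then show ?R using p q tgt eps by blast
next
  assume R: ?R
  have "composes \<Lambda> x (Word p) = composes \<Lambda> x (Word q)" for x
    using R by (cases x) (auto simp: composes_Word_Word composes_Triv_Word)
  then show ?L
    using R by (simp add: H_equiv_def)
qed

lemma H_equiv_word_sword_iff: "H_equiv_word p q \<Longrightarrow> sword (x @ p) \<longleftrightarrow> sword (x @ q)"
  by (simp add: H_equiv_word_iff)

lemma H_equiv_word_sym: "H_equiv_word p q \<Longrightarrow> H_equiv_word q p"
  by (auto simp: H_equiv_word_iff)

lemma H_equiv_word_trans: "H_equiv_word p q \<Longrightarrow> H_equiv_word q r \<Longrightarrow> H_equiv_word p r"
  by (auto simp: H_equiv_word_iff)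

lemma H_equiv_word_append_left:
  assumes "H_equiv_word p q" "sword (z @ q)"
  shows "H_equiv_word (z @ p) (z @ q)"
proof (cases z)
  case Nil
  then show ?thesis using assms by simp
next
  case (Cons a z')
  have "sword (x @ z @ p) \<longleftrightarrow> sword (x @ z @ q)" for x
    using assms H_equiv_word_sword_iff[OF assms(1), of "x @ z"] by simp
  then show ?thesis
    using assms(2) Cons unfolding H_equiv_word_iff by (metis append_Cons append_Nil list.sel(1))
qed

text \<open>Whether a word can stand in front of \<open>b B\<close> is decided by \<open>b\<close>
  alone, since \<open>b\<close> is mixed and \<open>b B\<close> is a string. What follows
  \<open>b\<close> is therefore invisible to H-equivalence.\<close>

lemma H_equiv_word_append_right:
  assumes "H_equiv_word (p @ b) (q @ b)" "mixed b" "sword (b @ B)"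
  shows "H_equiv_word (p @ b @ B) (q @ b @ B)"
proof -
  have "sword (x @ b @ B) \<longleftrightarrow> sword (x @ b)" for x
    using sword_glue[OF _ assms(3,2), of x] mixed_not_Nil[OF assms(2)] sword_appendD(1)[of "x @ b" B]
    by auto
  then have str: "sword (x @ p @ b @ B) \<longleftrightarrow> sword (x @ q @ b @ B)" for x
    using H_equiv_word_sword_iff[OF assms(1), of x] by (metis append_assoc)
  have "sword (p @ b @ B)" "sword (q @ b @ B)"
    using assms(1) sword_glue[OF _ assms(3,2)] by (auto simp: H_equiv_word_iff)
  moreover have "hd (r @ b @ B) = hd (r @ b)" for r
    using mixed_not_Nil[OF assms(2)] by (cases r) auto
  ultimately show ?thesis
    using assms(1) str by (simp add: H_equiv_word_iff)
qed

text \<open>A word put in front sees only the first \<open>g\<close>. Removing a copy from a power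
  with exponent at least two thus always preserves the H-class, which is why the skeleton operations
  count as H-reductions.\<close>

lemma H_equiv_word_square:
  assumes "band_word g" "sword (g @ B)"
  shows "H_equiv_word (g @ g @ B) (g @ B)"
proof -
  have "sword (g @ g @ B)"
    using sword_glue[OF band_word_square[OF assms(1)] assms(2) band_word_mixed[OF assms(1)]] .
  moreover have "sword (x @ g @ g @ B) \<longleftrightarrow> sword (x @ g @ B)" for x
  proof -
    have "sword (x @ g @ C) \<longleftrightarrow> sword (x @ g)" if "sword (g @ C)" for C
      using sword_glue[OF _ that band_word_mixed[OF assms(1)]] sword_appendD(1)[of "x @ g" C]
        band_word_not_Nil[OF assms(1)] by auto
    then show ?thesis
      using calculation assms(2) by blast
  qed
  moreover have "hd (g @ g @ B) = hd (g @ B)"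
    using band_word_not_Nil[OF assms(1)] by simp
  ultimately show ?thesis
    using assms(2) unfolding H_equiv_word_iff by metis
qed

text \<open>
  With \<open>A\<close> and \<open>B\<close> nonempty no strings of length 0 occur; windows of the intermediate bands of a path
  always satisfy this.
\<close>

definition H_step :: "'a syl list \<Rightarrow> 'a syl list \<Rightarrow> 'a syl list \<Rightarrow> bool" where
  "H_step c Y Z \<longleftrightarrow> (\<exists>A g B. conjugate c g \<and> A \<noteq> [] \<and> B \<noteq> [] \<and> Y = A @ g @ B \<and> Z = A @ B \<and>
     sword Y \<and> H_equiv_word (g @ B) B)"

definition H_step_fun :: "'a syl list \<Rightarrow> 'a syl list \<Rightarrow> 'a syl list" where
  "H_step_fun c Y = (if \<exists>Z. H_step c Y Z then THE Z. H_step c Y Z else Y)"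

definition contains_pow :: "'a syl list \<Rightarrow> nat \<Rightarrow> 'a syl list \<Rightarrow> bool" where
  "contains_pow c n Y \<longleftrightarrow> (\<exists>A g B. conjugate c g \<and> Y = A @ word_pow g n @ B \<and> sword Y)"

lemma H_step_sword: "H_step c Y Z \<Longrightarrow> sword Y \<and> sword Z"
  unfolding H_step_def using H_equiv_word_sword_iff by blast

end

section \<open>Commutation of H-reductions at different bands\<close>

context domestic_string_algebra
begin

text \<open>\<open>v s v t E\<close> is H-equivalent to \<open>v t E\<close> and hence to
  \<open>E\<close>. Since \<open>v t\<close> may stand in front of \<open>E\<close>, it may stand in
  front of \<open>v s v t E\<close> as well. So \<open>(v t) (v s) (v t)\<close> is a string, and
  \<open>v s\<close> is a return word of \<open>v t\<close>.\<close>

lemma overlapping_H_windows: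
  assumes "band_word (s @ v)" "band_word (v @ t)"
    and b: "H_equiv_word (s @ v @ t @ E) (t @ E)" and c: "H_equiv_word (v @ t @ E) E"
  shows "conjugate (s @ v) (v @ t)"
proof -
  have vtE: "sword (v @ t @ E)"
    using c by (simp add: H_equiv_word_iff)
  have "H_equiv_word (v @ s @ v @ t @ E) E"
    using H_equiv_word_trans[OF H_equiv_word_append_left[OF b vtE] c] .
  then have "sword ((v @ t) @ v @ s @ v @ t @ E)"
    using H_equiv_word_sword_iff[of "v @ s @ v @ t @ E" E "v @ t"] vtE by simp
  then have "sword ((v @ t) @ (v @ s) @ (v @ t))"
    using sword_appendD(1)[of "(v @ t) @ (v @ s) @ (v @ t)" E] band_word_not_Nil[OF assms(2)] by auto
  then obtain k where "v @ s = word_pow (v @ t) k"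
    using return_word[OF assms(2)] by blast
  then show ?thesis
    using conjugate_append[of s v] primitive_conjugate_word_pow band_word_primitive[OF assms(1)]
    by metis
qed

text \<open>The situation arises when deleting \<open>b\<close> joins \<open>g2\<close> and
  \<open>g1\<close> to a window \<open>g\<close>. Starting from \<open>g g E\<close>, the
  H-equivalences insert \<open>b\<close> between \<open>g2\<close> and \<open>g1\<close> and a
  further \<open>g\<close> before \<open>E\<close>. So \<open>g2 b g1\<close> is a power of
  \<open>g\<close>, which makes \<open>b\<close> a power of \<open>g1 g2\<close>.\<close>

lemma straddling_H_window:
  assumes "band_word b" and g: "band_word (g2 @ g1)" and "sword (g2 @ b @ g1 @ E)"
    and bE: "H_equiv_word (b @ g1 @ E) (g1 @ E)" and gE: "H_equiv_word (g2 @ g1 @ E) E"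
  shows "conjugate b (g2 @ g1)"
proof -
  have c: "sword ((g2 @ g1) @ E)"
    using gE by (simp add: H_equiv_word_iff)
  have "sword ((g2 @ g1) @ (g2 @ g1) @ E)"
    using sword_glue[OF band_word_square[OF g] c band_word_mixed[OF g]] .
  then have "sword (((g2 @ g1) @ g2) @ g1 @ E)"
    by simp
  then have "sword (((g2 @ g1) @ g2 @ b @ g1) @ E)"
    using H_equiv_word_sword_iff[OF bE, of "(g2 @ g1) @ g2"] by simp
  then have "sword (((g2 @ g1) @ g2 @ b @ g1) @ (g2 @ g1) @ E)"
    using H_equiv_word_sword_iff[OF gE, of "(g2 @ g1) @ g2 @ b @ g1"] by simp
  then have "sword ((g2 @ g1) @ (g2 @ b @ g1) @ (g2 @ g1))"
    using sword_appendD(1)[of "(g2 @ g1) @ (g2 @ b @ g1) @ (g2 @ g1)" E] band_word_not_Nil[OF g] by auto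
  then obtain k where k: "g2 @ b @ g1 = word_pow (g2 @ g1) k"
    using return_word[OF g] by blast
  moreover have "k \<noteq> 0"
    using k band_word_not_Nil[OF assms(1)] by (cases k) auto
  then obtain m where "k = Suc m"
    by (cases k) auto
  ultimately have "g2 @ b @ g1 = g2 @ word_pow (g1 @ g2) m @ g1"
    unfolding \<open>k = Suc m\<close> using word_pow_rotate[of g1 m g2] by simp
  then have "b = word_pow (g1 @ g2) m"
    by simp
  then have "conjugate b (g1 @ g2)"
    using primitive_conjugate_word_pow[OF band_word_primitive[OF assms(1)]] conjugate_refl by metis
  then show ?thesis
    using conjugate_append conjugate_trans by blast
qed

lemma H_step_unique:
  assumes "band_word c" "H_step c Y Z" "H_step c Y Z'"
  shows "Z = Z'"
proof -
  obtain A g B where 1: "conjugate c g" "Y = A @ g @ B" "Z = A @ B" "sword Y"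
    using assms(2) by (auto simp: H_step_def)
  obtain A' g' B' where 2: "conjugate c g'" "Y = A' @ g' @ B'" "Z' = A' @ B'"
    using assms(3) by (auto simp: H_step_def)
  have "conjugate g g'"
    using 1(1) 2(1) conjugate_sym conjugate_trans by blast
  have "A @ B = A' @ B'"
  proof (rule windows_same_reduct)
    show "A @ g @ B = A' @ g' @ B'"
      using 1(2)[symmetric] 2(2) by (rule trans)
    show "sword (A @ g @ B)"
      using 1(2,4) by (rule subst)
    show "band_word g"
      using assms(1) 1(1) by (rule band_word_conjugate)
  qed fact
  then show ?thesis
    unfolding 1(3) 2(3) .
qed

text \<open>Partial overlap is excluded by \<open>overlapping_H_windows\<close>, containment by
  \<open>band_word_window_conjugate\<close>, so the windows are disjoint. Deleting the right one
  changes the tail of the left one only up to H-equivalence; deleting the left one does not touch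
  the tail of the right one.\<close>

lemma H_step_diamond:
  assumes b: "band_word b" and c: "band_word c" and "\<not> conjugate b c"
    and "H_step b Y Z" "H_step c Y Z'"
  shows "\<exists>W. H_step c Z W \<and> H_step b Z' W"
proof -
  \<comment> \<open>Here \<open>g\<close> is the window that starts no later. The bands are
    quantified afresh, so both orders of the given windows are instances.\<close>
  have main: "\<exists>W. H_step c (A @ B) W \<and> H_step b (A' @ B') W"
    if cj: "conjugate b g" "conjugate c h" and nc: "\<not> conjugate g h"
      and bw: "band_word g" "band_word h"
      and ne: "A \<noteq> []" "B \<noteq> []" "A' \<noteq> []" "B' \<noteq> []"
      and str: "sword (A @ g @ B)" and eq: "A @ g @ B = A' @ h @ B'"
      and le: "length A \<le> length A'"
      and H: "H_equiv_word (g @ B) B" "H_equiv_word (h @ B') B'"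
    for b c g h A B A' B'
  proof -
    obtain s where s: "A' = A @ s" "g @ B = s @ h @ B'"
      using append_eq_appendE[OF eq le] by metis
    from s(2) show ?thesis
    proof (cases rule: append_eq_append_casesE)
      case (left M)
      have Z: "sword (A @ M @ h @ B')"
        using H_equiv_word_sword_iff[OF H(1), of A] str left by simp
      then have MhB: "sword (M @ h @ B')"
        using ne sword_appendD(2)[of A] by blast
      have ghB: "sword (g @ M @ h @ B')"
        using str left ne sword_appendD(2)[of A "g @ B"] by simp
      have MB: "sword (M @ B')"
        using MhB H_equiv_word_sword_iff[OF H(2)] by blast
      have gMB: "sword (g @ M @ B')"
        using ghB H_equiv_word_sword_iff[OF H(2), of "g @ M"] by simp
      have "H_equiv_word (g @ M @ h @ B') (g @ M @ B')"
        using H_equiv_word_append_left[OF H(2), of "g @ M"] gMB by simp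
      moreover have "H_equiv_word (M @ h @ B') (M @ B')"
        using H_equiv_word_append_left[OF H(2) MB] .
      ultimately have "H_equiv_word (g @ M @ B') (M @ B')"
        using H(1) left H_equiv_word_trans H_equiv_word_sym by metis
      moreover have "sword (A @ g @ M @ B')"
        using str left H_equiv_word_sword_iff[OF H(2), of "A @ g @ M"] by simp
      ultimately have "H_step b (A' @ B') (A @ M @ B')"
        unfolding H_step_def using cj ne s(1) left
        by (intro exI[of _ A] exI[of _ g] exI[of _ "M @ B'"]) simp
      moreover have "H_step c (A @ B) (A @ M @ B')"
        unfolding H_step_def using cj ne Z H left
        by (intro exI[of _ "A @ M"] exI[of _ h] exI[of _ B']) simp
      ultimately show ?thesis by blast
    next
      case (right v)
      from right(2)[symmetric] have False
      proof (cases rule: append_eq_append_casesE)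
        case (left t)
        then show False
          using overlapping_H_windows[of s v t B'] right bw H nc by simp
      next
        case 2: (right t)
        then show False
          using band_word_window_conjugate[of s h t] right bw nc by simp
      qed
      then show ?thesis ..
    qed
  qed
  obtain A g B where 1: "conjugate b g" "A \<noteq> []" "B \<noteq> []" "Y = A @ g @ B" "Z = A @ B"
    "sword Y" "H_equiv_word (g @ B) B"
    using assms(4) by (auto simp: H_step_def)
  obtain A' h B' where 2: "conjugate c h" "A' \<noteq> []" "B' \<noteq> []" "Y = A' @ h @ B'" "Z' = A' @ B'"
    "H_equiv_word (h @ B') B'"
    using assms(5) by (auto simp: H_step_def)
  have nc: "\<not> conjugate g h" "\<not> conjugate h g"
    using assms(3) 1(1) 2(1) conjugate_sym conjugate_trans by blast+
  have bw: "band_word g" "band_word h"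
    using b c 1(1) 2(1) band_word_conjugate by blast+
  have eq: "A @ g @ B = A' @ h @ B'"
    using 1(4)[symmetric] 2(4) by (rule trans)
  have str: "sword (A @ g @ B)"
    using 1(4,6) by (rule subst)
  show ?thesis
  proof (cases "length A \<le> length A'")
    case True
    then show ?thesis
      unfolding 1(5) 2(5)
      using main[OF 1(1) 2(1) nc(1) bw 1(2,3) 2(2,3) str eq _ 1(7) 2(6)] by blast
  next
    case False
    then have "length A' \<le> length A" by simp
    then show ?thesis
      unfolding 1(5) 2(5)
      using main[OF 2(1) 1(1) nc(2) bw(2,1) 2(2,3) 1(2,3) str[unfolded eq] eq[symmetric] _ 2(6) 1(7)] by blast
  qed
qed

text \<open>A window of \<open>c\<close> in \<open>Z\<close> lies to the right of the cut with
  unchanged tail, to the left with a tail changed up to H-equivalence, or it straddles the cut,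
  which \<open>straddling_H_window\<close> rules out.\<close>

lemma H_step_persistent:
  assumes b: "band_word b" and c: "band_word c" and nc: "\<not> conjugate b c"
    and "H_step b Y Z" "H_step c Z W"
  shows "\<exists>V. H_step c Y V"
proof -
  obtain A g B where 1: "conjugate b g" "A \<noteq> []" "B \<noteq> []" "Y = A @ g @ B" "Z = A @ B"
    "sword Y" "H_equiv_word (g @ B) B"
    using assms(4) by (auto simp: H_step_def)
  obtain A' h B' where 2: "conjugate c h" "A' \<noteq> []" "B' \<noteq> []" "Z = A' @ h @ B'" "sword Z"
    "H_equiv_word (h @ B') B'"
    using assms(5) by (auto simp: H_step_def)
  have bw: "band_word g" "band_word h"
    using b c 1(1) 2(1) band_word_conjugate by blast+
  have "A @ B = A' @ h @ B'"
    using 1 2 by simp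
  then show ?thesis
  proof (cases rule: append_eq_append_casesE)
    case (left t)
    then show ?thesis
      unfolding H_step_def using 1 2
      by (intro exI[of _ "(A @ g @ t) @ B'"] exI[of _ "A @ g @ t"] exI[of _ h] exI[of _ B']) simp
  next
    case (right t)
    from right(2) show ?thesis
    proof (cases rule: append_eq_append_casesE)
      case (left u)
      have "sword (u @ B)"
        using 2(4,5) left right H_equiv_word_sword_iff[OF 2(6), of A'] 2(2) sword_appendD(2)[of A' "u @ B"] 1(3)
        by simp
      then have uB: "H_equiv_word (u @ g @ B) (u @ B)"
        by (rule H_equiv_word_append_left[OF 1(7)])
      have "sword (h @ u @ B)"
        using 2(6) left by (simp add: H_equiv_word_iff)
      then have "H_equiv_word (h @ u @ g @ B) (h @ u @ B)"
        using H_equiv_word_append_left[OF 1(7), of "h @ u"] by simp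
      then have "H_equiv_word (h @ u @ g @ B) (u @ g @ B)"
        using uB 2(6) left H_equiv_word_trans H_equiv_word_sym by metis
      then show ?thesis
        unfolding H_step_def using 1 2 left right
        by (intro exI[of _ "A' @ u @ g @ B"] exI[of _ A'] exI[of _ h] exI[of _ "u @ g @ B"]) simp
    next
      case r: (right u)
      have "conjugate g (t @ u)"
      proof (rule straddling_H_window)
        show "sword (t @ g @ u @ B')"
          using 1 right r sword_appendD(2)[of A' "t @ g @ B"] by simp
      qed (use bw 1 2 r in auto)
      then have False
        using nc 1 2 r conjugate_sym conjugate_trans by metis
      then show ?thesis ..
    qed
  qed
qed

lemma H_step_fun_eq: "band_word c \<Longrightarrow> H_step c Y Z \<Longrightarrow> H_step_fun c Y = Z"
  unfolding H_step_fun_def using H_step_unique by (auto intro!: the_equality)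

lemma H_step_fun_id: "\<nexists>Z. H_step c Y Z \<Longrightarrow> H_step_fun c Y = Y"
  by (simp add: H_step_fun_def)

lemma H_step_fun_enabled:
  assumes "band_word b" "band_word c" "\<not> conjugate b c"
  shows "(\<exists>Z. H_step b (H_step_fun c Y) Z) \<longleftrightarrow> (\<exists>Z. H_step b Y Z)"
proof (cases "\<exists>Z. H_step c Y Z")
  case True
  then obtain Z where Z: "H_step c Y Z" ..
  have "\<not> conjugate c b" using assms(3) conjugate_sym by blast
  then show ?thesis
    using H_step_fun_eq[OF assms(2) Z] H_step_diamond[OF assms(1,2,3) _ Z]
      H_step_persistent[OF assms(2,1) _ Z] by metis
next
  case False
  then show ?thesis by (simp add: H_step_fun_id)
qed

lemma H_step_fun_commute:
  assumes "band_word b" "band_word c" "\<not> conjugate b c"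
  shows "H_step_fun b (H_step_fun c Y) = H_step_fun c (H_step_fun b Y)"
proof -
  have nc: "\<not> conjugate c b" using assms(3) conjugate_sym by blast
  note en = H_step_fun_enabled[OF assms] H_step_fun_enabled[OF assms(2,1) nc]
  show ?thesis
  proof (cases "(\<exists>Z. H_step b Y Z) \<and> (\<exists>Z. H_step c Y Z)")
    case True
    then obtain Z Z' where Z: "H_step b Y Z" "H_step c Y Z'" by blast
    obtain W where "H_step c Z W" "H_step b Z' W"
      using H_step_diamond[OF assms Z] by blast
    then show ?thesis
      using H_step_fun_eq assms(1,2) Z by metis
  next
    case False
    then show ?thesis
      using en H_step_fun_id by metis
  qed
qed

text \<open>A step at \<open>c\<close> lowers the largest exponent, which bounds the number of such
  steps. A power beside the cut absorbs the deleted window by sliding it with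
  \<open>windows_shift\<close>. If the cut runs through the power, the H-equivalence shows that the
  deleted window has the phase of the cut.\<close>

lemma H_step_contains_pow:
  assumes c: "band_word c" and "H_step c Y Z" "contains_pow c n Z" "n \<ge> 1"
  shows "contains_pow c (Suc n) Y"
proof -
  obtain A b B where 1: "conjugate c b" "A \<noteq> []" "B \<noteq> []" "Y = A @ b @ B" "Z = A @ B"
    "sword Y" "H_equiv_word (b @ B) B"
    using assms(2) by (auto simp: H_step_def)
  obtain A' g B' where 2: "conjugate c g" "Z = A' @ word_pow g n @ B'" "sword Z"
    using assms(3) by (auto simp: contains_pow_def)
  obtain m where m: "n = Suc m"
    using assms(4) by (cases n) auto
  have bw: "band_word b" "band_word g" and cj: "conjugate b g" "conjugate g b"
    using c 1(1) 2(1) band_word_conjugate conjugate_sym conjugate_trans by blast+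
  have found: ?thesis if "Y = P @ word_pow g (Suc n) @ Q" for P Q
    unfolding contains_pow_def using that 2(1) 1(6) by blast
  have bB: "sword (b @ B)"
    using 1 by (simp add: H_equiv_word_iff)
  have "A @ B = A' @ word_pow g n @ B'"
    using 1 2 by simp
  then show ?thesis
  proof (cases rule: append_eq_append_casesE)
    case (left t)
    have "b @ B = (b @ t) @ g @ word_pow g m @ B'"
      using left m by simp
    then have "b @ b @ t = (b @ t) @ g"
      by (rule windows_shift[OF bw(1) cj(1) _ bB])
    then have "b @ t = t @ g"
      by simp
    then have "Y = (A @ t) @ word_pow g (Suc n) @ B'"
      unfolding 1(4) left(2) by simp
    then show ?thesis by (rule found)
  next
    case (right t)
    from right(2) show ?thesis
    proof (cases rule: append_eq_append_casesE)
      case (left u)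
      have Y: "Y = A' @ word_pow g m @ g @ u @ b @ B"
        unfolding 1(4) right(1) left(1) m word_pow_Suc_right by simp
      have "sword (g @ u @ b @ B)"
        using 1(6) Y band_word_not_Nil[OF bw(2)] sword_appendD(2)[of "A' @ word_pow g m" "g @ u @ b @ B"]
        by simp
      then have "g @ g @ u = (g @ u) @ b"
        by (intro windows_shift[OF bw(2) cj(2), of _ _ B]) auto
      then have "Y = A' @ word_pow g m @ (g @ g @ u) @ B"
        unfolding Y by simp
      also have "\<dots> = A' @ word_pow g (Suc n) @ u @ B"
        unfolding m word_pow_Suc_right by simp
      finally show ?thesis by (rule found)
    next
      case r: (right u)
      have tu: "t @ u = word_pow g n" using r by simp
      obtain i j h1 h2 where h: "g = h1 @ h2" "t = word_pow g i @ h1" "u = h2 @ word_pow g j"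
        "Suc (i + j) = n"
        using word_pow_split[OF tu assms(4)] by blast
      have mn: "mixed (word_pow g n)"
        using band_word_mixed[OF bw(2)] m by simp
      \<comment> \<open>Doubling the power yields the string \<open>u t B\<close>, into which the
        H-equivalence may insert \<open>b\<close>.\<close>
      have "sword (word_pow g n @ word_pow g n)"
        using band_word_pow[OF bw(2), of "n + n"] m unfolding word_pow_add by simp
      moreover have "sword (word_pow g n @ B')"
        using 2(2,3) mixed_not_Nil[OF mn] sword_appendD(2)[of A'] by blast
      ultimately have "sword (word_pow g n @ word_pow g n @ B')"
        using sword_glue mn by blast
      then have "sword (t @ u @ t @ B)"
        unfolding tu[symmetric] r(2) by simp
      then have "sword (u @ t @ B)"
        using sword_appendD(2)[of t "u @ t @ B"] 1(3) by simp
      then have utbB: "sword (u @ t @ b @ B)"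
        using H_equiv_word_sword_iff[OF 1(7), of "u @ t"] by simp
      \<comment> \<open>\<open>k\<close> is the rotation of \<open>g\<close> read from the cut. Once
        \<open>k b\<close> is known to be a string, the case \<open>M = []\<close> of
        \<open>disjoint_windows_shift\<close> gives \<open>b = k\<close>, so putting
        \<open>b\<close> back merely lengthens the power.\<close>
      define k where "k = h2 @ h1"
      have gk: "conjugate g k"
        unfolding h k_def by (rule conjugate_append)
      then have k: "band_word k" "conjugate k b"
        using bw(2) band_word_conjugate cj(2) conjugate_sym conjugate_trans by blast+
      have "u @ t = h2 @ word_pow (h1 @ h2) (j + i) @ h1"
        unfolding h(2,3) word_pow_add h(1) by simp
      also have "\<dots> = word_pow k (j + i) @ k"
        unfolding k_def using word_pow_rotate[of h2 "j + i" h1] by simp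
      finally have "u @ t @ b @ B = (word_pow k (j + i) @ k @ b) @ B"
        by (metis append_assoc)
      with utbB have "sword ((word_pow k (j + i) @ k @ b) @ B)"
        by (rule back_subst)
      then have "sword (k @ b)"
        using band_word_not_Nil[OF bw(1)] sword_appendD(1)[of "word_pow k (j + i) @ k @ b" B]
          sword_appendD(2)[of "word_pow k (j + i)" "k @ b"] by simp
      then have "b = k"
        using disjoint_windows_shift[OF k, of "[]"] by simp
      then have "t @ b @ u = word_pow g i @ g @ g @ word_pow g j"
        unfolding h(2,3) k_def h(1) by simp
      also have "\<dots> = word_pow g (i + (Suc (Suc j)))"
        unfolding word_pow_add by simp
      finally have "Y = A' @ word_pow g (Suc n) @ B'"
        unfolding 1(4) right(1) r(2) h(4)[symmetric] by simp
      then show ?thesis by (rule found)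
    qed
  qed
qed

text \<open>If one more application still acts, then so did the \<open>k\<close> earlier ones, and
  pulling the window back through them raises the exponent by one each time.\<close>

lemma H_step_fun_funpow_enabled:
  assumes "band_word c" "\<exists>Z. H_step c ((H_step_fun c ^^ k) Y) Z"
  shows "contains_pow c (Suc k) Y"
  using assms(2)
proof (induction k arbitrary: Y)
  case 0
  then show ?case
    unfolding H_step_def contains_pow_def by fastforce
next
  case (Suc k)
  show ?case
  proof (cases "\<exists>Z. H_step c Y Z")
    case True
    then obtain Z where Z: "H_step c Y Z" ..
    have "contains_pow c (Suc k) (H_step_fun c Y)"
      using Suc by (simp add: funpow_swap1)
    then show ?thesis
      using H_step_contains_pow[OF assms(1) Z] H_step_fun_eq[OF assms(1) Z] by simp
  next
    case False
    then have "(H_step_fun c ^^ k) Y = Y" for k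
      using H_step_fun_id[OF False] by (induction k) auto
    then show ?thesis
      using False Suc.prems by metis
  qed
qed

lemma H_step_fun_funpow_fixed:
  assumes "band_word c" "\<not> contains_pow c (Suc k) Y"
  shows "H_step_fun c ((H_step_fun c ^^ k) Y) = (H_step_fun c ^^ k) Y"
  using H_step_fun_funpow_enabled[OF assms(1)] assms(2) H_step_fun_id by blast

lemma power_H_step:
  assumes "band_word g" "conjugate c g" "sword (A @ word_pow g (Suc (Suc n)) @ B)" "A \<noteq> []" "B \<noteq> []"
  shows "H_step c (A @ word_pow g (Suc (Suc n)) @ B) (A @ word_pow g (Suc n) @ B)"
proof -
  have "sword (g @ word_pow g n @ B)"
    using assms(3,4) band_word_not_Nil[OF assms(1)] sword_appendD(2)[of "A @ g" "g @ word_pow g n @ B"]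
    by simp
  then show ?thesis
    unfolding H_step_def using assms H_equiv_word_square[OF assms(1), of "word_pow g n @ B"]
    by (intro exI[of _ A] exI[of _ g] exI[of _ "word_pow g (Suc n) @ B"]) simp
qed

end

section \<open>Reductions of strings with fixed end bands\<close>

text \<open>Vertex and sign of a string of length 0 are forgotten. The neighbouring syllables
  determine both, as \<open>factors_exist\<close> and \<open>unique_middle_factor\<close>
  exploit.\<close>

fun str_word :: "('v, 'a) str \<Rightarrow> 'a syl list" where
  "str_word (Triv v i) = []"
| "str_word (Word w) = w"

lemma cat_Word: "cat x (Word w) = Word (str_word x @ w)"
  by (cases x) auto

lemma Word_cat: "cat (Word w) x = Word (w @ str_word x)"
  by (cases x) auto

context string_algebra
begin

lemma composes_cat_Word: "composes \<Lambda> x (Word w) \<Longrightarrow> sword (str_word x @ w)"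
  by (cases x) (auto simp: composes_def)

lemma Word_composes_cat: "composes \<Lambda> (Word w) x \<Longrightarrow> sword (w @ str_word x)"
  by (cases x) (auto simp: composes_def)

lemma factors_middle_Word:
  "factors \<Lambda> y x (Word g) w \<Longrightarrow> y = Word (str_word x @ g @ str_word w) \<and> sword (str_word x @ g @ str_word w)"
  using composes_cat_Word[of x "g @ str_word w"] by (simp add: factors_def Word_cat cat_Word)

lemma factors_outer_Words:
  "factors \<Lambda> y (Word p) u (Word q) \<Longrightarrow> y = Word (p @ str_word u @ q) \<and> sword (p @ str_word u @ q)"
  using Word_composes_cat[of p "Word (str_word u @ q)"] by (simp add: factors_def cat_Word)

lemma factors_Words:
  "sword (A @ g @ B) \<Longrightarrow> A \<noteq> [] \<Longrightarrow> g \<noteq> [] \<Longrightarrow> B \<noteq> [] \<Longrightarrow>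
    factors \<Lambda> (Word (A @ g @ B)) (Word A) (Word g) (Word B)"
  using sword_appendD(1)[of A] sword_appendD(2)[of A "g @ B"] sword_appendD(1)[of g B] sword_appendD(2)[of g B]
  by (simp add: factors_def composes_Word_Word)

lemma factors_exist:
  assumes "sword (A @ g @ B)" "g \<noteq> []"
  shows "\<exists>x w. str_word x = A \<and> str_word w = B \<and> factors \<Lambda> (Word (A @ g @ B)) x (Word g) w"
proof -
  have gB: "sword (g @ B)"
    using assms sword_appendD(2)[of A "g @ B"] by simp
  then have g: "sword g"
    using assms sword_appendD(1)[of g B] by simp
  obtain w where w: "str_word w = B" "composes \<Lambda> (Word g) w"
  proof (cases "B = []")
    case True
    then show ?thesis
      using that[of "Triv (syl_src \<Lambda> (last g)) (- syl_sigma \<Lambda> (last g))"] is_string_Triv_last[OF g] g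
      by (simp add: composes_Word_Triv)
  next
    case False
    then show ?thesis
      using that[of "Word B"] gB g sword_appendD(2)[of g B] by (simp add: composes_Word_Word)
  qed
  have cat: "cat (Word g) w = Word (g @ B)"
    using w(1) by (simp add: Word_cat)
  obtain x where "str_word x = A" "composes \<Lambda> x (Word (g @ B))"
  proof (cases "A = []")
    case True
    then show ?thesis
      using that[of "Triv (syl_tgt \<Lambda> (hd (g @ B))) (syl_epsilon \<Lambda> (hd (g @ B)))"] is_string_Triv_hd[OF gB] gB
      by (simp only: composes_Triv_Word str_word.simps)
  next
    case False
    then show ?thesis
      using that[of "Word A"] gB assms(1) sword_appendD(1)[of A "g @ B"] by (simp add: composes_Word_Word)
  qed
  then show ?thesis
    using w cat by (intro exI[of _ x] exI[of _ w]) (simp add: factors_def cat_Word)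
qed

lemma cyclic_perm_Word: "cyclic_perm x (Word w) \<longleftrightarrow> (\<exists>g. x = Word g \<and> conjugate w g)"
  by (auto simp: cyclic_perm_def conjugate_iff_rotate)

lemma band_count_set:
  assumes "w \<noteq> []" "n \<ge> 1"
  shows "(\<exists>b' y1 y2. cyclic_perm b' (Word w) \<and> factors \<Lambda> (Word Y) y2 (str_pow b' n) y1) \<longleftrightarrow>
    contains_pow w n Y"
proof
  assume "\<exists>b' y1 y2. cyclic_perm b' (Word w) \<and> factors \<Lambda> (Word Y) y2 (str_pow b' n) y1"
  then obtain g y1 y2 where "conjugate w g" "factors \<Lambda> (Word Y) y2 (Word (word_pow g n)) y1"
    by (auto simp: cyclic_perm_Word)
  then show "contains_pow w n Y"
    unfolding contains_pow_def using factors_middle_Word by blast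
next
  assume "contains_pow w n Y"
  then obtain A g B where g: "conjugate w g" "Y = A @ word_pow g n @ B" "sword Y"
    by (auto simp: contains_pow_def)
  then have "word_pow g n \<noteq> []"
    using assms conjugate_length[of w g] by (auto simp: word_pow_eq_Nil)
  then obtain x z where "factors \<Lambda> (Word Y) x (Word (word_pow g n)) z"
    using factors_exist g by metis
  then show "\<exists>b' y1 y2. cyclic_perm b' (Word w) \<and> factors \<Lambda> (Word Y) y2 (str_pow b' n) y1"
    using g(1) by (intro exI[of _ "Word g"] exI[of _ z] exI[of _ x]) (simp add: cyclic_perm_Word)
qed

lemma band_count_eq:
  assumes "w \<noteq> []"
  shows "band_count \<Lambda> (Word w) (Word Y) = Max (insert 0 {n. n \<ge> 1 \<and> contains_pow w n Y})"
  unfolding band_count_def using band_count_set[OF assms] by (metis (no_types, lifting))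

lemma finite_contains_pow:
  assumes "w \<noteq> []"
  shows "finite {n. n \<ge> 1 \<and> contains_pow w n Y}"
proof (rule finite_subset)
  show "{n. n \<ge> 1 \<and> contains_pow w n Y} \<subseteq> {..length Y}"
  proof
    fix n
    assume "n \<in> {n. n \<ge> 1 \<and> contains_pow w n Y}"
    then obtain A g B where g: "conjugate w g" "Y = A @ word_pow g n @ B"
      by (auto simp: contains_pow_def)
    have "n * 1 \<le> n * length g"
      using conjugate_length[OF g(1)] assms by (intro mult_le_mono) (auto simp: Suc_le_eq)
    also have "\<dots> = length (word_pow g n)"
      by (rule length_word_pow[symmetric])
    also have "\<dots> \<le> length Y"
      unfolding g(2) by (simp only: length_append)
    finally show "n \<in> {..length Y}" by simp
  qed
qed simp

lemma contains_pow_le_band_count: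
  "w \<noteq> [] \<Longrightarrow> n \<ge> 1 \<Longrightarrow> contains_pow w n Y \<Longrightarrow> n \<le> band_count \<Lambda> (Word w) (Word Y)"
  unfolding band_count_eq using finite_contains_pow by (intro Max_ge) auto

lemma contains_pow_band_count:
  assumes "w \<noteq> []" "band_count \<Lambda> (Word w) (Word Y) > 0"
  shows "contains_pow w (band_count \<Lambda> (Word w) (Word Y)) Y"
proof -
  have "band_count \<Lambda> (Word w) (Word Y) \<in> insert 0 {n. n \<ge> 1 \<and> contains_pow w n Y}"
    unfolding band_count_eq[OF assms(1)] using finite_contains_pow[OF assms(1)] by (intro Max_in) auto
  then show ?thesis using assms(2) by auto
qed

text \<open>The invariant of the words reached from a path: disjoint blocks of the end bands, in
  their own rotation, at both ends. They keep windows of other bands away from the ends, so for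
  these bands the conditions \<open>A \<noteq> []\<close> and \<open>B \<noteq> []\<close> of
  \<open>H_step\<close> hold automatically.\<close>

definition end_bands :: "'a syl list \<Rightarrow> 'a syl list \<Rightarrow> 'a syl list \<Rightarrow> bool" where
  "end_bands e a Y \<longleftrightarrow> is_band \<Lambda> (Word e) \<and> is_band \<Lambda> (Word a) \<and> sword Y \<and> (\<exists>u. Y = e @ u @ a)"

end

section \<open>Agreement of the defined reductions with steps on words\<close>

context domestic_string_algebra
begin

lemma end_bands_window:
  assumes Y: "end_bands e a (A @ g @ B)" and g: "band_word g" and "\<not> conjugate e g" "\<not> conjugate a g"
  shows "\<exists>A' B'. A = e @ A' \<and> B = B' @ a"
proof -
  obtain u where e: "is_band \<Lambda> (Word e)" and a: "is_band \<Lambda> (Word a)" and str: "sword (A @ g @ B)"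
    and u: "A @ g @ B = e @ u @ a"
    using Y by (auto simp: end_bands_def)
  have ng: "g \<noteq> []" using g by (rule band_word_not_Nil)
  have "\<not> length A < length e"
    using overlap_conjugate[OF e g str, of "[]" "u @ a"] u ng assms(3) by auto
  then obtain A' where A': "A = e @ A'"
    using append_eq_appendE[of e "u @ a" A "g @ B"] u by (metis not_less)
  have "length A < length (e @ u) + length a"
    using arg_cong[OF u, of length] ng by (cases g) auto
  then have "\<not> length (e @ u) < length A + length g"
    using overlap_conjugate[OF a g str, of "e @ u" "[]"] u assms(4) by auto
  then obtain B' where "B = B' @ a"
    using append_eq_appendE[of "A @ g" B "e @ u" a] u by auto
  then show ?thesis using A' by blast
qed

lemma end_bands_window':
  assumes Y: "end_bands e a Y" and c: "band_word c" and "\<not> conjugate e c" "\<not> conjugate a c"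
    and "conjugate c g" "Y = A @ g @ B"
  shows "\<exists>A' B'. A = e @ A' \<and> B = B' @ a" "A \<noteq> []" "B \<noteq> []"
proof -
  have "\<not> conjugate e g" "\<not> conjugate a g"
    using assms(3-5) conjugate_sym conjugate_trans by blast+
  then show *: "\<exists>A' B'. A = e @ A' \<and> B = B' @ a"
    using end_bands_window[of e a A g B] Y band_word_conjugate[OF c assms(5)] assms(6) by blast
  have "band_word e" "band_word a"
    using Y is_band_imp_band_word by (auto simp: end_bands_def)
  then show "A \<noteq> []" "B \<noteq> []"
    using * band_word_not_Nil by auto
qed

lemma H_step_end_bands:
  assumes "end_bands e a Y" "band_word c" "\<not> conjugate e c" "\<not> conjugate a c" "H_step c Y Z"
  shows "end_bands e a Z"
proof -
  obtain A g B where 1: "conjugate c g" "Y = A @ g @ B" "Z = A @ B" "sword Y" "H_equiv_word (g @ B) B"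
    using assms(5) by (auto simp: H_step_def)
  obtain A' B' where "A = e @ A'" "B = B' @ a"
    using end_bands_window'(1)[OF assms(1-4) 1(1,2)] by blast
  then have "Z = e @ (A' @ B') @ a"
    using 1(3) by simp
  then show ?thesis
    using assms(1) H_step_sword[OF assms(5)] unfolding end_bands_def by blast
qed

lemma H_step_fun_end_bands:
  assumes "end_bands e a Y" "band_word c" "\<not> conjugate e c" "\<not> conjugate a c"
  shows "end_bands e a (H_step_fun c Y)"
proof (cases "\<exists>Z. H_step c Y Z")
  case True
  then show ?thesis
    using H_step_end_bands[OF assms] H_step_fun_eq[OF assms(2)] by metis
next
  case False
  then show ?thesis using assms(1) by (simp add: H_step_fun_id)
qed

lemma is_reduction_Word:
  assumes "end_bands e a Y" "band_word c" "\<not> conjugate e c" "\<not> conjugate a c"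
    and "is_reduction \<Lambda> (Word c) (Word Y) z"
  shows "\<exists>A g B. conjugate c g \<and> Y = A @ g @ B \<and> z = Word (A @ B)"
proof -
  obtain g y1 y2 where g: "conjugate c g" "factors \<Lambda> (Word Y) y2 (Word g) y1" "z = cat y2 y1"
    using assms(5) by (auto simp: is_reduction_def cyclic_perm_Word)
  have Y: "Y = str_word y2 @ g @ str_word y1"
    using factors_middle_Word[OF g(2)] by simp
  have "str_word y2 \<noteq> []"
    using end_bands_window'(2)[OF assms(1-4) g(1) Y] .
  then have "z = Word (str_word y2 @ str_word y1)"
    using g(3) by (cases y2) (auto simp: Word_cat)
  then show ?thesis using g(1) Y by blast
qed

lemma reduct_eq:
  assumes "end_bands e a Y" "band_word c" "\<not> conjugate e c" "\<not> conjugate a c"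
    and "is_reduction \<Lambda> (Word c) (Word Y) z"
  shows "reduct \<Lambda> (Word c) (Word Y) = z"
  unfolding reduct_def
proof (rule the_equality)
  show "is_reduction \<Lambda> (Word c) (Word Y) z" by fact
  fix z'
  assume z': "is_reduction \<Lambda> (Word c) (Word Y) z'"
  obtain A g B where 1: "conjugate c g" "Y = A @ g @ B" "z = Word (A @ B)"
    using is_reduction_Word[OF assms] by blast
  obtain A' g' B' where 2: "conjugate c g'" "Y = A' @ g' @ B'" "z' = Word (A' @ B')"
    using is_reduction_Word[OF assms(1-4) z'] by blast
  have "A @ B = A' @ B'"
  proof (rule windows_same_reduct)
    show "sword (A @ g @ B)"
      using assms(1) 1(2) by (auto simp: end_bands_def)
    show "A @ g @ B = A' @ g' @ B'"
      using 1(2)[symmetric] 2(2) by (rule trans)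
    show "band_word g"
      using assms(2) 1(1) by (rule band_word_conjugate)
    show "conjugate g g'"
      using 1(1) 2(1) conjugate_sym conjugate_trans by blast
  qed
  then show "z' = z"
    using 1(3) 2(3) by simp
qed

lemma H_step_is_reduction:
  assumes "band_word c" "H_step c Y Z"
  shows "is_reduction \<Lambda> (Word c) (Word Y) (Word Z)" "is_H_reduction \<Lambda> (Word Y) (Word Z)"
    "contains_pow c 1 Y"
proof -
  obtain A g B where 1: "conjugate c g" "A \<noteq> []" "B \<noteq> []" "Y = A @ g @ B" "Z = A @ B"
    "sword Y" "H_equiv_word (g @ B) B"
    using assms(2) by (auto simp: H_step_def)
  have g: "band_word g"
    using assms(1) 1(1) by (rule band_word_conjugate)
  have f: "factors \<Lambda> (Word Y) (Word A) (Word g) (Word B)"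
    using factors_Words[OF _ 1(2) _ 1(3)] 1(4,6) band_word_not_Nil[OF g] by simp
  have AB: "sword (A @ B)"
    using H_step_sword[OF assms(2)] 1(5) by simp
  then have comp: "composes \<Lambda> (Word A) (Word B)"
    using 1(2,3) sword_appendD[of A B] by (simp add: composes_Word_Word)
  show "is_reduction \<Lambda> (Word c) (Word Y) (Word Z)"
    unfolding is_reduction_def cyclic_perm_Word using 1(1,5) f comp by (metis cat.simps(1))
  obtain w where "is_band \<Lambda> (Word w)" "conjugate w g"
    using g by (auto simp: band_word_def)
  then show "is_H_reduction \<Lambda> (Word Y) (Word Z)"
    unfolding is_H_reduction_def using 1(5,7) f comp cyclic_perm_Word by (metis cat.simps(1))
  show "contains_pow c 1 Y"
    unfolding contains_pow_def using 1(1,4,6) by (metis One_nat_def replicate_Suc replicate_0 concat.simps append_Nil2)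
qed

text \<open>The band hidden in \<open>is_H_reduction\<close> is a priori unrelated to
  \<open>c\<close>. Equal results force windows of equal length, and by
  \<open>conjugate_if_shift\<close> two such windows are conjugate; so the window removed is one of
  \<open>c\<close>.\<close>

lemma H_reduction_imp_H_step:
  assumes Y: "end_bands e a Y" and c: "band_word c" "\<not> conjugate e c" "\<not> conjugate a c"
    and z: "is_reduction \<Lambda> (Word c) (Word Y) z" and H: "is_H_reduction \<Lambda> (Word Y) z"
  shows "\<exists>Z. H_step c Y Z"
proof -
  obtain A g B where 1: "conjugate c g" "Y = A @ g @ B" "z = Word (A @ B)"
    using is_reduction_Word[OF Y c z] by blast
  obtain b b' y1 y2 where b: "is_band \<Lambda> b" "cyclic_perm b' b" "factors \<Lambda> (Word Y) y2 b' y1"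
    "z = cat y2 y1" "H_equiv \<Lambda> (cat b' y1) y1"
    using H by (auto simp: is_H_reduction_def)
  obtain h where h: "b' = Word h"
    using b(2) by (auto simp: cyclic_perm_def)
  have Y': "Y = str_word y2 @ h @ str_word y1"
    using factors_middle_Word b(3) h by auto
  have nz: "A @ B \<noteq> []"
    using end_bands_window'(2)[OF Y c 1(1,2)] by simp
  have AB: "A @ B = str_word y2 @ str_word y1"
    using 1(3) b(4) by (cases y2; cases y1) auto
  have len: "length g = length h"
    using arg_cong[OF AB, of length] arg_cong[OF trans[OF 1(2)[symmetric] Y'], of length] by simp
  have shift: "conjugate g' h'" if eq: "A1 @ B1 = A2 @ B2" "A1 @ g' @ B1 = A2 @ h' @ B2"
    and "length g' = length h'" and le: "length A1 \<le> length A2" for g' h' A1 B1 A2 B2 :: "'a syl list"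
  proof -
    obtain s where s: "A2 = A1 @ s" "B1 = s @ B2"
      using append_eq_appendE[OF eq(1) le] by blast
    then have "(g' @ s) @ B2 = (s @ h') @ B2"
      using eq(2) by simp
    then have "g' @ s = s @ h'" by simp
    then show ?thesis by (rule conjugate_if_shift)
  qed
  have eq: "A @ g @ B = str_word y2 @ h @ str_word y1"
    using 1(2)[symmetric] Y' by (rule trans)
  have "conjugate g h"
    using shift[OF AB eq len] shift[OF AB[symmetric] eq[symmetric] len[symmetric]] conjugate_sym
    by (metis nat_le_linear)
  then have ch: "conjugate c h"
    using 1(1) conjugate_trans by blast
  note ne = end_bands_window'(2,3)[OF Y c ch Y']
  then have y1: "y1 = Word (str_word y1)"
    by (cases y1) auto
  have "H_equiv_word (h @ str_word y1) (str_word y1)"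
    using b(5) h y1 by (metis cat.simps(1))
  then show ?thesis
    unfolding H_step_def using ne ch Y' Y by (auto simp: end_bands_def)
qed

end

section \<open>Reductions at the chosen band representatives\<close>

locale domestic_string_algebra_bands = domestic_string_algebra \<Lambda>
  for \<Lambda> :: "('v, 'a) string_pres" +
  fixes Ba :: "('v, 'a) str set"
  assumes representatives: "band_representatives \<Lambda> Ba"
begin

lemma Ba_is_band:
  assumes "b \<in> Ba"
  shows "is_band \<Lambda> b" "is_band \<Lambda> (Word (str_word b))" "b = Word (str_word b)" "band_word (str_word b)"
proof -
  show b: "is_band \<Lambda> b"
    using assms representatives by (simp add: band_representatives_def)
  then obtain w where "b = Word w"
    by (auto simp: is_band_def)
  then show w: "b = Word (str_word b)" by simp
  then show "is_band \<Lambda> (Word (str_word b))" using b by simp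
  then show "band_word (str_word b)" by (rule is_band_imp_band_word)
qed

lemma Ba_conjugate_eq:
  assumes "b \<in> Ba" "c \<in> Ba" "conjugate (str_word b) (str_word c)"
  shows "b = c"
proof -
  have "cyclic_perm c b" "cyclic_perm b b"
    using Ba_is_band(3)[OF assms(1)] Ba_is_band(3)[OF assms(2)] assms(3) cyclic_perm_Word conjugate_refl
    by metis+
  then show ?thesis
    using representatives Ba_is_band(1)[OF assms(1)] assms(1,2) unfolding band_representatives_def by blast
qed

abbreviation hl :: "('v, 'a) str \<Rightarrow> 'a syl list \<Rightarrow> 'a syl list" where
  "hl c \<equiv> H_step_fun (str_word c)"

lemma hl_commute:
  assumes "b \<in> Ba" "c \<in> Ba"
  shows "hl b (hl c Y) = hl c (hl b Y)"
  using assms H_step_fun_commute[OF Ba_is_band(4) Ba_is_band(4)] Ba_conjugate_eq by metis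

lemma H_reduct_eq:
  assumes "end_bands (str_word e) (str_word a) Y" "e \<in> Ba" "a \<in> Ba" "c \<in> Ba" "c \<noteq> e" "c \<noteq> a"
  shows "H_reduct \<Lambda> Ba c (Word Y) = Word (hl c Y)"
proof -
  let ?c = "str_word c"
  have c: "c = Word ?c" and cw: "band_word ?c"
    using Ba_is_band assms(4) by blast+
  have nc: "\<not> conjugate (str_word e) ?c" "\<not> conjugate (str_word a) ?c"
    using assms Ba_conjugate_eq by blast+
  note A = assms(1) cw nc
  show ?thesis
  proof (cases "\<exists>Z. H_step ?c Y Z")
    case True
    then obtain Z where Z: "H_step ?c Y Z" ..
    note r = H_step_is_reduction[OF cw Z]
    have red: "reduct \<Lambda> c (Word Y) = Word Z"
      using reduct_eq[OF A r(1)] c by simp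
    have "band_count \<Lambda> c (Word Y) \<ge> 1"
      using contains_pow_le_band_count[OF band_word_not_Nil[OF cw] _ r(3)] c by simp
    then have "c \<in> bands_in \<Lambda> Ba (Word Y)"
      using assms(4) by (simp add: bands_in_def)
    moreover have "is_reduction \<Lambda> c (Word Y) (Word Z)"
      using r(1) c by simp
    ultimately have "H_reduct \<Lambda> Ba c (Word Y) = Word Z"
      unfolding H_reduct_def red using r(2) by auto
    then show ?thesis
      using H_step_fun_eq[OF cw Z] by simp
  next
    case False
    have "H_reduct \<Lambda> Ba c (Word Y) = Word Y"
    proof (rule ccontr)
      assume "H_reduct \<Lambda> Ba c (Word Y) \<noteq> Word Y"
      then obtain z where z: "is_reduction \<Lambda> c (Word Y) z" "is_H_reduction \<Lambda> (Word Y) (reduct \<Lambda> c (Word Y))"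
        unfolding H_reduct_def by (auto split: if_splits)
      have z1: "is_reduction \<Lambda> (Word ?c) (Word Y) z"
        using z(1) c by simp
      then have "reduct \<Lambda> c (Word Y) = z"
        using reduct_eq[OF A] c by simp
      then show False
        using H_reduction_imp_H_step[OF A z1] z(2) False by simp
    qed
    then show ?thesis
      using H_step_fun_id[OF False] by simp
  qed
qed

end

section \<open>Paths of weak bridges\<close>

definition path_prefix :: "('v, 'a) arrow list \<Rightarrow> 'a syl list" where
  "path_prefix P = concat (map (\<lambda>f. str_word (arrow_tgt f) @ str_word (arrow_str f)) (rev P))"

definition path_word :: "('v, 'a) arrow list \<Rightarrow> 'a syl list" where
  "path_word P = path_prefix P @ str_word (path_src P)"

definition interior :: "('v, 'a) arrow list \<Rightarrow> ('v, 'a) str set" where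
  "interior P = arrow_tgt ` set (butlast P)"

text \<open>The starting band enters as a final block with empty bridge, so that every band on the
  path heads a block.\<close>

definition path_blocks :: "('v, 'a) arrow list \<Rightarrow> ('a syl list \<times> 'a syl list) list" where
  "path_blocks P =
     map (\<lambda>f. (str_word (arrow_tgt f), str_word (arrow_str f))) (rev P) @ [(str_word (path_src P), [])]"

abbreviation concat_blocks :: "('b list \<times> 'b list) list \<Rightarrow> 'b list" where
  "concat_blocks xs \<equiv> concat (map (\<lambda>(b, u). b @ u) xs)"

lemma path_prefix_append: "path_prefix (P @ Q) = path_prefix Q @ path_prefix P"
  by (simp add: path_prefix_def)

lemma path_prefix_snoc: "path_prefix (P @ [f]) = str_word (arrow_tgt f) @ str_word (arrow_str f) @ path_prefix P"
  by (simp add: path_prefix_def)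

lemma concat_path_blocks: "concat_blocks (path_blocks P) = path_word P"
  by (simp add: path_blocks_def path_word_def path_prefix_def comp_def)

lemma fold_path_str:
  "fold (\<lambda>f y. cat (arrow_tgt f) (cat (arrow_str f) y)) P (Word y) = Word (path_prefix P @ y)"
  by (induction P arbitrary: y) (simp_all add: cat_Word path_prefix_def)

lemma path_word_append:
  assumes "P \<noteq> []"
  shows "path_word (P @ Q) = path_prefix Q @ path_word P"
  using assms by (simp add: path_word_def path_prefix_append path_src_def)

lemma path_prefix_start:
  assumes "P \<noteq> []"
  shows "path_prefix P = str_word (path_tgt P) @ str_word (arrow_str (last P)) @ path_prefix (butlast P)"
  using path_prefix_snoc[of "butlast P" "last P"] assms by (simp add: path_tgt_def)

text \<open>A window that fits into no bridge either starts in a band block, or starts in a bridge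
  and runs into the next block. The last hypothesis will come from band-freeness.\<close>

lemma window_meets_block:
  assumes "concat_blocks xs = A @ g @ B" "g \<noteq> []"
    and "\<forall>u \<in> snd ` set xs. \<not> sublist g u"
  shows "\<exists>xs1 b u xs2. xs = xs1 @ (b, u) # xs2 \<and>
    length A < length (concat_blocks xs1) + length b \<and> length (concat_blocks xs1) < length A + length g"
  using assms
proof (induction xs arbitrary: A)
  case Nil
  then show ?case by simp
next
  case (Cons x rest)
  obtain b u where x: "x = (b, u)" by (cases x)
  have eq: "b @ u @ concat_blocks rest = A @ g @ B"
    using Cons.prems(1) x by simp
  show ?case
  proof (cases "length A < length b")
    case True
    then show ?thesis
      using x Cons.prems(2) by (intro exI[of _ "[]"] exI[of _ b] exI[of _ u] exI[of _ rest]) simp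
  next
    case False
    then obtain A1 where A1: "A = b @ A1" "u @ concat_blocks rest = A1 @ g @ B"
      using append_eq_appendE[OF eq] by auto
    show ?thesis
    proof (cases "length u \<le> length A1")
      case True
      then obtain A2 where A2: "A1 = u @ A2" "concat_blocks rest = A2 @ g @ B"
        using append_eq_appendE[OF A1(2)] by auto
      have nb: "\<forall>u \<in> snd ` set rest. \<not> sublist g u"
        using Cons.prems(3) by simp
      obtain xs1 b' u' xs2 where "rest = xs1 @ (b', u') # xs2"
        "length A2 < length (concat_blocks xs1) + length b'" "length (concat_blocks xs1) < length A2 + length g"
        using Cons.IH[OF A2(2) Cons.prems(2) nb] by blast
      then show ?thesis
        using x A1(1) A2(1)
        by (intro exI[of _ "x # xs1"] exI[of _ b'] exI[of _ u'] exI[of _ xs2]) simp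
    next
      case le: False
      have gt: "length u < length A1 + length g"
      proof (rule ccontr)
        assume "\<not> length u < length A1 + length g"
        then obtain t where "u = (A1 @ g) @ t"
          using append_eq_appendE[of "A1 @ g" B u "concat_blocks rest"] A1(2) by auto
        then have "sublist g u" by auto
        then show False using Cons.prems(3) x by auto
      qed
      have "rest \<noteq> []"
        using arg_cong[OF A1(2), of length] gt by auto
      then obtain b' u' rest' where r: "rest = (b', u') # rest'"
        by (cases rest) auto
      show ?thesis
        using x r A1(1) le gt
        by (intro exI[of _ "[x]"] exI[of _ b'] exI[of _ u'] exI[of _ rest']) simp
    qed
  qed
qed

context domestic_string_algebra_bands
begin

lemma cas_weak_bridge_quiver:
  assumes "P \<noteq> []"
  shows "(\<exists>b'. pre_digraph.cas (weak_bridge_quiver \<Lambda> Ba) b P b') \<longleftrightarrow>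
    b = path_src P \<and> successively (\<lambda>f g. arrow_tgt f = arrow_src g) P"
  using assms
proof (induction P arbitrary: b)
  case Nil
  then show ?case by simp
next
  case (Cons f P)
  show ?case
  proof (cases P)
    case Nil
    then show ?thesis
      by (auto simp: pre_digraph.cas.simps path_src_def weak_bridge_quiver_def)
  next
    case (Cons g Q)
    then show ?thesis
      using Cons.IH[of "arrow_tgt f"]
      by (auto simp: pre_digraph.cas.simps path_src_def weak_bridge_quiver_def)
  qed
qed

lemma bridge_paths_iff:
  "P \<in> bridge_paths \<Lambda> Ba \<longleftrightarrow>
    P \<noteq> [] \<and> set P \<subseteq> weak_bridges \<Lambda> Ba \<and> successively (\<lambda>f g. arrow_tgt f = arrow_src g) P"
proof -
  have "path_src P \<in> Ba" if "P \<noteq> []" "set P \<subseteq> weak_bridges \<Lambda> Ba"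
    using that by (cases P) (auto simp: path_src_def weak_bridges_def)
  then show ?thesis
    using cas_weak_bridge_quiver[of P]
    by (auto simp: bridge_paths_def pre_digraph.awalk_def weak_bridge_quiver_def)
qed

lemma bridge_paths_append_iff:
  assumes "P \<noteq> []" "Q \<noteq> []"
  shows "P @ Q \<in> bridge_paths \<Lambda> Ba \<longleftrightarrow>
    P \<in> bridge_paths \<Lambda> Ba \<and> Q \<in> bridge_paths \<Lambda> Ba \<and> path_tgt P = path_src Q"
  using assms by (auto simp: bridge_paths_iff successively_append_iff path_tgt_def path_src_def)

lemma weak_bridge_facts:
  assumes "f \<in> weak_bridges \<Lambda> Ba"
  shows "arrow_src f \<in> Ba" "arrow_tgt f \<in> Ba"
    "sword (str_word (arrow_tgt f) @ str_word (arrow_str f) @ str_word (arrow_src f))"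
    "\<And>g. sublist g (str_word (arrow_str f)) \<Longrightarrow> \<not> band_word g"
proof -
  obtain b1 u b2 where f: "f = (b1, u, b2)" by (metis prod.exhaust)
  show b: "arrow_src f \<in> Ba" "arrow_tgt f \<in> Ba"
    using assms by (auto simp: weak_bridges_def)
  obtain y where "factors \<Lambda> y b2 u b1"
    using assms f by (auto simp: weak_bridges_def)
  then show "sword (str_word (arrow_tgt f) @ str_word (arrow_str f) @ str_word (arrow_src f))"
    using factors_outer_Words Ba_is_band(3) b f by (metis fst_conv snd_conv)
  fix g
  assume g: "sublist g (str_word (arrow_str f))"
  show "\<not> band_word g"
  proof
    assume bg: "band_word g"
    then have ng: "g \<noteq> []" by (rule band_word_not_Nil)
    obtain A B where AB: "str_word u = A @ g @ B"
      using g f by (auto simp: sublist_def)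
    then have u: "u = Word (A @ g @ B)"
      using ng by (cases u) auto
    have "is_string \<Lambda> u" and bf: "band_free \<Lambda> u"
      using assms f by (auto simp: weak_bridges_def)
    then obtain x w where "factors \<Lambda> u x (Word g) w"
      using factors_exist[OF _ ng] u by blast
    moreover obtain w0 where "is_band \<Lambda> (Word w0)" "conjugate w0 g"
      using bg by (auto simp: band_word_def)
    moreover from this have "cyclic_perm (Word g :: ('v, 'a) str) (Word w0)"
      by (auto simp: cyclic_perm_Word)
    ultimately show False
      using bf unfolding band_free_def by blast
  qed
qed

text \<open>A bridge from \<open>b\<close> to itself is a return word and hence a power of
  \<open>b\<close>. Exponent 0 gives the excluded trivial bridge, a positive one contradicts
  band-freeness.\<close>

lemma weak_bridge_no_loop:
  assumes "f \<in> weak_bridges \<Lambda> Ba"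
  shows "arrow_src f \<noteq> arrow_tgt f"
proof
  assume eq: "arrow_src f = arrow_tgt f"
  obtain b u where f: "f = (b, u, b)" by (metis prod.exhaust fst_conv snd_conv eq)
  note F = weak_bridge_facts[OF assms]
  have b: "b \<in> Ba" using F(1) f by simp
  have "sword (str_word b @ str_word u @ str_word b)"
    using F(3) f by simp
  then obtain k where k: "str_word u = word_pow (str_word b) k"
    using return_word[OF Ba_is_band(4)[OF b]] by blast
  show False
  proof (cases k)
    case 0
    obtain y where y: "factors \<Lambda> y b u b" and u: "is_string \<Lambda> u"
      and nt: "u \<noteq> Triv (tgt \<Lambda> b) (str_epsilon \<Lambda> b)"
      using assms f by (auto simp: weak_bridges_def)
    obtain v i where ut: "u = Triv v i"
      using u k 0 by (cases u) (auto simp: is_string.simps(2))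
    \<comment> \<open>Exponent 0 only says that the word is empty; vertex and sign of
      \<open>u\<close> are read off from composability with \<open>b\<close>.\<close>
    have "composes \<Lambda> u (Word (str_word b))"
      using y Ba_is_band(3)[OF b] by (simp add: factors_def)
    then have "u = Triv (tgt \<Lambda> (Word (str_word b))) (str_epsilon \<Lambda> (Word (str_word b)))"
      unfolding ut composes_Triv_Word by simp
    then show False
      using nt Ba_is_band(3)[OF b] by simp
  next
    case (Suc j)
    then have "sublist (str_word b) (str_word u)"
      using k by simp
    then show False
      using F(4) f Ba_is_band(4)[OF b] by simp
  qed
qed

lemma bridge_path_not_Nil: "P \<in> bridge_paths \<Lambda> Ba \<Longrightarrow> P \<noteq> []"
  by (simp add: bridge_paths_iff)

lemma bridge_path_Ba:
  assumes "P \<in> bridge_paths \<Lambda> Ba"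
  shows "path_src P \<in> Ba" "f \<in> set P \<Longrightarrow> arrow_tgt f \<in> Ba" "path_tgt P \<in> Ba"
proof -
  have P: "P \<noteq> []" "set P \<subseteq> weak_bridges \<Lambda> Ba"
    using assms by (auto simp: bridge_paths_iff)
  then have "hd P \<in> set P" "last P \<in> set P" by auto
  then show "path_src P \<in> Ba" "path_tgt P \<in> Ba" "f \<in> set P \<Longrightarrow> arrow_tgt f \<in> Ba"
    using P weak_bridge_facts(1,2) unfolding path_src_def path_tgt_def by blast+
qed

lemma path_str_eq:
  assumes "P \<in> bridge_paths \<Lambda> Ba"
  shows "path_str P = Word (path_word P)"
proof -
  have "path_str P = fold (\<lambda>f y. cat (arrow_tgt f) (cat (arrow_str f) y)) P (Word (str_word (path_src P)))"
    unfolding path_str_def using Ba_is_band(3)[OF bridge_path_Ba(1)[OF assms]] by simp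
  then show ?thesis
    by (simp add: fold_path_str path_word_def)
qed

lemma sword_path_word:
  assumes "P \<in> bridge_paths \<Lambda> Ba"
  shows "sword (path_word P)"
  using assms
proof (induction P rule: rev_induct)
  case Nil
  then show ?case by (simp add: bridge_paths_iff)
next
  case (snoc f P)
  have f: "f \<in> weak_bridges \<Lambda> Ba"
    using snoc.prems by (simp add: bridge_paths_iff)
  note F = weak_bridge_facts[OF f]
  show ?case
  proof (cases "P = []")
    case True
    then show ?thesis
      using F(3) by (simp add: path_word_def path_prefix_def path_src_def)
  next
    case False
    then have P: "P \<in> bridge_paths \<Lambda> Ba" "path_tgt P = arrow_src f"
      using snoc.prems bridge_paths_append_iff[of P "[f]"] by (auto simp: path_src_def)
    obtain R where R: "path_word P = str_word (arrow_src f) @ R"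
      using path_prefix_start[OF False] P(2) by (simp add: path_word_def)
    have "sword ((str_word (arrow_tgt f) @ str_word (arrow_str f)) @ str_word (arrow_src f) @ R)"
      using sword_glue[of "str_word (arrow_tgt f) @ str_word (arrow_str f)" "str_word (arrow_src f)" R]
        F(3) snoc.IH[OF P(1)] R band_word_mixed[OF Ba_is_band(4)[OF F(1)]] by simp
    then show ?thesis
      using R False by (simp add: path_word_append) (simp add: path_prefix_def)
  qed
qed

text \<open>Bridges are band-free, so the window meets a band block. The blocks carry the
  representatives in their own rotation, as \<open>overlap_conjugate\<close> requires.\<close>

lemma path_window:
  assumes P: "P \<in> bridge_paths \<Lambda> Ba" and eq: "path_word P = A @ g @ B" and g: "band_word g"
  shows "\<exists>xs1 b u xs2. path_blocks P = xs1 @ (b, u) # xs2 \<and> conjugate b g \<and>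
    length A < length (concat_blocks xs1) + length b \<and> length (concat_blocks xs1) < length A + length g"
proof -
  have nb: "\<forall>u \<in> snd ` set (path_blocks P). \<not> sublist g u"
    using g band_word_not_Nil[OF g] weak_bridge_facts(4) P
    by (fastforce simp: path_blocks_def bridge_paths_iff)
  obtain xs1 b u xs2 where xs: "path_blocks P = xs1 @ (b, u) # xs2"
    "length A < length (concat_blocks xs1) + length b" "length (concat_blocks xs1) < length A + length g"
    using window_meets_block[OF trans[OF concat_path_blocks eq] band_word_not_Nil[OF g] nb] by blast
  have "(b, u) \<in> set (path_blocks P)" using xs(1) by simp
  then obtain c where "c \<in> Ba" "b = str_word c"
    using bridge_path_Ba[OF P] by (auto simp: path_blocks_def)
  then have b: "is_band \<Lambda> (Word b)"
    using Ba_is_band(2) by blast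
  have "A @ g @ B = concat_blocks xs1 @ b @ u @ concat_blocks xs2"
    using eq concat_path_blocks[of P] xs(1) by simp
  then have "conjugate b g"
    using overlap_conjugate[OF b g, of A B "concat_blocks xs1" "u @ concat_blocks xs2"] xs(2,3)
      sword_path_word[OF P] eq by simp
  then show ?thesis using xs by blast
qed

lemma path_window_vertex:
  assumes "P \<in> bridge_paths \<Lambda> Ba" "c \<in> Ba" "path_word P = A @ g @ B" "conjugate (str_word c) g"
  shows "c \<in> insert (path_src P) (arrow_tgt ` set P)"
proof -
  have "band_word g"
    using band_word_conjugate[OF Ba_is_band(4)] assms(2,4) by blast
  then obtain xs1 b u xs2 where b: "path_blocks P = xs1 @ (b, u) # xs2" "conjugate b g"
    using path_window[OF assms(1,3)] by blast
  have "(b, u) \<in> set (path_blocks P)" using b(1) by simp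
  then obtain d where d: "d \<in> insert (path_src P) (arrow_tgt ` set P)" "b = str_word d"
    by (auto simp: path_blocks_def)
  then have "d \<in> Ba"
    using bridge_path_Ba[OF assms(1)] by auto
  moreover have "conjugate (str_word d) (str_word c)"
    using b(2) d(2) assms(4) conjugate_sym conjugate_trans by blast
  ultimately show ?thesis
    using Ba_conjugate_eq assms(2) d(1) by metis
qed

text \<open>By \<open>return_word\<close> the word of a closed path is a power of its base band. The
  target of the first arrow then meets a copy of that band and equals it, so the first arrow would
  be a loop.\<close>

lemma path_src_neq_tgt:
  assumes P: "P \<in> bridge_paths \<Lambda> Ba"
  shows "path_src P \<noteq> path_tgt P"
proof
  assume eq: "path_src P = path_tgt P"
  obtain f Q where fQ: "P = f # Q"
    using bridge_path_not_Nil[OF P] by (cases P) auto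
  have f: "f \<in> weak_bridges \<Lambda> Ba"
    using P fQ by (simp add: bridge_paths_iff)
  show False
  proof (cases "Q = []")
    case True
    then show False
      using weak_bridge_no_loop[OF f] eq fQ by (simp add: path_src_def path_tgt_def)
  next
    case False
    let ?b = "str_word (arrow_src f)" and ?d = "str_word (arrow_tgt f)"
    have b: "arrow_src f \<in> Ba" and d: "arrow_tgt f \<in> Ba"
      using weak_bridge_facts[OF f] by blast+
    have "path_tgt Q = arrow_src f"
      using eq fQ False by (simp add: path_src_def path_tgt_def)
    then obtain R where R: "path_prefix Q = ?b @ R"
      using path_prefix_start[OF False] by auto
    have W: "path_word P = ?b @ (R @ ?d @ str_word (arrow_str f)) @ ?b"
      using R path_prefix_append[of "[f]" Q] fQ by (simp add: path_word_def path_src_def path_prefix_def)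
    then obtain k where k: "R @ ?d @ str_word (arrow_str f) = word_pow ?b k"
      using return_word[OF Ba_is_band(4)[OF b]] sword_path_word[OF P] by metis
    have pow: "path_word P = word_pow ?b (Suc (Suc k))"
      unfolding W k word_pow_Suc_right[of "Suc k"] by simp
    \<comment> \<open>Counting copies of the base band from the left, beginning with 0,
      \<open>q\<close> is the copy in which the block of the first target starts.\<close>
    define q where "q = length (?b @ R) div length ?b"
    have nb: "?b \<noteq> []"
      using band_word_not_Nil[OF Ba_is_band(4)[OF b]] .
    have nd: "?d \<noteq> []"
      using band_word_not_Nil[OF Ba_is_band(4)[OF d]] .
    have q: "q * length ?b \<le> length (?b @ R)" "length (?b @ R) < q * length ?b + length ?b"
    proof -
      have "0 < length ?b" using nb by simp
      then show "q * length ?b \<le> length (?b @ R)" "length (?b @ R) < q * length ?b + length ?b"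
        using div_mult_mod_eq[of "length (?b @ R)" "length ?b"]
          mod_less_divisor[of "length ?b" "length (?b @ R)"] unfolding q_def by linarith+
    qed
    have "q * length ?b < length (path_word P)"
      using q(1) W nd by (cases ?d) auto
    then have "q < Suc (Suc k)"
      unfolding pow length_word_pow mult_less_cancel2 by blast
    then have "path_word P = word_pow ?b q @ ?b @ word_pow ?b (Suc k - q)"
      unfolding pow using word_pow_add[of q "Suc (Suc k - q)" ?b] by simp
    then have "(?b @ R) @ ?d @ str_word (arrow_str f) @ ?b = word_pow ?b q @ ?b @ word_pow ?b (Suc k - q)"
      using W by simp
    moreover have "sword ((?b @ R) @ ?d @ str_word (arrow_str f) @ ?b)"
      using sword_path_word[OF P] W by simp
    moreover have "q * length ?b < length (?b @ R) + length ?d"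
      using q(1) nd by (cases ?d) auto
    ultimately have "conjugate ?b ?d"
      using overlap_conjugate[OF Ba_is_band(2)[OF b] Ba_is_band(4)[OF d], of "?b @ R"
          "str_word (arrow_str f) @ ?b" "word_pow ?b q"] q
      unfolding length_word_pow by blast
    then show False
      using Ba_conjugate_eq[OF b d] weak_bridge_no_loop[OF f] by blast
  qed
qed

lemma interior_neq_ends:
  assumes P: "P \<in> bridge_paths \<Lambda> Ba" and "c \<in> interior P"
  shows "c \<in> Ba" "c \<noteq> path_src P" "c \<noteq> path_tgt P"
proof -
  obtain f where f: "f \<in> set (butlast P)" "c = arrow_tgt f"
    using assms(2) by (auto simp: interior_def)
  then show "c \<in> Ba"
    using bridge_path_Ba(2)[OF P] in_set_butlastD by metis
  obtain Q R where QR: "butlast P = Q @ f # R"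
    using f(1) by (meson split_list)
  then have split: "P = (Q @ [f]) @ (R @ [last P])"
    using append_butlast_last_id[OF bridge_path_not_Nil[OF P]] by simp
  then have QP: "Q @ [f] \<in> bridge_paths \<Lambda> Ba" "R @ [last P] \<in> bridge_paths \<Lambda> Ba"
    "path_tgt (Q @ [f]) = path_src (R @ [last P])"
    using P bridge_paths_append_iff[of "Q @ [f]" "R @ [last P]"] by auto
  have "path_src (Q @ [f]) = path_src P"
    using split by (metis path_src_def hd_append snoc_eq_iff_butlast)
  moreover have "path_tgt (Q @ [f]) = c" "path_tgt (R @ [last P]) = path_tgt P"
    using f(2) by (simp_all add: path_tgt_def)
  ultimately show "c \<noteq> path_src P" "c \<noteq> path_tgt P"
    using path_src_neq_tgt[OF QP(1)] path_src_neq_tgt[OF QP(2)] QP(3) by auto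
qed

lemma vertices_eq:
  assumes "P \<noteq> []"
  shows "arrow_tgt ` set P = insert (path_tgt P) (interior P)"
proof -
  have "set P = insert (last P) (set (butlast P))"
    using arg_cong[OF append_butlast_last_id[OF assms], of set] by simp
  then show ?thesis
    by (simp add: interior_def path_tgt_def)
qed

lemma path_word_end_bands:
  assumes "P \<in> bridge_paths \<Lambda> Ba"
  shows "end_bands (str_word (path_tgt P)) (str_word (path_src P)) (path_word P)"
  unfolding end_bands_def
  using Ba_is_band(2) bridge_path_Ba[OF assms] sword_path_word[OF assms]
    path_prefix_start[OF bridge_path_not_Nil[OF assms]]
  by (auto simp: path_word_def)

text \<open>This makes the skeleton trivial at the end bands. In a square \<open>g g\<close> the
  inner copy would meet a block of \<open>c\<close>. As the path is acyclic, \<open>c\<close> labels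
  only the extremal block, and the inner copy cannot reach it, because the outer copy is as long as
  that block.\<close>

lemma band_count_path_ends:
  assumes P: "P \<in> bridge_paths \<Lambda> Ba" and c: "c = path_src P \<or> c = path_tgt P"
  shows "band_count \<Lambda> c (path_str P) \<le> 1"
proof (rule ccontr)
  assume "\<not> ?thesis"
  then have n: "band_count \<Lambda> c (path_str P) \<ge> 2" by simp
  let ?n = "band_count \<Lambda> c (path_str P)"
  have cBa: "c \<in> Ba" using c bridge_path_Ba[OF P] by auto
  note cw = Ba_is_band(3,4)[OF cBa]
  have "contains_pow (str_word c) ?n (path_word P)"
    using contains_pow_band_count[OF band_word_not_Nil[OF cw(2)], of "path_word P"] n cw(1)
      path_str_eq[OF P] by simp
  then obtain A g B where g: "conjugate (str_word c) g" "path_word P = A @ word_pow g ?n @ B"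
    by (auto simp: contains_pow_def)
  obtain m where "?n = Suc (Suc m)"
    using n by (metis Suc_le_D numeral_2_eq_2 Suc_le_mono)
  then obtain C where C: "path_word P = A @ g @ g @ C"
    using g(2) by simp
  have bg: "band_word g"
    using cw(2) g(1) by (rule band_word_conjugate)
  have len: "length g = length (str_word c)"
    using conjugate_length[OF g(1)] by simp
  have conj_eq: "d = c" if "d \<in> Ba" "conjugate (str_word d) g" for d
    using that g(1) cBa Ba_conjugate_eq conjugate_sym conjugate_trans by metis
  have ends: "path_src P \<noteq> path_tgt P"
    by (rule path_src_neq_tgt[OF P])
  from c show False
  proof
    assume cs: "c = path_src P"
    obtain xs1 b u xs2 where xs: "path_blocks P = xs1 @ (b, u) # xs2" "conjugate b g"
      "length (concat_blocks xs1) < length A + length g"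
      using path_window[OF P C bg] by blast
    have "xs2 = []"
    proof (rule ccontr)
      assume ne: "xs2 \<noteq> []"
      then have "butlast (path_blocks P) = xs1 @ (b, u) # butlast xs2"
        unfolding xs(1) by (simp add: butlast_append)
      then have "(b, u) \<in> set (butlast (path_blocks P))" by simp
      then obtain f where f: "f \<in> set P" "b = str_word (arrow_tgt f)"
        by (auto simp: path_blocks_def)
      then have "arrow_tgt f = c"
        using conj_eq bridge_path_Ba(2)[OF P] xs(2) by blast
      then have "c \<in> insert (path_tgt P) (interior P)"
        using f(1) vertices_eq[OF bridge_path_not_Nil[OF P]] by blast
      then show False
        using cs ends interior_neq_ends(2)[OF P] by auto
    qed
    then have "(b, u) = (str_word (path_src P), [])" "concat_blocks xs1 @ b @ u = path_word P"
      using xs(1) concat_path_blocks[of P] by (auto simp: path_blocks_def)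
    then have "length (concat_blocks xs1) + length g = length (path_word P)"
      using len cs by (metis Pair_inject append_Nil2 length_append)
    then show False
      using xs(3) C by simp
  next
    assume ct: "c = path_tgt P"
    have C': "path_word P = (A @ g) @ g @ C"
      using C by simp
    obtain xs1 b u xs2 where xs: "path_blocks P = xs1 @ (b, u) # xs2" "conjugate b g"
      "length (A @ g) < length (concat_blocks xs1) + length b"
      using path_window[OF P C' bg] by blast
    have "xs1 = []"
    proof (rule ccontr)
      assume ne: "xs1 \<noteq> []"
      then have "tl (path_blocks P) = tl xs1 @ (b, u) # xs2"
        unfolding xs(1) by simp
      moreover have "tl (path_blocks P) =
        map (\<lambda>f. (str_word (arrow_tgt f), str_word (arrow_str f))) (rev (butlast P)) @ [(str_word (path_src P), [])]"
        unfolding path_blocks_def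
        by (subst (1) append_butlast_last_id[OF bridge_path_not_Nil[OF P], symmetric]) simp
      ultimately have "(b, u) \<in> set (map (\<lambda>f. (str_word (arrow_tgt f), str_word (arrow_str f))) (rev (butlast P))
          @ [(str_word (path_src P), [])])"
        by (metis in_set_conv_decomp)
      then obtain d where d: "d \<in> insert (path_src P) (interior P)" "b = str_word d"
        by (auto simp: interior_def)
      then have "d \<in> Ba"
        using bridge_path_Ba(1)[OF P] interior_neq_ends(1)[OF P] by auto
      then have "d = c"
        using conj_eq xs(2) d(2) by blast
      then show False
        using d(1) ct ends interior_neq_ends(3)[OF P] by auto
    qed
    then show False
      using xs(3) conjugate_length[OF xs(2)] by simp
  qed
qed

end

section \<open>H-strings of paths\<close>

context domestic_string_algebra_bands
begin

lemma fold_hl_commute: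
  assumes "set L \<subseteq> Ba" "c \<in> Ba"
  shows "hl c (fold hl L Y) = fold hl L (hl c Y)"
  using assms(1)
proof (induction L arbitrary: Y)
  case (Cons b L)
  then show ?case
    using hl_commute[OF _ assms(2), of b Y] by simp
qed simp

lemma funpow_hl_commute:
  assumes "set L \<subseteq> Ba" "c \<in> Ba"
  shows "(hl c ^^ n) (fold hl L Y) = fold hl L ((hl c ^^ n) Y)"
  using fold_hl_commute[OF assms] by (induction n) auto

lemma fold_hl_fold_commute:
  assumes "set L \<subseteq> Ba" "set M \<subseteq> Ba"
  shows "fold hl L (fold hl M Y) = fold hl M (fold hl L Y)"
  using assms(1)
proof (induction L arbitrary: Y)
  case (Cons b L)
  then show ?case
    using fold_hl_commute[OF assms(2), of b Y] by simp
qed simp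

lemma fold_hl_mset:
  assumes "set L \<subseteq> Ba" "mset L = mset M"
  shows "fold hl L Y = fold hl M Y"
proof -
  have "hl x \<circ> hl y = hl y \<circ> hl x" if "x \<in> set L" "y \<in> set L" for x y
  proof
    fix Z
    show "(hl x \<circ> hl y) Z = (hl y \<circ> hl x) Z"
      using hl_commute[of x y Z] assms(1) that by auto
  qed
  then have "fold hl L = fold hl M"
    by (rule fold_multiset_equiv[OF _ assms(2)])
  then show ?thesis by simp
qed

lemma fold_hl_fixed:
  assumes "\<And>c. c \<in> set L \<Longrightarrow> hl c Y = Y"
  shows "fold hl L Y = Y"
  using assms by (induction L) auto

text \<open>All applications of \<open>c\<close> move to the front and become an iterate on the
  original word, where the bound by exponents applies.\<close>

lemma fold_hl_count:
  assumes "set L \<subseteq> Ba" "c \<in> Ba"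
  shows "fold hl L Y = fold hl (filter (\<lambda>b. b \<noteq> c) L) ((hl c ^^ count (mset L) c) Y)"
  using assms(1)
proof (induction L arbitrary: Y)
  case (Cons b L)
  show ?case
  proof (cases "b = c")
    case True
    then show ?thesis
      using Cons by (simp add: funpow_swap1)
  next
    case False
    have "(hl c ^^ n) (hl b Y) = hl b ((hl c ^^ n) Y)" for n
      using funpow_hl_commute[of "[b]" c n Y] Cons.prems assms(2) by simp
    then show ?thesis
      using Cons False by simp
  qed
qed simp

lemma fold_hl_end_bands:
  assumes "end_bands (str_word e) (str_word a) Y" "e \<in> Ba" "a \<in> Ba" "set L \<subseteq> Ba - {e, a}"
  shows "end_bands (str_word e) (str_word a) (fold hl L Y)"
  using assms(1,4)
proof (induction L arbitrary: Y)
  case (Cons c L)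
  have "end_bands (str_word e) (str_word a) (hl c Y)"
    using H_step_fun_end_bands[OF Cons.prems(1) Ba_is_band(4)] Ba_conjugate_eq assms(2,3) Cons.prems(2)
    by auto
  then show ?case using Cons by simp
qed simp

lemma foldr_H_reduct:
  assumes "end_bands (str_word e) (str_word a) Y" "e \<in> Ba" "a \<in> Ba" "set L \<subseteq> Ba - {e, a}"
  shows "foldr (H_reduct \<Lambda> Ba) L (Word Y) = Word (fold hl (rev L) Y)"
  using assms(4)
proof (induction L)
  case (Cons c L)
  have "end_bands (str_word e) (str_word a) (fold hl (rev L) Y)"
    using fold_hl_end_bands[OF assms(1-3)] Cons.prems by simp
  then show ?case
    using Cons H_reduct_eq[OF _ assms(2,3)] by simp
qed simp

lemma contains_pow_H_step:
  assumes Y: "end_bands e a Y" and c: "band_word c" "\<not> conjugate e c" "\<not> conjugate a c"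
    and "contains_pow c (Suc (Suc n)) Y"
  shows "\<exists>Z. H_step c Y Z \<and> contains_pow c (Suc n) Z"
proof -
  obtain A g B where g: "conjugate c g" "Y = A @ word_pow g (Suc (Suc n)) @ B" "sword Y"
    using assms(5) by (auto simp: contains_pow_def)
  \<comment> \<open>The same power is read with its first and with its last copy split off; the
    first reading shows that \<open>A\<close> is nonempty, the second that \<open>B\<close>
    is.\<close>
  have 1: "Y = A @ g @ word_pow g (Suc n) @ B"
    unfolding g(2) by simp
  have 2: "Y = (A @ word_pow g (Suc n)) @ g @ B"
    unfolding g(2) word_pow_Suc_right[of "Suc n"] by simp
  have "A \<noteq> []" "B \<noteq> []"
    using end_bands_window'(2)[OF Y c g(1) 1] end_bands_window'(3)[OF Y c g(1) 2] .
  then have "H_step c Y (A @ word_pow g (Suc n) @ B)"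
    using power_H_step[OF band_word_conjugate[OF c(1) g(1)] g(1)] g(2,3) by metis
  then show ?thesis
    using g(1) H_step_sword unfolding contains_pow_def by blast
qed

lemma funpow_H_step_fun_contains_pow:
  assumes Y: "end_bands e a Y" and c: "band_word c" "\<not> conjugate e c" "\<not> conjugate a c"
    and "contains_pow c k Y" "j < k"
  shows "contains_pow c (k - j) ((H_step_fun c ^^ j) Y) \<and> end_bands e a ((H_step_fun c ^^ j) Y)"
  using assms(6)
proof (induction j)
  case 0
  then show ?case using Y assms(5) by simp
next
  case (Suc j)
  let ?Y = "(H_step_fun c ^^ j) Y"
  have IH: "contains_pow c (k - j) ?Y" "end_bands e a ?Y"
    using Suc by simp_all
  have "k - j = Suc (Suc (k - Suc (Suc j)))"
    using Suc.prems by simp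
  then obtain Z where Z: "H_step c ?Y Z" "contains_pow c (Suc (k - Suc (Suc j))) Z"
    using contains_pow_H_step[OF IH(2) c] IH(1) by metis
  have "Suc (k - Suc (Suc j)) = k - Suc j"
    using Suc.prems by simp
  then show ?case
    using Z(2) H_step_fun_eq[OF c(1) Z(1)] H_step_end_bands[OF IH(2) c Z(1)] by simp
qed

lemma enabled_fold_hl:
  assumes "set L \<subseteq> Ba - {c}" "c \<in> Ba"
  shows "(\<exists>Z. H_step (str_word c) (fold hl L Y) Z) \<longleftrightarrow> (\<exists>Z. H_step (str_word c) Y Z)"
  using assms(1)
proof (induction L arbitrary: Y)
  case (Cons b L)
  then have "b \<in> Ba" "b \<noteq> c" by auto
  then have "(\<exists>Z. H_step (str_word c) (hl b Y) Z) \<longleftrightarrow> (\<exists>Z. H_step (str_word c) Y Z)"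
    using H_step_fun_enabled[OF Ba_is_band(4)[OF assms(2)] Ba_is_band(4)] Ba_conjugate_eq assms(2)
    by metis
  then show ?case
    using Cons by simp
qed simp

text \<open>The exponent is measured in \<open>Y\<close>, but the reductions act after the steps in
  \<open>L\<close>. Steps at other bands neither enable nor disable steps at \<open>c\<close>, so
  the removals that leave one copy of the power are still available there.\<close>

lemma funpow_reduct:
  assumes Y: "end_bands (str_word e) (str_word a) Y" "e \<in> Ba" "a \<in> Ba"
    and L: "set L \<subseteq> Ba - {e, a, c}" and c: "c \<in> Ba" "c \<noteq> e" "c \<noteq> a"
    and "j \<le> band_count \<Lambda> c (Word Y) - 1"
  shows "(reduct \<Lambda> c ^^ j) (Word (fold hl L Y)) = Word ((hl c ^^ j) (fold hl L Y))"
  using assms(8)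
proof (induction j)
  case (Suc j)
  let ?c = "str_word c" and ?k = "band_count \<Lambda> c (Word Y)"
  let ?W = "(hl c ^^ j) (fold hl L Y)"
  have cw: "band_word ?c" and cW: "c = Word ?c"
    using Ba_is_band[OF c(1)] by blast+
  have nc: "\<not> conjugate (str_word e) ?c" "\<not> conjugate (str_word a) ?c"
    using Ba_conjugate_eq Y(2,3) c by blast+
  have jk: "Suc j < ?k" using Suc.prems by simp
  have "contains_pow ?c ?k Y"
    using contains_pow_band_count[OF band_word_not_Nil[OF cw]] cW jk by simp
  then have Yj: "contains_pow ?c (?k - j) ((hl c ^^ j) Y)"
    "end_bands (str_word e) (str_word a) ((hl c ^^ j) Y)"
    using funpow_H_step_fun_contains_pow[OF Y(1) cw nc] jk by simp_all
  have "?k - j = Suc (Suc (?k - Suc (Suc j)))"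
    using jk by simp
  then have "\<exists>Z. H_step ?c ((hl c ^^ j) Y) Z"
    using contains_pow_H_step[OF Yj(2) cw nc] Yj(1) by metis
  moreover have W: "?W = fold hl L ((hl c ^^ j) Y)"
    using funpow_hl_commute[of L c] L c(1) by blast
  ultimately obtain Z where Z: "H_step ?c ?W Z"
    using enabled_fold_hl[of L c] L c(1) by auto
  have "end_bands (str_word e) (str_word a) ?W"
    unfolding W using fold_hl_end_bands[OF Yj(2) Y(2,3)] L by blast
  then have "reduct \<Lambda> c (Word ?W) = Word Z"
    using reduct_eq[OF _ cw nc H_step_is_reduction(1)[OF cw Z]] cW by simp
  then show ?case
    using Suc H_step_fun_eq[OF cw Z] by simp
qed simp

text \<open>Commutation of the folded functions is available only on words reached from the path, so
  \<open>Finite_Set.fold\<close> is evaluated through \<open>fold_graph\<close>: each order of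
  processing yields a list with prescribed multiplicities, and lists with equal multisets give equal
  words.\<close>

lemma skeleton_eq:
  assumes P: "P \<in> bridge_paths \<Lambda> Ba"
  shows "\<exists>L. set L \<subseteq> interior P \<and> skeleton \<Lambda> Ba (path_str P) = Word (fold hl L (path_word P)) \<and>
    (\<forall>b \<in> interior P. count (mset L) b = band_count \<Lambda> b (path_str P) - 1)"
proof -
  let ?k = "\<lambda>b. band_count \<Lambda> b (path_str P)"
  let ?F = "\<lambda>b. reduct \<Lambda> b ^^ (?k b - 1)"
  let ?B = "bands_in \<Lambda> Ba (path_str P)"
  let ?e = "path_tgt P" and ?a = "path_src P"
  have str: "path_str P = Word (path_word P)"
    by (rule path_str_eq[OF P])
  have E: "end_bands (str_word ?e) (str_word ?a) (path_word P)" "?e \<in> Ba" "?a \<in> Ba"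
    using path_word_end_bands[OF P] bridge_path_Ba[OF P] by auto
  have int: "interior P \<subseteq> Ba - {?e, ?a}"
    using interior_neq_ends[OF P] by blast
  have B: "?B \<subseteq> insert ?e (insert ?a (interior P))"
  proof
    fix b
    assume "b \<in> ?B"
    then have b: "b \<in> Ba" "?k b > 0"
      by (auto simp: bands_in_def)
    then obtain A g B where g: "conjugate (str_word b) g" "path_word P = A @ word_pow g (?k b) @ B"
      using contains_pow_band_count[OF band_word_not_Nil[OF Ba_is_band(4)[OF b(1)]]] Ba_is_band(3)[OF b(1)] str
      unfolding contains_pow_def by metis
    obtain m where "?k b = Suc m" using b(2) by (cases "?k b") auto
    then have "path_word P = A @ g @ word_pow g m @ B"
      using g(2) by simp
    then show "b \<in> insert ?e (insert ?a (interior P))"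
      using path_window_vertex[OF P b(1) _ g(1)] vertices_eq[OF bridge_path_not_Nil[OF P]] by blast
  qed
  then have fin: "finite ?B"
    by (rule finite_subset) (simp add: interior_def)
  have graph: "\<exists>L. set L \<subseteq> interior P \<inter> D \<and> y = Word (fold hl L (path_word P)) \<and>
      (\<forall>b \<in> interior P. count (mset L) b = (if b \<in> D then ?k b - 1 else 0))"
    if "fold_graph ?F (path_str P) D y" "D \<subseteq> ?B" for D y
    using that
  proof (induction rule: fold_graph.induct)
    case emptyI
    then show ?case by (intro exI[of _ "[]"]) (simp add: str)
  next
    case (insertI x D y)
    then obtain L where L: "set L \<subseteq> interior P \<inter> D" "y = Word (fold hl L (path_word P))"
      "\<forall>b \<in> interior P. count (mset L) b = (if b \<in> D then ?k b - 1 else 0)"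
      by auto
    show ?case
    proof (cases "x \<in> interior P")
      case True
      have rep: "fold hl (replicate n x) Z = (hl x ^^ n) Z" for n Z
        by (induction n arbitrary: Z) (simp_all add: funpow_swap1)
      have "set L \<subseteq> Ba - {?e, ?a, x}"
        using L(1) int insertI.hyps(1) by auto
      then have "?F x y = Word (fold hl (L @ replicate (?k x - 1) x) (path_word P))"
        unfolding L(2) fold_append comp_apply rep str
        by (rule funpow_reduct[OF E _ _ _ _ order_refl]) (use True int in auto)
      then show ?thesis
        using L True insertI.hyps(1)
        by (intro exI[of _ "L @ replicate (?k x - 1) x"]) auto
    next
      case False
      \<comment> \<open>An end band has count at most one, so truncated subtraction gives exponent 0
        and the band contributes nothing to the list.\<close>
      then have "x = ?e \<or> x = ?a"
        using insertI.prems B by auto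
      then have "?k x - 1 = 0"
        using band_count_path_ends[OF P] by auto
      then have "?F x y = y" by (simp only: funpow_0)
      then show ?thesis
        using L False by (intro exI[of _ L]) auto
    qed
  qed
  from finite_imp_fold_graph[OF fin, of ?F "path_str P"] obtain y
    where y: "fold_graph ?F (path_str P) ?B y" ..
  obtain L where L: "set L \<subseteq> interior P \<inter> ?B" "y = Word (fold hl L (path_word P))"
    "\<forall>b \<in> interior P. count (mset L) b = (if b \<in> ?B then ?k b - 1 else 0)"
    using graph[OF y] by blast
  have "y' = y" if y': "fold_graph ?F (path_str P) ?B y'" for y'
  proof -
    obtain M where M: "set M \<subseteq> interior P \<inter> ?B" "y' = Word (fold hl M (path_word P))"
      "\<forall>b \<in> interior P. count (mset M) b = (if b \<in> ?B then ?k b - 1 else 0)"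
      using graph[OF y'] by blast
    have "mset L = mset M"
    proof (rule multiset_eqI)
      fix b
      show "count (mset L) b = count (mset M) b"
      proof (cases "b \<in> interior P")
        case True
        then show ?thesis using L(3) M(3) by simp
      next
        case False
        then have "b \<notin># mset L" "b \<notin># mset M"
          using L(1) M(1) by auto
        then show ?thesis by (simp only: not_in_iff)
      qed
    qed
    moreover have "set L \<subseteq> Ba"
      using L(1) int by blast
    ultimately show ?thesis
      unfolding L(2) M(2) using fold_hl_mset[of L M] by simp
  qed
  with y have "(THE z. fold_graph ?F (path_str P) ?B z) = y"
    by (rule the_equality)
  then have "skeleton \<Lambda> Ba (path_str P) = y"
    unfolding skeleton_def Finite_Set.fold_def using fin by (simp only: if_True)
  moreover have "count (mset L) b = ?k b - 1" if "b \<in> interior P" for b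
  proof -
    have "b \<in> Ba" using that int by blast
    then have "b \<notin> ?B \<Longrightarrow> ?k b = 0" by (simp add: bands_in_def)
    then show ?thesis using L(3) that by auto
  qed
  ultimately show ?thesis
    using L(1,2) by blast
qed

section \<open>H-strings as normal forms, and their dependence on the two halves of a path\<close>

definition H_word :: "('v, 'a) arrow list \<Rightarrow> 'a syl list" where
  "H_word P = str_word (path_tgt P) @ str_word (H_string \<Lambda> Ba P) @ str_word (path_src P)"

text \<open>For empty \<open>u\<close> the middle factor has length 0, and composability with
  \<open>q\<close> fixes its vertex and sign. Hence \<open>H_string\<close> is well defined and can
  be recovered from the full word.\<close>

lemma unique_middle_factor:
  assumes "sword (p @ u @ q)" "p \<noteq> []" "q \<noteq> []"
  shows "\<exists>!x. factors \<Lambda> (Word (p @ u @ q)) (Word p) x (Word q)"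
proof -
  have uq: "sword (u @ q)" and q: "sword q"
    using assms sword_appendD(2)[of p "u @ q"] sword_appendD(2)[of "p @ u" q] by auto
  have p: "sword p"
    using assms sword_appendD(1) by blast
  show ?thesis
  proof (cases "u = []")
    case True
    let ?x = "Triv (syl_tgt \<Lambda> (hd q)) (syl_epsilon \<Lambda> (hd q))"
    have "factors \<Lambda> (Word (p @ u @ q)) (Word p) ?x (Word q)"
      unfolding factors_def composes_Triv_Word cat_Word composes_Word_Word
      using True assms q p is_string_Triv_hd[OF q] by simp
    moreover have "x = ?x" if "factors \<Lambda> (Word (p @ u @ q)) (Word p) x (Word q)" for x
    proof (cases x)
      case (Triv v i)
      then show ?thesis
        using that by (simp add: factors_def composes_Triv_Word)
    next
      case (Word w)
      then have "w = []"
        using factors_outer_Words[OF that] True by simp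
      then show ?thesis
        using that Word by (simp add: factors_def composes_def is_string.simps(2))
    qed
    ultimately show ?thesis by blast
  next
    case False
    have "factors \<Lambda> (Word (p @ u @ q)) (Word p) (Word u) (Word q)"
      using factors_Words[OF assms(1,2) False assms(3)] .
    moreover have "x = Word u" if "factors \<Lambda> (Word (p @ u @ q)) (Word p) x (Word q)" for x
      using factors_outer_Words[OF that] False by (cases x) auto
    ultimately show ?thesis by blast
  qed
qed

text \<open>The skeleton applies an interior band one time less than its exponent, and the list of
  interior targets adds at least one application. By then the exponent of the path word is used up.
  Since bands commute, each of them can be counted separately.\<close>

lemma H_word_facts:
  assumes P: "P \<in> bridge_paths \<Lambda> Ba"
  shows "\<exists>L. set L \<subseteq> interior P \<and> H_word P = fold hl L (path_word P)"
    and "\<And>c. c \<in> interior P \<Longrightarrow> hl c (H_word P) = H_word P"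
    and "H_string \<Lambda> Ba P = (THE u. factors \<Lambda> (Word (H_word P)) (path_tgt P) u (path_src P))"
proof -
  let ?e = "path_tgt P" and ?a = "path_src P"
  let ?k = "\<lambda>b. band_count \<Lambda> b (path_str P)"
  have E: "end_bands (str_word ?e) (str_word ?a) (path_word P)" "?e \<in> Ba" "?a \<in> Ba"
    using path_word_end_bands[OF P] bridge_path_Ba[OF P] by auto
  have int: "interior P \<subseteq> Ba - {?e, ?a}"
    using interior_neq_ends[OF P] by blast
  obtain L where L: "set L \<subseteq> interior P" "skeleton \<Lambda> Ba (path_str P) = Word (fold hl L (path_word P))"
    "\<forall>b \<in> interior P. count (mset L) b = ?k b - 1"
    using skeleton_eq[OF P] by blast
  define I where "I = map arrow_tgt (butlast P)"
  define M where "M = L @ rev I"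
  have I: "set I = interior P"
    by (simp add: I_def interior_def)
  have M: "set M = interior P"
    using L(1) I by (auto simp: M_def)
  then have MBa: "set M \<subseteq> Ba" "set M \<subseteq> Ba - {?e, ?a}"
    using int by auto
  have LE: "end_bands (str_word ?e) (str_word ?a) (fold hl L (path_word P))"
    using fold_hl_end_bands[OF E] L(1) int by blast
  have fr: "foldr (H_reduct \<Lambda> Ba) I (skeleton \<Lambda> Ba (path_str P)) = Word (fold hl M (path_word P))"
    using foldr_H_reduct[OF LE E(2,3), of I] I int L(2) by (simp add: M_def)
  have fixed: "hl c (fold hl M (path_word P)) = fold hl M (path_word P)" if c: "c \<in> interior P" for c
  proof -
    let ?n = "count (mset M) c"
    have cBa: "c \<in> Ba" using c int by blast
    note cw = Ba_is_band(3,4)[OF cBa]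
    have "count (mset I) c \<ge> 1"
      using c I by (simp add: Suc_le_eq)
    moreover have "?n = count (mset L) c + count (mset I) c"
      by (simp add: M_def)
    moreover have "count (mset L) c = ?k c - 1"
      using L(3) c by blast
    ultimately have "?n \<ge> ?k c"
      by linarith
    then have "\<not> contains_pow (str_word c) (Suc ?n) (path_word P)"
      using contains_pow_le_band_count[OF band_word_not_Nil[OF cw(2)], of "Suc ?n" "path_word P"] cw(1)
        path_str_eq[OF P] by auto
    then have "hl c ((hl c ^^ ?n) (path_word P)) = (hl c ^^ ?n) (path_word P)"
      by (rule H_step_fun_funpow_fixed[OF cw(2)])
    moreover have "set (filter (\<lambda>b. b \<noteq> c) M) \<subseteq> Ba"
      using MBa by auto
    ultimately show ?thesis
      unfolding fold_hl_count[OF MBa(1) cBa] by (simp only: fold_hl_commute cBa)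
  qed
  have ME: "end_bands (str_word ?e) (str_word ?a) (fold hl M (path_word P))"
    by (rule fold_hl_end_bands[OF E MBa(2)])
  then obtain u where u: "fold hl M (path_word P) = str_word ?e @ u @ str_word ?a"
    "sword (str_word ?e @ u @ str_word ?a)"
    by (auto simp: end_bands_def)
  have H: "H_string \<Lambda> Ba P = (THE u. factors \<Lambda> (Word (fold hl M (path_word P))) ?e u ?a)"
    unfolding H_string_def fr[unfolded I_def] ..
  obtain ew aw where ea: "?e = Word ew" "?a = Word aw"
    using Ba_is_band(3) E(2,3) by blast
  then have "ew \<noteq> []" "aw \<noteq> []"
    using band_word_not_Nil[OF Ba_is_band(4)[OF E(2)]] band_word_not_Nil[OF Ba_is_band(4)[OF E(3)]] by auto
  then have "\<exists>!x. factors \<Lambda> (Word (fold hl M (path_word P))) ?e x ?a"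
    unfolding u(1) using unique_middle_factor[of ew u aw] u(2) ea by simp
  then have fac: "factors \<Lambda> (Word (fold hl M (path_word P))) ?e (H_string \<Lambda> Ba P) ?a"
    unfolding H by (rule theI')
  have HM: "H_word P = fold hl M (path_word P)"
    unfolding H_word_def ea using factors_outer_Words[OF fac[unfolded ea]] by simp
  show "\<exists>L. set L \<subseteq> interior P \<and> H_word P = fold hl L (path_word P)"
    using HM M by blast
  show "\<And>c. c \<in> interior P \<Longrightarrow> hl c (H_word P) = H_word P"
    unfolding HM by (rule fixed)
  show "H_string \<Lambda> Ba P = (THE u. factors \<Lambda> (Word (H_word P)) (path_tgt P) u (path_src P))"
    unfolding HM by (rule H)
qed

text \<open>A step in \<open>Y\<close> stays a step after extension on the left, because the tail of
  its window is unchanged. \<open>M\<close> collects only the entries that act: one that is idle in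
  \<open>Y\<close> might act on the longer word and is left out.\<close>

lemma fold_hl_append_left:
  assumes "set L \<subseteq> Ba" "sword (X @ Y)" "Y \<noteq> []"
  shows "\<exists>M. set M \<subseteq> set L \<and> X @ fold hl L Y = fold hl M (X @ Y)"
  using assms
proof (induction L arbitrary: Y)
  case Nil
  then show ?case by (intro exI[of _ "[]"]) simp
next
  case (Cons c L)
  show ?case
  proof (cases "\<exists>Z. H_step (str_word c) Y Z")
    case True
    then obtain Z where Z: "H_step (str_word c) Y Z" ..
    then obtain A g B where g: "conjugate (str_word c) g" "A \<noteq> []" "B \<noteq> []" "Y = A @ g @ B" "Z = A @ B"
      "H_equiv_word (g @ B) B"
      by (auto simp: H_step_def)
    then have XZ: "H_step (str_word c) (X @ Y) (X @ Z)"
      unfolding H_step_def using Cons.prems(2)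
      by (intro exI[of _ "X @ A"] exI[of _ g] exI[of _ B]) simp
    have cw: "band_word (str_word c)"
      using Cons.prems(1) Ba_is_band(4) by simp
    have "sword (X @ Z)" "Z \<noteq> []" "set L \<subseteq> Ba"
      using H_step_sword[OF XZ] g Cons.prems(1) by auto
    then obtain M where "set M \<subseteq> set L" "X @ fold hl L Z = fold hl M (X @ Z)"
      using Cons.IH by blast
    then show ?thesis
      using H_step_fun_eq[OF cw Z] H_step_fun_eq[OF cw XZ] by (intro exI[of _ "c # M"]) auto
  next
    case False
    obtain M where "set M \<subseteq> set L" "X @ fold hl L Y = fold hl M (X @ Y)"
      using Cons.IH[OF _ Cons.prems(2,3)] Cons.prems(1) by auto
    then show ?thesis
      using H_step_fun_id[OF False] by (intro exI[of _ M]) auto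
  qed
qed

text \<open>Here the tail grows. Every window of a band other than the end bands lies before the
  block \<open>a\<close>, which is mixed, so \<open>H_equiv_word_append_right\<close> transfers the
  H-equivalence to the longer tail.\<close>

lemma fold_hl_append_right:
  assumes "set L \<subseteq> Ba - {e, a}" "end_bands (str_word e) (str_word a) Y" "e \<in> Ba" "a \<in> Ba"
    and "sword (str_word a @ R)"
  shows "\<exists>M. set M \<subseteq> set L \<and> fold hl L Y @ R = fold hl M (Y @ R)"
  using assms(1,2)
proof (induction L arbitrary: Y)
  case Nil
  then show ?case by (intro exI[of _ "[]"]) simp
next
  case (Cons c L)
  show ?case
  proof (cases "\<exists>Z. H_step (str_word c) Y Z")
    case True
    then obtain Z where Z: "H_step (str_word c) Y Z" ..
    then obtain A g B where g: "conjugate (str_word c) g" "A \<noteq> []" "B \<noteq> []" "Y = A @ g @ B" "Z = A @ B"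
      "sword Y" "H_equiv_word (g @ B) B"
      by (auto simp: H_step_def)
    have cBa: "c \<in> Ba" "c \<noteq> e" "c \<noteq> a" and LBa: "set L \<subseteq> Ba - {e, a}"
      using Cons.prems(1) by auto
    have cw: "band_word (str_word c)"
      using cBa Ba_is_band(4) by simp
    have nc: "\<not> conjugate (str_word e) (str_word c)" "\<not> conjugate (str_word a) (str_word c)"
      using Ba_conjugate_eq assms(3,4) cBa by blast+
    obtain B' where B': "B = B' @ str_word a"
      using end_bands_window'(1)[OF Cons.prems(2) cw nc g(1,4)] by blast
    have ma: "mixed (str_word a)"
      using band_word_mixed[OF Ba_is_band(4)[OF assms(4)]] .
    have "H_equiv_word (g @ B @ R) (B @ R)"
      using H_equiv_word_append_right[of "g @ B'" "str_word a" B' R] g(7) B' ma assms(5) by simp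
    moreover have "sword (Y @ R)"
      using sword_glue[OF _ assms(5) ma, of "A @ g @ B'"] g(4,6) B' by simp
    ultimately have ZR: "H_step (str_word c) (Y @ R) (Z @ R)"
      unfolding H_step_def using g
      by (intro exI[of _ A] exI[of _ g] exI[of _ "B @ R"]) simp
    have "end_bands (str_word e) (str_word a) Z"
      by (rule H_step_end_bands[OF Cons.prems(2) cw nc Z])
    then obtain M where "set M \<subseteq> set L" "fold hl L Z @ R = fold hl M (Z @ R)"
      using Cons.IH[OF LBa] by blast
    then show ?thesis
      using H_step_fun_eq[OF cw Z] H_step_fun_eq[OF cw ZR] by (intro exI[of _ "c # M"]) auto
  next
    case False
    obtain M where "set M \<subseteq> set L" "fold hl L Y @ R = fold hl M (Y @ R)"
      using Cons.IH[OF _ Cons.prems(2)] Cons.prems(1) by auto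
    then show ?thesis
      using H_step_fun_id[OF False] by (intro exI[of _ M]) auto
  qed
qed

lemma sword_H_word:
  assumes "P \<in> bridge_paths \<Lambda> Ba"
  shows "sword (H_word P)"
proof -
  obtain L where L: "set L \<subseteq> interior P" "H_word P = fold hl L (path_word P)"
    using H_word_facts(1)[OF assms] by blast
  have "interior P \<subseteq> Ba - {path_tgt P, path_src P}"
    using interior_neq_ends[OF assms] by blast
  then have "end_bands (str_word (path_tgt P)) (str_word (path_src P)) (H_word P)"
    unfolding L(2) using fold_hl_end_bands[OF path_word_end_bands[OF assms]] bridge_path_Ba[OF assms] L(1)
    by blast
  then show ?thesis by (simp add: end_bands_def)
qed

text \<open>The halves share the block of the junction band. After the reduction of \<open>P\<close>
  this block still ends the word of \<open>Q\<close>, so \<open>Q\<close> can be reduced with the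
  remainder \<open>R\<close> behind it. The word obtained depends on \<open>P\<close> and
  \<open>Q\<close> only through their H-strings and end bands.\<close>

lemma path_word_append_reduces:
  assumes P: "P \<in> bridge_paths \<Lambda> Ba" and Q: "Q \<in> bridge_paths \<Lambda> Ba" and PQ: "path_tgt P = path_src Q"
  shows "\<exists>L. set L \<subseteq> interior (P @ Q) \<and> fold hl L (path_word (P @ Q)) =
    str_word (path_tgt Q) @ str_word (H_string \<Lambda> Ba Q) @ H_word P"
proof -
  let ?b = "str_word (path_tgt P)"
  have ne: "P \<noteq> []" "Q \<noteq> []"
    using P Q bridge_path_not_Nil by auto
  have PQ': "P @ Q \<in> bridge_paths \<Lambda> Ba"
    using bridge_paths_append_iff[OF ne] P Q PQ by blast
  have W: "path_word (P @ Q) = path_prefix Q @ path_word P"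
    by (rule path_word_append[OF ne(1)])
  have "interior (P @ Q) = arrow_tgt ` set P \<union> interior Q"
    using ne by (auto simp: interior_def butlast_append)
  then have int: "interior P \<subseteq> interior (P @ Q)" "interior Q \<subseteq> interior (P @ Q)"
    using vertices_eq[OF ne(1)] by auto
  obtain L1 where L1: "set L1 \<subseteq> interior P" "H_word P = fold hl L1 (path_word P)"
    using H_word_facts(1)[OF P] by blast
  obtain L2 where L2: "set L2 \<subseteq> interior Q" "H_word Q = fold hl L2 (path_word Q)"
    using H_word_facts(1)[OF Q] by blast
  have "set L1 \<subseteq> Ba"
    using L1(1) interior_neq_ends(1)[OF P] by blast
  moreover have "sword (path_prefix Q @ path_word P)"
    using sword_path_word[OF PQ'] W by simp
  moreover have "path_word P \<noteq> []"
    using sword_path_word[OF P] sword_not_Nil by blast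
  ultimately obtain M1 where M1: "set M1 \<subseteq> set L1"
    "path_prefix Q @ H_word P = fold hl M1 (path_word (P @ Q))"
    using fold_hl_append_left L1(2) W by metis
  define R where "R = str_word (H_string \<Lambda> Ba P) @ str_word (path_src P)"
  have HP: "H_word P = ?b @ R"
    by (simp add: H_word_def R_def)
  have "path_prefix Q @ H_word P = path_word Q @ R"
    using HP PQ by (simp add: path_word_def)
  moreover have "set L2 \<subseteq> Ba - {path_tgt Q, path_src Q}"
    using L2(1) interior_neq_ends[OF Q] by blast
  moreover have "sword (str_word (path_src Q) @ R)"
    using sword_H_word[OF P] HP PQ by simp
  ultimately obtain M2 where M2: "set M2 \<subseteq> set L2"
    "H_word Q @ R = fold hl M2 (path_prefix Q @ H_word P)"
    using fold_hl_append_right[OF _ path_word_end_bands[OF Q]] bridge_path_Ba[OF Q] L2(2) by metis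
  have "H_word Q @ R = str_word (path_tgt Q) @ str_word (H_string \<Lambda> Ba Q) @ H_word P"
    using HP PQ by (simp add: H_word_def)
  then have "fold hl (M1 @ M2) (path_word (P @ Q)) =
      str_word (path_tgt Q) @ str_word (H_string \<Lambda> Ba Q) @ H_word P"
    using M1(2) M2(2) by simp
  moreover have "set (M1 @ M2) \<subseteq> interior (P @ Q)"
    using M1(1) M2(1) L1(1) L2(1) int by auto
  ultimately show ?thesis by blast
qed

text \<open>Stability at the interior bands of one path does not suffice for comparing paths with
  different interiors. A band off the path has no window in the path word and so no step there;
  commutation carries this over to \<open>H_word P\<close>.\<close>

lemma hl_H_word_fixed:
  assumes P: "P \<in> bridge_paths \<Lambda> Ba" and c: "c \<in> Ba" "c \<noteq> path_src P" "c \<noteq> path_tgt P"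
  shows "hl c (H_word P) = H_word P"
proof (cases "c \<in> interior P")
  case True
  then show ?thesis by (rule H_word_facts(2)[OF P])
next
  case False
  have "\<nexists>Z. H_step (str_word c) (path_word P) Z"
  proof
    assume "\<exists>Z. H_step (str_word c) (path_word P) Z"
    then obtain A g B where "conjugate (str_word c) g" "path_word P = A @ g @ B"
      by (auto simp: H_step_def)
    then show False
      using path_window_vertex[OF P c(1)] vertices_eq[OF bridge_path_not_Nil[OF P]] False c by blast
  qed
  then have "hl c (path_word P) = path_word P"
    by (rule H_step_fun_id)
  moreover obtain L where L: "set L \<subseteq> interior P" "H_word P = fold hl L (path_word P)"
    using H_word_facts(1)[OF P] by blast
  moreover have "set L \<subseteq> Ba"
    using L(1) interior_neq_ends(1)[OF P] by blast
  ultimately show ?thesis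
    using fold_hl_commute[OF _ c(1)] by simp
qed

lemma H_arrow_append_cong:
  assumes P: "P \<in> bridge_paths \<Lambda> Ba" "Q \<in> bridge_paths \<Lambda> Ba" "path_tgt P = path_src Q"
    and P': "P' \<in> bridge_paths \<Lambda> Ba" "Q' \<in> bridge_paths \<Lambda> Ba" "path_tgt P' = path_src Q'"
    and eq: "H_arrow \<Lambda> Ba P = H_arrow \<Lambda> Ba P'" "H_arrow \<Lambda> Ba Q = H_arrow \<Lambda> Ba Q'"
  shows "H_arrow \<Lambda> Ba (P @ Q) = H_arrow \<Lambda> Ba (P' @ Q')"
proof -
  have ne: "P \<noteq> []" "Q \<noteq> []" "P' \<noteq> []" "Q' \<noteq> []"
    using P P' bridge_path_not_Nil by auto
  have bp: "P @ Q \<in> bridge_paths \<Lambda> Ba" "P' @ Q' \<in> bridge_paths \<Lambda> Ba"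
    using bridge_paths_append_iff[OF ne(1,2)] bridge_paths_append_iff[OF ne(3,4)] P P' by blast+
  have ends: "path_src (P @ Q) = path_src (P' @ Q')" "path_tgt (P @ Q) = path_tgt (P' @ Q')"
    using eq ne by (auto simp: H_arrow_def path_src_def path_tgt_def)
  \<comment> \<open>\<open>G\<close> is built from the two arrows alone, so it is a common reduct of
    both path words, and further steps lead from it to either H-word.\<close>
  define G where "G = str_word (path_tgt Q) @ str_word (H_string \<Lambda> Ba Q) @ H_word P"
  have G': "G = str_word (path_tgt Q') @ str_word (H_string \<Lambda> Ba Q') @ H_word P'"
    using eq by (simp add: G_def H_word_def H_arrow_def)
  have red: "\<exists>L. set L \<subseteq> interior R \<and> H_word R = fold hl L G"
    if R: "R \<in> bridge_paths \<Lambda> Ba" and M: "\<exists>M. set M \<subseteq> interior R \<and> fold hl M (path_word R) = G" for R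
  proof -
    obtain L where L: "set L \<subseteq> interior R" "H_word R = fold hl L (path_word R)"
      using H_word_facts(1)[OF R] by blast
    obtain M where M: "set M \<subseteq> interior R" "fold hl M (path_word R) = G"
      using M by blast
    have "set L \<subseteq> Ba" "set M \<subseteq> Ba"
      using L(1) M(1) interior_neq_ends(1)[OF R] by blast+
    then have "fold hl L G = fold hl M (H_word R)"
      unfolding L(2) M(2)[symmetric] by (rule fold_hl_fold_commute)
    also have "\<dots> = H_word R"
      using H_word_facts(2)[OF R] M(1) by (intro fold_hl_fixed) blast
    finally show ?thesis using L(1) by metis
  qed
  obtain L where L: "set L \<subseteq> interior (P @ Q)" "H_word (P @ Q) = fold hl L G"
    using red[OF bp(1)] path_word_append_reduces[OF P] unfolding G_def by blast
  obtain L' where L': "set L' \<subseteq> interior (P' @ Q')" "H_word (P' @ Q') = fold hl L' G"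
    using red[OF bp(2)] path_word_append_reduces[OF P'] unfolding G' by blast
  have Ba: "set L \<subseteq> Ba - {path_src (P @ Q), path_tgt (P @ Q)}"
    "set L' \<subseteq> Ba - {path_src (P @ Q), path_tgt (P @ Q)}"
    unfolding atomize_conj
    using L(1) L'(1) interior_neq_ends[OF bp(1)] interior_neq_ends[OF bp(2), folded ends] by blast
  \<comment> \<open>The H-word of each path is also fixed by the steps leading to the other one.
    Both lists of steps applied to \<open>G\<close> therefore give either H-word, depending on the
    order, and the order does not matter.\<close>
  have "H_word (P @ Q) = fold hl L' (H_word (P @ Q))"
    by (rule fold_hl_fixed[symmetric], rule hl_H_word_fixed[OF bp(1)]) (use Ba(2) in blast)+
  also have "\<dots> = fold hl L (H_word (P' @ Q'))"
    unfolding L(2) L'(2) using Ba by (intro fold_hl_fold_commute) auto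
  also have "\<dots> = H_word (P' @ Q')"
    by (rule fold_hl_fixed, rule hl_H_word_fixed[OF bp(2)]) (use Ba(1)[unfolded ends] in blast)+
  finally have "H_string \<Lambda> Ba (P @ Q) = H_string \<Lambda> Ba (P' @ Q')"
    using H_word_facts(3)[OF bp(1)] H_word_facts(3)[OF bp(2)] ends by simp
  then show ?thesis
    using ends by (simp add: H_arrow_def)
qed

lemma H_comp_H_arrow:
  assumes "P \<in> bridge_paths \<Lambda> Ba" "Q \<in> bridge_paths \<Lambda> Ba" "path_tgt P = path_src Q"
  shows "H_comp_defined \<Lambda> Ba (H_arrow \<Lambda> Ba Q) (H_arrow \<Lambda> Ba P) \<and>
    H_comp \<Lambda> Ba (H_arrow \<Lambda> Ba Q) (H_arrow \<Lambda> Ba P) = H_arrow \<Lambda> Ba (P @ Q)"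
proof -
  have "is_H_comp \<Lambda> Ba (H_arrow \<Lambda> Ba Q) (H_arrow \<Lambda> Ba P) h \<longleftrightarrow> h = H_arrow \<Lambda> Ba (P @ Q)" for h
    unfolding is_H_comp_def using assms H_arrow_append_cong[OF assms] by metis
  then show ?thesis
    by (simp add: H_comp_defined_def H_comp_def)
qed

end

theorem theorem7p6:
  fixes \<Lambda> :: "('v, 'a) string_pres"
    and Ba :: "('v, 'a) str set"
    and b0 b1 b2 b3 u1 u2 u3 :: "('v, 'a) str"
  assumes "string_algebra \<Lambda>"
    and "domestic \<Lambda>"
    and "band_representatives \<Lambda> Ba"
    and "(b0, u1, b1) \<in> weak_arch_bridges \<Lambda> Ba"
    and "(b1, u2, b2) \<in> weak_arch_bridges \<Lambda> Ba"
    and "(b2, u3, b3) \<in> weak_arch_bridges \<Lambda> Ba"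
  shows "H_comp_defined \<Lambda> Ba (b1, u2, b2) (b0, u1, b1) \<and>
    H_comp_defined \<Lambda> Ba (b2, u3, b3) (b1, u2, b2) \<and>
    H_comp_defined \<Lambda> Ba (b2, u3, b3) (H_comp \<Lambda> Ba (b1, u2, b2) (b0, u1, b1)) \<and>
    H_comp_defined \<Lambda> Ba (H_comp \<Lambda> Ba (b2, u3, b3) (b1, u2, b2)) (b0, u1, b1) \<and>
    H_comp \<Lambda> Ba (b2, u3, b3) (H_comp \<Lambda> Ba (b1, u2, b2) (b0, u1, b1)) =
    H_comp \<Lambda> Ba (H_comp \<Lambda> Ba (b2, u3, b3) (b1, u2, b2)) (b0, u1, b1)"
proof -
  interpret domestic_string_algebra_bands \<Lambda> Ba
    using assms(1-3)
    by (simp add: domestic_string_algebra_bands_def domestic_string_algebra_def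
        domestic_string_algebra_axioms_def domestic_string_algebra_bands_axioms_def)
  obtain P1 P2 P3 where P: "P1 \<in> bridge_paths \<Lambda> Ba" "P2 \<in> bridge_paths \<Lambda> Ba" "P3 \<in> bridge_paths \<Lambda> Ba"
    and H: "(b0, u1, b1) = H_arrow \<Lambda> Ba P1" "(b1, u2, b2) = H_arrow \<Lambda> Ba P2" "(b2, u3, b3) = H_arrow \<Lambda> Ba P3"
    using assms(4-6) unfolding weak_arch_bridges_def by blast
  have ne: "P1 \<noteq> []" "P2 \<noteq> []" "P3 \<noteq> []"
    using P bridge_path_not_Nil by auto
  have ends: "path_tgt P1 = path_src P2" "path_tgt P2 = path_src P3"
    using H by (simp_all add: H_arrow_def)
  have P12: "P1 @ P2 \<in> bridge_paths \<Lambda> Ba" and P23: "P2 @ P3 \<in> bridge_paths \<Lambda> Ba"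
    using bridge_paths_append_iff P ends ne by blast+
  have ends': "path_tgt (P1 @ P2) = path_src P3" "path_tgt P1 = path_src (P2 @ P3)"
    using ends ne by (simp_all add: path_tgt_def path_src_def)
  note C = H_comp_H_arrow[OF P(1,2) ends(1)] H_comp_H_arrow[OF P(2,3) ends(2)]
    H_comp_H_arrow[OF P12 P(3) ends'(1)] H_comp_H_arrow[OF P(1) P23 ends'(2)]
  show ?thesis
    unfolding H using C by simp
qed

end
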